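(* Assume (C0), (C1), (C2) for a potential $g$ and a frequency $\omega>0$, and suppose that either (i) $\gamma<0$ and there is $k\in\mathbb{N}_{odd}$ with $\Phi_k'(0)>0$, or (ii) $\gamma>0$ and there is $k\in\mathbb{N}_{odd}$ with $\Phi_k'(0)<0$. Then $g(x)w_{tt}-w_{xx}+h(x)(w_t^3)_t=0$ has a nontrivial, real-valued, $T$-periodic weak solution $w$ with $T=2\pi/\omega$, and there is $C>0$ such that $|w(x,t)|\le Ce^{-\rho|x|}$ for all $(x,t)\in\mathbb{R}^2$, with $\rho$ the constant from (C2).
   Context: Let $\omega>0$, $T=2\pi/\omega$, $\mathbb{T}_T=\mathbb{R}/T\mathbb{Z}$, $D=\mathbb{R}\times\mathbb{T}_T$; $\mathbb{N}_{odd}$ denotes the positive odd integers. (C0): $g\in L^\infty(\mathbb{R})$ is even, $g\not\equiv 0$, and $h=\gamma\delta_0$ with $\gamma\in\mathbb{R}\setminus\{0\}$ ($\delta_0$ the Dirac delta at $0$). For $k\in\mathbb{N}_{odd}$, $L_k=-\frac{d^2}{dx^2}-k^2\omega^2g(x)$ is the self-adjoint operator on $L^2(\mathbb{R})$ with domain $H^2(\mathbb{R})$; $\sigma_D(L_k)$ is the spectrum of $L_k$ restricted to $\{\varphi\in H^2(\mathbb{R}):\varphi(0)=0\}$. (C1): for all $k\in\mathbb{N}_{odd}$, $0\notin\sigma_{ess}(L_k)\cup\sigma_D(L_k)$. Under (C0),(C1), for each $k\in\mathbb{N}_{odd}$ fix a function $\Phi_k\in H^2(0,\infty)$ with $L_k\Phi_k=0$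 on $(0,\infty)$ and $\Phi_k(0)=1$ (such a function exists). (C2): there exist $\rho,M>0$ such that $|\Phi_k(x)|\le Me^{-\rho x}$ for all $x\ge0$ and all $k\in\mathbb{N}_{odd}$. A weak solution of $g(x)w_{tt}-w_{xx}+h(x)(w_t^3)_t=0$ is a real function $w\in H^1(D)$ with $\partial_t w(0,\cdot)\in L^3(\mathbb{T}_T)$ such that for every $\psi\in C_c^\infty(D)$ $$\int_D\big(-g(x)\,\partial_tw\,\partial_t\psi+\partial_xw\,\partial_x\psi\big)\,d(x,t)-\gamma\int_0^T(\partial_tw(0,t))^3\,\partial_t\psi(0,t)\,dt=0.$$ *)

theory Defs
  imports "HOL-Analysis.Analysis"
begin

definition smooth1 :: "(real \<Rightarrow> real) \<Rightarrow> bool" where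
  "smooth1 \<phi> \<longleftrightarrow> (\<forall>n x. ((deriv ^^ n) \<phi>) differentiable (at x))"

definition test_fun_on :: "real set \<Rightarrow> (real \<Rightarrow> real) \<Rightarrow> bool" where
  "test_fun_on U \<phi> \<longleftrightarrow> smooth1 \<phi> \<and> compact (closure {x. \<phi> x \<noteq> 0})
      \<and> closure {x. \<phi> x \<noteq> 0} \<subseteq> U"

definition weak_deriv_on :: "real set \<Rightarrow> (real \<Rightarrow> 'a::{banach,second_countable_topology})
    \<Rightarrow> (real \<Rightarrow> 'a) \<Rightarrow> bool" where
  "weak_deriv_on U u v \<longleftrightarrow> (\<forall>\<phi>. test_fun_on U \<phi> \<longrightarrow>
      integrable lborel (\<lambda>x. deriv \<phi> x *\<^sub>R u x) \<and> integrable lborel (\<lambda>x. \<phi> x *\<^sub>R v x) \<and>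
      (\<integral>x. deriv \<phi> x *\<^sub>R u x \<partial>lborel) = - (\<integral>x. \<phi> x *\<^sub>R v x \<partial>lborel))"

definition L2_on :: "real set \<Rightarrow> (real \<Rightarrow> 'a::{banach,second_countable_topology}) \<Rightarrow> bool" where
  "L2_on S f \<longleftrightarrow> (\<lambda>x. indicator S x *\<^sub>R f x) \<in> borel_measurable lborel
      \<and> set_integrable lborel S (\<lambda>x. (norm (f x))\<^sup>2)"

definition L2norm :: "(real \<Rightarrow> complex) \<Rightarrow> real" where
  "L2norm f = sqrt (\<integral>x. (cmod (f x))\<^sup>2 \<partial>lborel)"

text \<open>Graph of the operator  u \<mapsto> -u'' - V u  on L^2(R) (complex valued).  Elements of the
  domain are represented by their continuous representatives; the second-order weak
  derivatives are taken on the open set U; B is an extra (boundary) condition.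
  U = UNIV, B = True gives the operator with domain H^2(R);
  U = R\<setminus>{0}, B u = (u 0 = 0) gives the Dirichlet operator with domain
  {u \<in> H^1(R) : u(0)=0, u \<in> H^2 on both half lines}.\<close>
definition schr_graph :: "real set \<Rightarrow> ((real \<Rightarrow> complex) \<Rightarrow> bool) \<Rightarrow> (real \<Rightarrow> real)
    \<Rightarrow> ((real \<Rightarrow> complex) \<times> (real \<Rightarrow> complex)) set" where
  "schr_graph U B V = {(u, f). continuous_on UNIV u \<and> B u \<and> L2_on UNIV u \<and> L2_on UNIV f \<and>
      (\<exists>u1 u2. L2_on UNIV u1 \<and> L2_on UNIV u2 \<and> weak_deriv_on U u u1 \<and> weak_deriv_on U u1 u2 \<and>
         (AE x in lborel. f x = - u2 x - complex_of_real (V x) * u x))}"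

definition resolvent_set :: "((real \<Rightarrow> complex) \<times> (real \<Rightarrow> complex)) set \<Rightarrow> complex set" where
  "resolvent_set G = {z. (\<forall>f. L2_on UNIV f \<longrightarrow> (\<exists>u. (u, \<lambda>x. z * u x + f x) \<in> G)) \<and>
      (\<exists>C. \<forall>(u, f) \<in> G. L2norm u \<le> C * L2norm (\<lambda>x. f x - z * u x))}"

definition spectrum_op :: "((real \<Rightarrow> complex) \<times> (real \<Rightarrow> complex)) set \<Rightarrow> complex set" where
  "spectrum_op G = - resolvent_set G"

definition eigenspace_op :: "((real \<Rightarrow> complex) \<times> (real \<Rightarrow> complex)) set \<Rightarrow> complex
    \<Rightarrow> (real \<Rightarrow> complex) set" where
  "eigenspace_op G z = {u. (u, \<lambda>x. z * u x) \<in> G}"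

definition is_eigenvalue :: "((real \<Rightarrow> complex) \<times> (real \<Rightarrow> complex)) set \<Rightarrow> complex \<Rightarrow> bool" where
  "is_eigenvalue G z \<longleftrightarrow> (\<exists>u \<in> eigenspace_op G z. \<not> (AE x in lborel. u x = 0))"

definition finite_multiplicity :: "((real \<Rightarrow> complex) \<times> (real \<Rightarrow> complex)) set \<Rightarrow> complex \<Rightarrow> bool" where
  "finite_multiplicity G z \<longleftrightarrow> (\<exists>Bs. finite Bs \<and> Bs \<subseteq> eigenspace_op G z \<and>
      (\<forall>u \<in> eigenspace_op G z. \<exists>c. AE x in lborel. u x = (\<Sum>b\<in>Bs. c b * b x)))"

definition discrete_spectrum :: "((real \<Rightarrow> complex) \<times> (real \<Rightarrow> complex)) set \<Rightarrow> complex set" where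
  "discrete_spectrum G = {z \<in> spectrum_op G. (\<exists>e>0. \<forall>\<mu> \<in> spectrum_op G. \<mu> \<noteq> z \<longrightarrow> e \<le> cmod (\<mu> - z))
      \<and> is_eigenvalue G z \<and> finite_multiplicity G z}"

definition ess_spectrum :: "((real \<Rightarrow> complex) \<times> (real \<Rightarrow> complex)) set \<Rightarrow> complex set" where
  "ess_spectrum G = spectrum_op G - discrete_spectrum G"

definition Lk_graph :: "(real \<Rightarrow> real) \<Rightarrow> real \<Rightarrow> nat \<Rightarrow> ((real \<Rightarrow> complex) \<times> (real \<Rightarrow> complex)) set" where
  "Lk_graph g \<omega> k = schr_graph UNIV (\<lambda>_. True) (\<lambda>x. (real k)\<^sup>2 * \<omega>\<^sup>2 * g x)"

definition LkD_graph :: "(real \<Rightarrow> real) \<Rightarrow> real \<Rightarrow> nat \<Rightarrow> ((real \<Rightarrow> complex) \<times> (real \<Rightarrow> complex)) set" where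
  "LkD_graph g \<omega> k = schr_graph (- {0}) (\<lambda>u. u 0 = 0) (\<lambda>x. (real k)\<^sup>2 * \<omega>\<^sup>2 * g x)"

text \<open>\<Phi> \<in> H^2(0,\<infinity>) (continuous representative on [0,\<infinity>)), L_k \<Phi> = 0 on (0,\<infinity>), \<Phi>(0) = 1.\<close>
definition is_Phi :: "(real \<Rightarrow> real) \<Rightarrow> real \<Rightarrow> nat \<Rightarrow> (real \<Rightarrow> real) \<Rightarrow> bool" where
  "is_Phi g \<omega> k \<Phi> \<longleftrightarrow> continuous_on {0..} \<Phi> \<and> L2_on {0<..} \<Phi> \<and>
     (\<exists>p1 p2. L2_on {0<..} p1 \<and> L2_on {0<..} p2 \<and>
        weak_deriv_on {0<..} \<Phi> p1 \<and> weak_deriv_on {0<..} p1 p2 \<and>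
        (AE x in lborel. 0 < x \<longrightarrow> - p2 x - (real k)\<^sup>2 * \<omega>\<^sup>2 * g x * \<Phi> x = 0)) \<and>
     \<Phi> 0 = 1"

definition dx :: "(real \<Rightarrow> real \<Rightarrow> real) \<Rightarrow> real \<Rightarrow> real \<Rightarrow> real" where
  "dx \<psi> = (\<lambda>x t. deriv (\<lambda>y. \<psi> y t) x)"

definition dt :: "(real \<Rightarrow> real \<Rightarrow> real) \<Rightarrow> real \<Rightarrow> real \<Rightarrow> real" where
  "dt \<psi> = (\<lambda>x t. deriv (\<lambda>s. \<psi> x s) t)"

primrec pd :: "bool list \<Rightarrow> (real \<Rightarrow> real \<Rightarrow> real) \<Rightarrow> real \<Rightarrow> real \<Rightarrow> real" where
  "pd [] \<psi> = \<psi>"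
| "pd (b # bs) \<psi> = (if b then dx (pd bs \<psi>) else dt (pd bs \<psi>))"

definition smooth2 :: "(real \<Rightarrow> real \<Rightarrow> real) \<Rightarrow> bool" where
  "smooth2 \<psi> \<longleftrightarrow> (\<forall>bs. continuous_on UNIV (\<lambda>z. pd bs \<psi> (fst z) (snd z)) \<and>
      (\<forall>x t. (\<lambda>y. pd bs \<psi> y t) differentiable (at x) \<and> (\<lambda>s. pd bs \<psi> x s) differentiable (at t)))"

text \<open>C_c^infinity(D), D = R \<times> R/TZ: smooth, T-periodic in t, compact support in x.\<close>
definition test_fun_D :: "real \<Rightarrow> (real \<Rightarrow> real \<Rightarrow> real) \<Rightarrow> bool" where
  "test_fun_D T \<psi> \<longleftrightarrow> smooth2 \<psi> \<and> (\<forall>x t. \<psi> x (t + T) = \<psi> x t) \<and>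
      (\<exists>R. \<forall>x t. R < \<bar>x\<bar> \<longrightarrow> \<psi> x t = 0)"

definition intD :: "real \<Rightarrow> (real \<Rightarrow> real \<Rightarrow> real) \<Rightarrow> real" where
  "intD T F = (LINT z:(UNIV \<times> {0..T})|lborel. F (fst z) (snd z))"

definition integrableD :: "real \<Rightarrow> (real \<Rightarrow> real \<Rightarrow> real) \<Rightarrow> bool" where
  "integrableD T F \<longleftrightarrow> set_integrable lborel (UNIV \<times> {0..T}) (\<lambda>z. F (fst z) (snd z))"

definition L2_D :: "real \<Rightarrow> (real \<Rightarrow> real \<Rightarrow> real) \<Rightarrow> bool" where
  "L2_D T F \<longleftrightarrow> (\<lambda>z. indicator (UNIV \<times> {0..T}) z * F (fst z) (snd z)) \<in> borel_measurable lborel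
      \<and> integrableD T (\<lambda>x t. (F x t)\<^sup>2)"

definition weak_dx_D :: "real \<Rightarrow> (real \<Rightarrow> real \<Rightarrow> real) \<Rightarrow> (real \<Rightarrow> real \<Rightarrow> real) \<Rightarrow> bool" where
  "weak_dx_D T w v \<longleftrightarrow> (\<forall>\<psi>. test_fun_D T \<psi> \<longrightarrow>
      integrableD T (\<lambda>x t. w x t * dx \<psi> x t) \<and> integrableD T (\<lambda>x t. v x t * \<psi> x t) \<and>
      intD T (\<lambda>x t. w x t * dx \<psi> x t) = - intD T (\<lambda>x t. v x t * \<psi> x t))"

definition weak_dt_D :: "real \<Rightarrow> (real \<Rightarrow> real \<Rightarrow> real) \<Rightarrow> (real \<Rightarrow> real \<Rightarrow> real) \<Rightarrow> bool" where
  "weak_dt_D T w v \<longleftrightarrow> (\<forall>\<psi>. test_fun_D T \<psi> \<longrightarrow>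
      integrableD T (\<lambda>x t. w x t * dt \<psi> x t) \<and> integrableD T (\<lambda>x t. v x t * \<psi> x t) \<and>
      intD T (\<lambda>x t. w x t * dt \<psi> x t) = - intD T (\<lambda>x t. v x t * \<psi> x t))"

definition weak_deriv_T :: "real \<Rightarrow> (real \<Rightarrow> real) \<Rightarrow> (real \<Rightarrow> real) \<Rightarrow> bool" where
  "weak_deriv_T T u v \<longleftrightarrow> (\<forall>\<eta>. smooth1 \<eta> \<and> (\<forall>t. \<eta> (t + T) = \<eta> t) \<longrightarrow>
      set_integrable lborel {0..T} (\<lambda>t. u t * deriv \<eta> t) \<and> set_integrable lborel {0..T} (\<lambda>t. v t * \<eta> t) \<and>
      (LINT t:{0..T}|lborel. u t * deriv \<eta> t) = - (LINT t:{0..T}|lborel. v t * \<eta> t))"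

text \<open>Real T-periodic weak solution of g w_tt - w_xx + \<gamma> \<delta>_0 (w_t^3)_t = 0, with
  T = 2\<pi>/\<omega>.  w is taken to be its continuous representative, so that w(0,.) is its trace
  on x = 0; wx, wt are the weak derivatives of w (w \<in> H^1(D)), and v = \<partial>_t w(0,.) \<in> L^3.\<close>
definition weak_solution :: "(real \<Rightarrow> real) \<Rightarrow> real \<Rightarrow> real \<Rightarrow> (real \<Rightarrow> real \<Rightarrow> real) \<Rightarrow> bool" where
  "weak_solution g \<gamma> \<omega> w \<longleftrightarrow> (let T = 2 * pi / \<omega> in
     continuous_on UNIV (\<lambda>z. w (fst z) (snd z)) \<and> (\<forall>x t. w x (t + T) = w x t) \<and>
     L2_D T w \<and>
     (\<exists>wx wt v. L2_D T wx \<and> L2_D T wt \<and> weak_dx_D T w wx \<and> weak_dt_D T w wt \<and>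
        weak_deriv_T T (\<lambda>t. w 0 t) v \<and>
        (\<lambda>t. indicator {0..T} t * v t) \<in> borel_measurable lborel \<and>
        set_integrable lborel {0..T} (\<lambda>t. \<bar>v t\<bar> ^ 3) \<and>
        (\<forall>\<psi>. test_fun_D T \<psi> \<longrightarrow>
           intD T (\<lambda>x t. - g x * wt x t * dt \<psi> x t + wx x t * dx \<psi> x t)
           - \<gamma> * (LINT t:{0..T}|lborel. (v t) ^ 3 * dt \<psi> 0 t) = 0)))"

end

theory Submission
  imports Defs "HOL-Complex_Analysis.Great_Picard" "HOL-Computational_Algebra.Polynomial"
begin

text \<open>The ansatz \<open>w(x,t) = \<Sum>\<^sub>k c\<^sub>k / (\<omega>k) \<Phi>\<^sub>k(\<bar>x\<bar>) sin (\<omega>kt)\<close>, \<open>k\<close> odd, solves the linear equation away from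
  \<open>x = 0\<close>, and the jump of \<open>w\<^sub>x\<close> at \<open>0\<close> turns the full equation into one for \<open>v = w\<^sub>t(0,\<cdot>) = \<Sum>\<^sub>k c\<^sub>k cos (\<omega>kt)\<close>:
  the \<open>k\<close>-th Fourier coefficient of \<open>\<gamma> v\<^sup>3\<close> must be \<open>- 2 \<Phi>\<^sub>k'(0) / (\<omega>k)\<^sup>2 c\<^sub>k\<close>. This is the Euler-Lagrange equation of
  \<open>\<bar>\<gamma>\<bar>/4 \<integral> v\<^sup>4 - 1/2 \<Sum>\<^sub>k b\<^sub>k c\<^sub>k\<^sup>2\<close> with \<open>b\<^sub>k\<close> a positive multiple of \<open>- sgn \<gamma> \<Phi>\<^sub>k'(0) / k\<^sup>2\<close>. Interpolating between the
  uniform bounds on \<open>\<Phi>\<^sub>k\<close> and \<open>\<Phi>\<^sub>k'' = O(k\<^sup>2)\<close> gives \<open>\<Phi>\<^sub>k'(0) = O(k)\<close>, so \<open>b\<^sub>k \<longrightarrow> 0\<close> and the quadratic part is compact;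
  Clarkson's inequality then makes minimising sequences of trigonometric polynomials Cauchy in \<open>L\<^sup>4\<close>. The sign condition
  says that some \<open>b\<^sub>k\<close> is positive, so that the minimum is negative and the minimiser is not zero.\<close>

section \<open>Minimisation over an orthogonal system\<close>

text \<open>A critical point of the energy fixes only the coefficients of v^3 against the odd
  cosines, whereas a weak solution is tested with arbitrary periodic traces. Symmetry closes the
  gap: odd cosines change sign under a shift by T/2 and are invariant under t -> T - t, cubes
  inherit both properties, and these survive the passage to the limit, so that all other
  coefficients of v^3 vanish.

  The regularity is borderline. The sequence c is only in l^2: the factor 1/(\<omega>k) makes the
  series of w absolutely convergent, but those of w_t and w_x are obtained in L^2 only, the latter
  because \<Phi>_k'/k decays exponentially with one constant for all k. Each identity is therefore
  proved for a single mode and summed through pairings with test functions. The same estimate puts b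
  in l^2, so that the linear side of the Euler-Lagrange equation is a uniformly convergent series.

  Since g is merely bounded and measurable, \<Phi>_k'' is known only almost everywhere. For this
  reason \<Phi>_k is identified with an iterated tail integral of -(\<omega>k)^2 g \<Phi>_k, whose
  first derivative is explicit and continuous.\<close>

lemma add_power_le:
  fixes a b :: real
  assumes "0 \<le> a" "0 \<le> b"
  shows "(a + b) ^ p \<le> 2 ^ p * (a ^ p + b ^ p)"
proof -
  have "(a + b) ^ p \<le> (2 * max a b) ^ p"
    using assms by (intro power_mono) auto
  also have "\<dots> = 2 ^ p * max a b ^ p"
    by (simp add: power_mult_distrib)
  also have "\<dots> \<le> 2 ^ p * (a ^ p + b ^ p)"
    using assms by (intro mult_left_mono) (auto simp: max_def)
  finally show ?thesis .
qed

text \<open>A fast subsequence has increments d_k whose p-th powers have integral at most 4^(-pk).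
  Weighted by 2^(pk) they still form a summable series, and its almost everywhere finite sum bounds
  each weighted term, so d_k \<le> R 2^(-k) pointwise. Telescoping then gives convergence and an
  integrable majorant at once, without Minkowski's inequality or spaces of equivalence
  classes.\<close>

lemma Lp_Cauchy_subseq:
  fixes f :: "nat \<Rightarrow> 'a \<Rightarrow> real" and p :: nat
  assumes p: "p > 0"
    and meas[measurable]: "\<And>n. f n \<in> borel_measurable M"
    and int: "\<And>n. integrable M (\<lambda>x. \<bar>f n x\<bar> ^ p)"
    and Cauchy: "\<And>\<epsilon>. 0 < \<epsilon> \<Longrightarrow> \<exists>N. \<forall>m\<ge>N. \<forall>n\<ge>N. (\<integral>x. \<bar>f m x - f n x\<bar> ^ p \<partial>M) < \<epsilon>"
  obtains r u K where "strict_mono r" "u \<in> borel_measurable M" "integrable M K"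
    "AE x in M. (\<lambda>n. f (r n) x) \<longlonglongrightarrow> u x"
    "\<And>n. AE x in M. \<bar>f (r n) x\<bar> ^ p \<le> K x"
proof -
  have diffint: "integrable M (\<lambda>x. \<bar>f m x - f n x\<bar> ^ p)" for m n
  proof (rule Bochner_Integration.integrable_bound)
    show "integrable M (\<lambda>x. 2 ^ p * (\<bar>f m x\<bar> ^ p + \<bar>f n x\<bar> ^ p))"
      using int by auto
    have "\<bar>f m x - f n x\<bar> ^ p \<le> 2 ^ p * (\<bar>f m x\<bar> ^ p + \<bar>f n x\<bar> ^ p)" for x
    proof -
      have "\<bar>f m x - f n x\<bar> ^ p \<le> (\<bar>f m x\<bar> + \<bar>f n x\<bar>) ^ p"
        by (intro power_mono) auto
      with add_power_le[of "\<bar>f m x\<bar>" "\<bar>f n x\<bar>" p] show ?thesis by auto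
    qed
    then show "AE x in M. norm (\<bar>f m x - f n x\<bar> ^ p) \<le> norm (2 ^ p * (\<bar>f m x\<bar> ^ p + \<bar>f n x\<bar> ^ p))"
      by (auto simp: abs_mult)
  qed auto
  have "\<exists>N. \<forall>m\<ge>N. \<forall>n\<ge>N. (\<integral>x. \<bar>f m x - f n x\<bar> ^ p \<partial>M) < (1 / 4 ^ p) ^ k" for k
    by (rule Cauchy) auto
  then obtain N where N: "\<And>k m n. m \<ge> N k \<Longrightarrow> n \<ge> N k \<Longrightarrow> (\<integral>x. \<bar>f m x - f n x\<bar> ^ p \<partial>M) < (1 / 4 ^ p) ^ k"
    by metis
  \<comment> \<open>Summing positive numbers above the thresholds makes the indices strictly
    increasing and keeps \<open>r k\<close> above \<open>N k\<close>.\<close>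
  define r where "r k = (\<Sum>i\<le>k. Suc (N i))" for k
  have r: "strict_mono r"
    by (rule strict_monoI_Suc) (simp add: r_def)
  have rN: "r k \<ge> N k" for k
    by (induction k) (auto simp: r_def)
  define d where "d k x = \<bar>f (r (Suc k)) x - f (r k) x\<bar>" for k x
  have [measurable]: "d k \<in> borel_measurable M" for k
    unfolding d_def by measurable
  have d_int: "integrable M (\<lambda>x. d k x ^ p)" for k
    unfolding d_def by (rule diffint)
  have d_le: "(\<integral>x. d k x ^ p \<partial>M) \<le> (1 / 4 ^ p) ^ k" for k
  proof -
    have "N k \<le> r (Suc k)" using rN[of k] r by (meson le_trans lessI less_imp_le strict_monoD)
    then show ?thesis unfolding d_def using N[of k "r (Suc k)" "r k"] rN by auto
  qed
  have q1: "1 < (2::real) ^ p" using p by simp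
  define h where "h k x = (2 ^ p) ^ k * d k x ^ p" for k x
  have h0: "0 \<le> h k x" for k x by (simp add: h_def d_def)
  have hint: "integrable M (h k)" for k
    unfolding h_def using d_int by auto
  have hI: "(\<integral>x. h k x \<partial>M) \<le> (1 / 2 ^ p) ^ k" for k
  proof -
    have "(\<integral>x. h k x \<partial>M) = (2 ^ p) ^ k * (\<integral>x. d k x ^ p \<partial>M)"
      unfolding h_def by simp
    also have "\<dots> \<le> (2 ^ p) ^ k * (1 / 4 ^ p) ^ k"
      by (intro mult_left_mono d_le) auto
    also have "\<dots> = (1 / 2 ^ p) ^ k"
    proof -
      have "(2::real) ^ p / 4 ^ p = 1 / 2 ^ p"
        by (simp add: power_divide[symmetric] power_one_over)
      then show ?thesis by (simp add: power_mult_distrib[symmetric])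
    qed
    finally show ?thesis .
  qed
  have hsumm: "summable (\<lambda>k. \<integral>x. norm (h k x) \<partial>M)"
  proof (rule summable_comparison_test)
    show "\<exists>N. \<forall>n\<ge>N. norm (\<integral>x. norm (h n x) \<partial>M) \<le> (1 / 2 ^ p) ^ n"
      using hI h0 by (auto simp: abs_of_nonneg integral_nonneg_AE)
    show "summable (\<lambda>n. (1 / 2 ^ p :: real) ^ n)"
      using q1 by (intro summable_geometric) auto
  qed
  have AEh: "AE x in M. summable (\<lambda>k. h k x)"
  proof -
    have fin: "(\<integral>\<^sup>+x. (\<Sum>k. ennreal (h k x)) \<partial>M) < \<infinity>"
    proof -
      have [measurable]: "h k \<in> borel_measurable M" for k unfolding h_def by measurable
      have "(\<integral>\<^sup>+x. (\<Sum>k. ennreal (h k x)) \<partial>M) = (\<Sum>k. \<integral>\<^sup>+x. ennreal (h k x) \<partial>M)"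
        by (intro nn_integral_suminf) auto
      also have "\<dots> = (\<Sum>k. ennreal (\<integral>x. h k x \<partial>M))"
        by (intro suminf_cong nn_integral_eq_integral hint) (auto simp: h0)
      also have "\<dots> = ennreal (\<Sum>k. \<integral>x. h k x \<partial>M)"
        using hsumm by (intro suminf_ennreal2) (auto simp: h0 integral_nonneg_AE)
      finally show ?thesis by simp
    qed
    have [measurable]: "h k \<in> borel_measurable M" for k unfolding h_def by measurable
    have "AE x in M. (\<Sum>k. ennreal (h k x)) \<noteq> \<infinity>"
      by (rule nn_integral_PInf_AE) (use fin in auto)
    then show ?thesis
      by eventually_elim (auto intro!: summable_suminf_not_top h0 simp: infinity_ennreal_def)
  qed
  define Hs where "Hs x = (\<Sum>k. h k x)" for x
  have Hint: "integrable M Hs"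
    unfolding Hs_def
    by (rule integrable_suminf[OF hint _ hsumm]) (use AEh h0 in auto)
  \<comment> \<open>This is \<open>add_power_le\<close> for |f (r 0) x| + 2R, where 2R is the
    geometric sum of the increment bounds and R^p = \<open>Hs x\<close>.\<close>
  define K where "K x = 2 ^ p * (\<bar>f (r 0) x\<bar> ^ p + 2 ^ p * Hs x)" for x
  have main: "(\<forall>n. \<bar>f (r n) x\<bar> ^ p \<le> K x) \<and> convergent (\<lambda>n. f (r n) x)" if sm: "summable (\<lambda>k. h k x)" for x
  proof -
    define R where "R = root p (Hs x)"
    have Hs0: "0 \<le> Hs x" unfolding Hs_def using sm h0 by (intro suminf_nonneg) auto
    have R0: "0 \<le> R" and Rp: "R ^ p = Hs x"
      using Hs0 p by (auto simp: R_def)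
    have dk: "d k x \<le> R * (1/2) ^ k" for k
    proof -
      have "h k x \<le> Hs x"
        unfolding Hs_def using sum_le_suminf[OF sm, of "{k}"] h0 by auto
      then have "(2 ^ k * d k x) ^ p \<le> R ^ p"
        by (simp add: h_def Rp power_mult_distrib power_mult[symmetric] mult.commute)
      then have "2 ^ k * d k x \<le> R"
        using R0 p by (rule_tac power_le_imp_le_base[of _ "p - 1"]) auto
      then show ?thesis by (simp add: field_simps power_divide)
    qed
    have sd: "summable (\<lambda>k. R * (1/2) ^ k)"
      by (intro summable_mult summable_geometric) auto
    have sd': "summable (\<lambda>k. f (r (Suc k)) x - f (r k) x)"
      by (rule summable_rabs_cancel, rule summable_comparison_test[OF _ sd])
        (use dk in \<open>auto simp: d_def\<close>)
    have tele: "(\<Sum>k<n. f (r (Suc k)) x - f (r k) x) = f (r n) x - f (r 0) x" for n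
      by (rule sum_lessThan_telescope)
    have "convergent (\<lambda>n. f (r n) x)"
    proof -
      have "(\<lambda>n. f (r n) x - f (r 0) x) \<longlonglongrightarrow> (\<Sum>k. f (r (Suc k)) x - f (r k) x)"
        using summable_LIMSEQ[OF sd'] unfolding tele .
      from tendsto_add[OF this tendsto_const[of "f (r 0) x"]]
      show ?thesis by (auto simp: convergent_def)
    qed
    moreover have "\<bar>f (r n) x\<bar> ^ p \<le> K x" for n
    proof -
      have "\<bar>f (r n) x - f (r 0) x\<bar> \<le> (\<Sum>k<n. d k x)"
        unfolding tele[symmetric] d_def by (rule sum_abs)
      also have "\<dots> \<le> (\<Sum>k<n. R * (1/2) ^ k)"
        by (intro sum_mono dk)
      also have "\<dots> \<le> (\<Sum>k. R * (1/2) ^ k)"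
        using R0 by (intro sum_le_suminf sd) auto
      also have "\<dots> = 2 * R"
        by (subst suminf_mult) (auto simp: suminf_geometric summable_geometric)
      finally have "\<bar>f (r n) x\<bar> \<le> \<bar>f (r 0) x\<bar> + 2 * R" by linarith
      then have "\<bar>f (r n) x\<bar> ^ p \<le> (\<bar>f (r 0) x\<bar> + 2 * R) ^ p"
        by (intro power_mono) auto
      also have "\<dots> \<le> 2 ^ p * (\<bar>f (r 0) x\<bar> ^ p + (2 * R) ^ p)"
        using R0 by (intro add_power_le) auto
      also have "\<dots> = K x" by (simp add: K_def power_mult_distrib Rp)
      finally show ?thesis .
    qed
    ultimately show ?thesis by blast
  qed
  show ?thesis
  proof (rule that[OF r])
    show "(\<lambda>x. lim (\<lambda>n. f (r n) x)) \<in> borel_measurable M" by measurable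
    show "integrable M K" unfolding K_def using Hint int by auto
    show "AE x in M. (\<lambda>n. f (r n) x) \<longlonglongrightarrow> lim (\<lambda>n. f (r n) x)"
      using AEh by eventually_elim (use main convergent_LIMSEQ_iff in blast)
    show "AE x in M. \<bar>f (r n) x\<bar> ^ p \<le> K x" for n
      using AEh by eventually_elim (use main in blast)
  qed
qed

text \<open>Used with odd cosines for the minimisation and the time derivative, and with odd sines
  for the space derivative. The pointwise bound on \<open>e j\<close> makes finite combinations
  bounded, so that all their powers are integrable; \<open>h\<close> is the common squared norm, T/2
  in both cases.\<close>

locale orth_system = finite_measure M for M :: "'a measure" +
  fixes e :: "nat \<Rightarrow> 'a \<Rightarrow> real" and h :: real
  assumes e_meas[measurable]: "\<And>j. e j \<in> borel_measurable M"
    and e_bnd: "\<And>j x. \<bar>e j x\<bar> \<le> 1"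
    and h_pos: "0 < h"
    and orth: "\<And>i j. (\<integral>x. e i x * e j x \<partial>M) = (if i = j then h else 0)"
begin

definition fs :: "(nat \<Rightarrow> real) \<Rightarrow> bool" where
  "fs c \<longleftrightarrow> (\<exists>N. \<forall>j\<ge>N. c j = 0)"

text \<open>An infinite sum, so that no truncation index has to be carried along; under
  \<open>fs c\<close> it is finite by \<open>P_eq\<close>.\<close>

definition P :: "(nat \<Rightarrow> real) \<Rightarrow> 'a \<Rightarrow> real" where
  "P c x = (\<Sum>j. c j * e j x)"

lemma fs_suminf:
  assumes "\<And>j. j \<ge> N \<Longrightarrow> c j = 0"
  shows "(\<Sum>j. c j) = (\<Sum>j<N. c j :: real)" "summable c"
proof -
  have "c j = 0" if "j \<notin> {..<N}" for j using that assms by auto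
  then show "(\<Sum>j. c j) = (\<Sum>j<N. c j :: real)" "summable c"
    by (auto intro: suminf_finite summable_finite[of "{..<N}"])
qed

lemma P_eq: "(\<And>j. j \<ge> N \<Longrightarrow> c j = 0) \<Longrightarrow> P c x = (\<Sum>j<N. c j * e j x)"
  unfolding P_def by (rule fs_suminf) auto

lemma fs_combine: "fs c \<Longrightarrow> fs d \<Longrightarrow> fs (\<lambda>j. \<alpha> * c j + \<beta> * d j)"
proof -
  assume "fs c" "fs d"
  then obtain N1 N2 where "\<forall>j\<ge>N1. c j = 0" "\<forall>j\<ge>N2. d j = 0" by (auto simp: fs_def)
  then show ?thesis unfolding fs_def by (intro exI[of _ "max N1 N2"]) auto
qed

lemma fs_obtain2:
  assumes "fs c" "fs d"
  obtains N where "\<And>j. j \<ge> N \<Longrightarrow> c j = 0" "\<And>j. j \<ge> N \<Longrightarrow> d j = 0"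
proof -
  from assms obtain N1 N2 where "\<forall>j\<ge>N1. c j = 0" "\<forall>j\<ge>N2. d j = 0" by (auto simp: fs_def)
  then show ?thesis by (intro that[of "max N1 N2"]) auto
qed

lemma P_combine:
  assumes "fs c" "fs d"
  shows "P (\<lambda>j. \<alpha> * c j + \<beta> * d j) x = \<alpha> * P c x + \<beta> * P d x"
proof -
  obtain N where "\<And>j. j \<ge> N \<Longrightarrow> c j = 0" "\<And>j. j \<ge> N \<Longrightarrow> d j = 0"
    using fs_obtain2[OF assms] by blast
  then have "P (\<lambda>j. \<alpha> * c j + \<beta> * d j) x = (\<Sum>j<N. (\<alpha> * c j + \<beta> * d j) * e j x)"
      "P c x = (\<Sum>j<N. c j * e j x)" "P d x = (\<Sum>j<N. d j * e j x)"
    by (auto intro!: P_eq)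
  then show ?thesis
    by (simp add: sum.distrib sum_distrib_left distrib_right mult.assoc)
qed

lemma sum_bdd: "\<bar>\<Sum>j<N. c j * e j x\<bar> \<le> (\<Sum>j<N. \<bar>c j\<bar>)"
proof -
  have "\<bar>\<Sum>j<N. c j * e j x\<bar> \<le> (\<Sum>j<N. \<bar>c j * e j x\<bar>)" by (rule sum_abs)
  also have "\<dots> \<le> (\<Sum>j<N. \<bar>c j\<bar>)"
    by (intro sum_mono) (simp add: abs_mult mult_left_le e_bnd)
  finally show ?thesis .
qed

lemma P_bdd:
  assumes "fs c"
  shows "\<exists>B. \<forall>x. \<bar>P c x\<bar> \<le> B"
proof -
  obtain N where N: "\<And>j. j \<ge> N \<Longrightarrow> c j = 0" using assms by (auto simp: fs_def)
  show ?thesis using sum_bdd[where N = N and c = c] P_eq[where N = N and c = c] N by auto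
qed

lemma P_meas[measurable]: "P c \<in> borel_measurable M"
  unfolding P_def by measurable

lemma integrable_bdd:
  fixes f :: "'a \<Rightarrow> real"
  assumes "f \<in> borel_measurable M" "\<And>x. \<bar>f x\<bar> \<le> B"
  shows "integrable M f"
  by (rule integrable_const_bound[where B = B]) (use assms in auto)

lemma P_power_integrable:
  assumes "fs c" and [measurable]: "\<phi> \<in> borel_measurable M" and \<phi>: "\<And>x. \<bar>\<phi> x\<bar> \<le> B"
  shows "integrable M (\<lambda>x. P c x ^ n * \<phi> x)"
proof -
  obtain C where C: "\<And>x. \<bar>P c x\<bar> \<le> C" using P_bdd[OF assms(1)] by blast
  have "\<bar>P c x ^ n * \<phi> x\<bar> \<le> C ^ n * B" for x
    unfolding abs_mult
    using C[of x] by (intro mult_mono \<phi>) (auto simp: power_abs intro!: power_mono)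
  then show ?thesis by (intro integrable_bdd) auto
qed

lemma P_power_integrable': "fs c \<Longrightarrow> integrable M (\<lambda>x. P c x ^ n)"
  using P_power_integrable[of c "\<lambda>_. 1" 1 n] by auto

lemma integrable_mult_e:
  fixes v \<phi> :: "'a \<Rightarrow> real"
  assumes [measurable]: "v \<in> borel_measurable M" and v2: "integrable M (\<lambda>x. (v x)\<^sup>2)"
    and [measurable]: "\<phi> \<in> borel_measurable M" and \<phi>: "\<And>x. \<bar>\<phi> x\<bar> \<le> B"
  shows "integrable M (\<lambda>x. v x * \<phi> x)"
proof (rule Bochner_Integration.integrable_bound[where f = "\<lambda>x. (1 + (v x)\<^sup>2) * B"])
  show "integrable M (\<lambda>x. (1 + (v x)\<^sup>2) * B)" using v2 by auto
  have B: "0 \<le> B" using \<phi>[of undefined] by linarith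
  have *: "\<bar>y\<bar> \<le> 1 + y\<^sup>2" for y :: real
    using zero_le_power2[of "\<bar>y\<bar> - 1/2"] by (simp add: power2_diff power2_eq_square[of "1/2"])
  have "\<bar>v x * \<phi> x\<bar> \<le> \<bar>(1 + (v x)\<^sup>2) * B\<bar>" for x
    unfolding abs_mult by (intro mult_mono) (use \<phi>[of x] B *[of "v x"] in auto)
  then show "AE x in M. norm (v x * \<phi> x) \<le> norm ((1 + (v x)\<^sup>2) * B)" by simp
qed auto

text \<open>One expansion serves for Parseval (\<open>v\<close> equal to 0) and for the best
  approximation property of partial Fourier sums.\<close>

lemma sq_dist:
  fixes v :: "'a \<Rightarrow> real"
  assumes [measurable]: "v \<in> borel_measurable M" and v2: "integrable M (\<lambda>x. (v x)\<^sup>2)"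
  shows "integrable M (\<lambda>x. (v x - (\<Sum>j<N. d j * e j x))\<^sup>2)"
    "(\<integral>x. (v x - (\<Sum>j<N. d j * e j x))\<^sup>2 \<partial>M)
      = (\<integral>x. (v x)\<^sup>2 \<partial>M) - 2 * (\<Sum>j<N. d j * (\<integral>x. v x * e j x \<partial>M)) + h * (\<Sum>j<N. (d j)\<^sup>2)"
proof -
  have eq: "(v x - (\<Sum>j<N. d j * e j x))\<^sup>2 =
     (v x)\<^sup>2 - 2 * (\<Sum>j<N. d j * (v x * e j x)) + (\<Sum>i<N. \<Sum>j<N. d i * d j * (e i x * e j x))" for x
  proof -
    define S where "S = (\<Sum>j<N. d j * e j x)"
    have "(v x - S)\<^sup>2 = (v x)\<^sup>2 - 2 * (S * v x) + S * S"
      by (simp add: power2_eq_square algebra_simps)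
    moreover have "S * v x = (\<Sum>j<N. d j * (v x * e j x))"
      unfolding S_def sum_distrib_right by (intro sum.cong) auto
    moreover have "S * S = (\<Sum>i<N. \<Sum>j<N. d i * d j * (e i x * e j x))"
      unfolding S_def sum_product by (intro sum.cong) auto
    ultimately show ?thesis by (simp add: S_def)
  qed
  have ve: "integrable M (\<lambda>x. v x * e j x)" for j
    by (rule integrable_mult_e[OF _ v2 _ e_bnd]) auto
  have ee: "integrable M (\<lambda>x. e i x * e j x)" for i j
    by (rule integrable_bdd[where B = 1])
      (auto simp: abs_mult intro!: mult_le_one e_bnd)
  show "integrable M (\<lambda>x. (v x - (\<Sum>j<N. d j * e j x))\<^sup>2)"
    unfolding eq using v2 ve ee by (auto intro!: Bochner_Integration.integrable_sum)
  show "(\<integral>x. (v x - (\<Sum>j<N. d j * e j x))\<^sup>2 \<partial>M)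
      = (\<integral>x. (v x)\<^sup>2 \<partial>M) - 2 * (\<Sum>j<N. d j * (\<integral>x. v x * e j x \<partial>M)) + h * (\<Sum>j<N. (d j)\<^sup>2)"
  proof -
    have "(\<integral>x. (\<Sum>i<N. \<Sum>j<N. d i * d j * (e i x * e j x)) \<partial>M)
        = (\<Sum>i<N. \<Sum>j<N. d i * d j * (if i = j then h else 0))"
      using ee by (subst Bochner_Integration.integral_sum, auto simp: orth)+
    also have "\<dots> = (\<Sum>i<N. h * (d i)\<^sup>2)"
    proof (rule sum.cong[OF refl])
      fix i assume "i \<in> {..<N}"
      have "(\<Sum>j<N. d i * d j * (if i = j then h else 0)) = (\<Sum>j<N. if i = j then h * (d i)\<^sup>2 else 0)"
        by (intro sum.cong) (auto simp: power2_eq_square)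
      then show "(\<Sum>j<N. d i * d j * (if i = j then h else 0)) = h * (d i)\<^sup>2"
        using \<open>i \<in> {..<N}\<close> by simp
    qed
    finally have 1: "(\<integral>x. (\<Sum>i<N. \<Sum>j<N. d i * d j * (e i x * e j x)) \<partial>M) = h * (\<Sum>j<N. (d j)\<^sup>2)"
      by (simp add: sum_distrib_left)
    have 2: "(\<integral>x. (\<Sum>j<N. d j * (v x * e j x)) \<partial>M) = (\<Sum>j<N. d j * (\<integral>x. v x * e j x \<partial>M))"
      using ve by (subst Bochner_Integration.integral_sum) auto
    have i1: "integrable M (\<lambda>x. \<Sum>j<N. d j * (v x * e j x))"
      "integrable M (\<lambda>x. \<Sum>i<N. \<Sum>j<N. d i * d j * (e i x * e j x))"
      using ve ee by (auto intro!: Bochner_Integration.integrable_sum)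
    show ?thesis
      unfolding eq using v2 i1 by (simp add: 1 2)
  qed
qed

lemma P_sq:
  assumes "fs c"
  shows "(\<integral>x. (P c x)\<^sup>2 \<partial>M) = h * (\<Sum>j. (c j)\<^sup>2)"
proof -
  obtain N where N: "\<And>j. j \<ge> N \<Longrightarrow> c j = 0" using assms by (auto simp: fs_def)
  show ?thesis
    using sq_dist(2)[where v = "\<lambda>_. 0" and N = N and d = c] fs_suminf(1)[of N "\<lambda>j. (c j)\<^sup>2"] N
    by (simp add: P_eq[OF N])
qed

lemma P_coeff:
  assumes "fs c"
  shows "(\<integral>x. P c x * e j x \<partial>M) = h * c j"
proof -
  obtain N where N: "\<And>j. j \<ge> N \<Longrightarrow> c j = 0" using assms by (auto simp: fs_def)
  define N' where "N' = max N (Suc j)"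
  have N': "\<And>j. j \<ge> N' \<Longrightarrow> c j = 0" "j < N'" using N by (auto simp: N'_def)
  have ee: "integrable M (\<lambda>x. e i x * e j x)" for i j
    by (rule integrable_bdd[where B = 1])
      (auto simp: abs_mult intro!: mult_le_one e_bnd)
  have "(\<integral>x. P c x * e j x \<partial>M) = (\<integral>x. (\<Sum>i<N'. c i * (e i x * e j x)) \<partial>M)"
    by (subst P_eq[where N = N']) (auto simp: N' sum_distrib_right mult.assoc)
  also have "\<dots> = h * c j"
  proof -
    have "(\<integral>x. (\<Sum>i<N'. c i * (e i x * e j x)) \<partial>M) = (\<Sum>i<N'. c i * (if i = j then h else 0))"
      using ee by (subst Bochner_Integration.integral_sum) (auto simp: orth)
    also have "\<dots> = (\<Sum>i<N'. if i = j then h * c j else 0)"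
      by (intro sum.cong) auto
    finally show ?thesis using N'(2) by simp
  qed
  finally show ?thesis .
qed

end

text \<open>The difference of the two sides is a multiple of the square of x^2 - y^2. Integrated,
  the inequality bounds an L^4 distance by a convexity defect.\<close>

lemma Clarkson4:
  fixes x y :: real
  shows "((x + y) / 2) ^ 4 + ((x - y) / 2) ^ 4 \<le> (x ^ 4 + y ^ 4) / 2"
proof -
  have "(x ^ 4 + y ^ 4) / 2 - (((x + y) / 2) ^ 4 + ((x - y) / 2) ^ 4) = 3/8 * (x\<^sup>2 - y\<^sup>2)\<^sup>2"
    by (simp add: field_simps power2_eq_square power4_eq_xxxx)
  moreover have "0 \<le> 3/8 * (x\<^sup>2 - y\<^sup>2)\<^sup>2" by simp
  ultimately show ?thesis by linarith
qed

text \<open>Compactness of the quadratic form on l^2 balls: the tail is small because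
  \<open>b\<close> tends to 0, and the head involves finitely many coordinates. Coordinatewise
  smallness thus takes the place of weak convergence.\<close>

lemma small_on_bounded_sets:
  fixes b :: "nat \<Rightarrow> real"
  assumes b: "b \<longlonglongrightarrow> 0" and \<epsilon>: "0 < \<epsilon>" and K: "0 \<le> K"
  obtains J \<delta> where "0 < \<delta>"
    "\<And>d. (\<And>j. j < J \<Longrightarrow> \<bar>d j\<bar> < \<delta>) \<Longrightarrow> summable (\<lambda>j. (d j)\<^sup>2) \<Longrightarrow> (\<Sum>j. (d j)\<^sup>2) \<le> K
        \<Longrightarrow> \<bar>\<Sum>j. b j * (d j)\<^sup>2\<bar> \<le> \<epsilon>"
proof -
  have "0 < \<epsilon> / (2 * (K + 1))" using \<epsilon> K by auto
  then obtain J where J: "\<And>j. j \<ge> J \<Longrightarrow> \<bar>b j\<bar> < \<epsilon> / (2 * (K + 1))"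
    using LIMSEQ_D[OF b] by fastforce
  \<comment> \<open>The summand 1 keeps \<open>S\<close> positive even if the first coefficients all
    vanish; \<delta> then allots half of \<epsilon> to the head.\<close>
  define S where "S = 1 + (\<Sum>j<J. \<bar>b j\<bar>)"
  have S: "0 < S" by (simp add: S_def add_pos_nonneg sum_nonneg)
  define \<delta> where "\<delta> = sqrt (\<epsilon> / (2 * S))"
  have \<delta>: "0 < \<delta>" "\<delta>\<^sup>2 = \<epsilon> / (2 * S)" using \<epsilon> S by (auto simp: \<delta>_def)
  show ?thesis
  proof (rule that[OF \<delta>(1)])
    fix d :: "nat \<Rightarrow> real"
    assume d: "\<And>j. j < J \<Longrightarrow> \<bar>d j\<bar> < \<delta>" and sm: "summable (\<lambda>j. (d j)\<^sup>2)" and le: "(\<Sum>j. (d j)\<^sup>2) \<le> K"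
    have bd: "\<bar>b j * (d j)\<^sup>2\<bar> \<le> (if j < J then \<bar>b j\<bar> * \<delta>\<^sup>2 else 0) + \<epsilon> / (2 * (K + 1)) * (d j)\<^sup>2" for j
    proof (cases "j < J")
      case True
      then have "(d j)\<^sup>2 \<le> \<delta>\<^sup>2" using d[of j] abs_le_square_iff[of "d j" \<delta>] \<delta> by auto
      then have "\<bar>b j * (d j)\<^sup>2\<bar> \<le> \<bar>b j\<bar> * \<delta>\<^sup>2" by (auto simp: abs_mult intro: mult_left_mono)
      moreover have "0 \<le> \<epsilon> / (2 * (K + 1)) * (d j)\<^sup>2" using \<epsilon> K by auto
      ultimately show ?thesis using True by auto
    next
      case False
      then have "\<bar>b j\<bar> * (d j)\<^sup>2 \<le> \<epsilon> / (2 * (K + 1)) * (d j)\<^sup>2"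
        using J[of j] by (intro mult_right_mono) auto
      then show ?thesis using False by (auto simp: abs_mult)
    qed
    have s1: "(\<lambda>j. if j < J then \<bar>b j\<bar> * \<delta>\<^sup>2 else 0) sums (\<Sum>j<J. \<bar>b j\<bar> * \<delta>\<^sup>2)"
      using sums_If_finite_set[of "{..<J}" "\<lambda>j. \<bar>b j\<bar> * \<delta>\<^sup>2"] by auto
    have s2: "(\<lambda>j. \<epsilon> / (2 * (K + 1)) * (d j)\<^sup>2) sums (\<epsilon> / (2 * (K + 1)) * (\<Sum>j. (d j)\<^sup>2))"
      by (intro sums_mult summable_sums sm)
    note s = sums_add[OF s1 s2]
    have "summable (\<lambda>j. \<bar>b j * (d j)\<^sup>2\<bar>)"
      by (rule summable_comparison_test[OF _ sums_summable[OF s]]) (use bd in auto)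
    then have "\<bar>\<Sum>j. b j * (d j)\<^sup>2\<bar> \<le> (\<Sum>j. \<bar>b j * (d j)\<^sup>2\<bar>)"
      by (rule summable_rabs)
    also have "\<dots> \<le> (\<Sum>j<J. \<bar>b j\<bar> * \<delta>\<^sup>2) + \<epsilon> / (2 * (K + 1)) * (\<Sum>j. (d j)\<^sup>2)"
      unfolding sums_unique[OF s]
      by (intro suminf_le bd sums_summable[OF s] \<open>summable (\<lambda>j. \<bar>b j * (d j)\<^sup>2\<bar>)\<close>)
    also have "(\<Sum>j<J. \<bar>b j\<bar> * \<delta>\<^sup>2) \<le> S * \<delta>\<^sup>2"
      unfolding S_def sum_distrib_right[symmetric] by (intro mult_right_mono) auto
    also have "S * \<delta>\<^sup>2 = \<epsilon> / 2" using S by (simp add: \<delta>(2))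
    also have "\<epsilon> / (2 * (K + 1)) * (\<Sum>j. (d j)\<^sup>2) \<le> \<epsilon> / (2 * (K + 1)) * K"
      using \<epsilon> K by (intro mult_left_mono le) auto
    also have "\<dots> \<le> \<epsilon> / 2" using \<epsilon> K by (simp add: field_simps)
    finally show "\<bar>\<Sum>j. b j * (d j)\<^sup>2\<bar> \<le> \<epsilon>" by simp
  qed
qed

lemma abs_le_one_plus_square: "\<bar>y\<bar> \<le> 1 + (y::real)\<^sup>2"
  using zero_le_power2[of "\<bar>y\<bar> - 1/2"] by (simp add: power2_diff power2_eq_square[of "1/2"])

lemma power_le_one_plus_power4:
  fixes y :: real
  assumes "n \<le> 4"
  shows "\<bar>y\<bar> ^ n \<le> 1 + y ^ 4"
proof (cases "\<bar>y\<bar> \<le> 1")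
  case True
  then have "\<bar>y\<bar> ^ n \<le> 1" by (simp add: power_le_one)
  then show ?thesis by (simp add: add_increasing2)
next
  case False
  then have "\<bar>y\<bar> ^ n \<le> \<bar>y\<bar> ^ 4" using assms by (intro power_increasing) auto
  then show ?thesis by simp
qed

lemma linear_term_zero:
  fixes A C :: real
  assumes C: "0 \<le> C" and s: "\<And>s. \<bar>s\<bar> \<le> 1 \<Longrightarrow> 0 \<le> s * A + s\<^sup>2 * C"
  shows "A = 0"
proof (rule ccontr)
  assume A: "A \<noteq> 0"
  \<comment> \<open>The test value s = -A/D is admissible because D \<ge> |A|, and D > C makes the
    linear gain A^2/D exceed the quadratic cost.\<close>
  define D where "D = C + \<bar>A\<bar> + 1"
  have D: "0 < D" "C < D" "\<bar>A\<bar> \<le> D" using C by (auto simp: D_def)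
  have "\<bar>- A / D\<bar> \<le> 1" using D by simp
  from s[OF this] have "A\<^sup>2 / D \<le> A\<^sup>2 * C / D\<^sup>2" by (simp add: power2_eq_square)
  then have "A\<^sup>2 * D \<le> A\<^sup>2 * C" using D by (simp add: field_simps power2_eq_square)
  then show False using A D by simp
qed

section \<open>The energy on finite coefficient sequences and its minimiser\<close>

context orth_system
begin

lemma fs_summable:
  assumes "fs c"
  shows "summable (\<lambda>j. f j * (c j)\<^sup>2 :: real)"
proof -
  obtain N where N: "\<And>j. j \<ge> N \<Longrightarrow> c j = 0" using assms by (auto simp: fs_def)
  show ?thesis by (rule fs_suminf(2)[of N]) (simp add: N)
qed

lemma fs_summable': "fs c \<Longrightarrow> summable (\<lambda>j. (c j)\<^sup>2)"
  using fs_summable[of c "\<lambda>_. 1"] by simp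

lemma quadratic_form_le:
  assumes "fs c" and B: "\<And>j. \<bar>b j\<bar> \<le> B"
  shows "(\<Sum>j. b j * (c j)\<^sup>2) \<le> B * (\<Sum>j. (c j)\<^sup>2)"
proof -
  have "(\<Sum>j. b j * (c j)\<^sup>2) \<le> (\<Sum>j. B * (c j)\<^sup>2)"
    using B abs_le_D1 by (intro suminf_le fs_summable[OF assms(1)] mult_right_mono) auto
  also have "\<dots> = B * (\<Sum>j. (c j)\<^sup>2)"
    by (intro suminf_mult fs_summable' assms)
  finally show ?thesis .
qed

text \<open>Defined on coefficients, where the quadratic part is diagonal. Criticality reads
  \<open>a * \<integral> P c ^ 3 * e j = b j * c j\<close>; the normalisation \<open>h\<close> is
  left to the choice of \<open>b\<close>.\<close>

definition energy :: "real \<Rightarrow> (nat \<Rightarrow> real) \<Rightarrow> (nat \<Rightarrow> real) \<Rightarrow> real" where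
  "energy a b c = a / 4 * (\<integral>x. P c x ^ 4 \<partial>M) - (\<Sum>j. b j * (c j)\<^sup>2) / 2"

text \<open>Parseval bounds the quadratic part by a multiple of the integral of (P c)^2, and
  completing the square absorbs this in half of the quartic term. The other half, with factor a/8,
  is kept: it bounds minimising sequences in L^4.\<close>

lemma energy_lower_bound:
  assumes a: "0 < a" and B: "\<And>j. \<bar>b j\<bar> \<le> B"
  obtains K where "\<And>c. fs c \<Longrightarrow> a / 8 * (\<integral>x. P c x ^ 4 \<partial>M) - K \<le> energy a b c"
proof
  fix c assume c: "fs c"
  define y where "y = B / (2 * h)"
  have "(\<Sum>j. b j * (c j)\<^sup>2) / 2 \<le> y * (h * (\<Sum>j. (c j)\<^sup>2))"
    using quadratic_form_le[OF c B] h_pos by (simp add: y_def)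
  also have "\<dots> = (\<integral>x. y * (P c x)\<^sup>2 \<partial>M)"
    using P_sq[OF c] by simp
  also have "\<dots> \<le> (\<integral>x. a / 8 * P c x ^ 4 + 2 * y\<^sup>2 / a \<partial>M)"
  proof (rule integral_mono)
    show "integrable M (\<lambda>x. y * (P c x)\<^sup>2)" "integrable M (\<lambda>x. a / 8 * P c x ^ 4 + 2 * y\<^sup>2 / a)"
      using P_power_integrable'[OF c] by auto
    fix x
    have "0 \<le> a / 8 * ((P c x)\<^sup>2 - 4 * y / a)\<^sup>2" using a by simp
    also have "\<dots> = a / 8 * P c x ^ 4 + 2 * y\<^sup>2 / a - y * (P c x)\<^sup>2"
      using a by (simp add: field_simps power2_eq_square power4_eq_xxxx)
    finally show "y * (P c x)\<^sup>2 \<le> a / 8 * P c x ^ 4 + 2 * y\<^sup>2 / a" by simp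
  qed
  also have "\<dots> = a / 8 * (\<integral>x. P c x ^ 4 \<partial>M) + 2 * y\<^sup>2 / a * measure M (space M)"
    using P_power_integrable'[OF c] by simp
  finally show "a / 8 * (\<integral>x. P c x ^ 4 \<partial>M) - 2 * (B / (2 * h))\<^sup>2 / a * measure M (space M) \<le> energy a b c"
    by (simp add: energy_def y_def)
qed

text \<open>Clarkson's inequality for the quartic part and the parallelogram identity for the
  quadratic one. Positive \<open>b j\<close> contribute concave terms, so the energy is not convex;
  the resulting error is the last sum, which \<open>small_on_bounded_sets\<close> controls. The
  constants are a/4 times 1/16 and 1/2 times 1/4.\<close>

lemma energy_midpoint:
  assumes a: "0 < a" and c: "fs c" and d: "fs d"
  shows "a / 64 * (\<integral>x. (P c x - P d x) ^ 4 \<partial>M) \<le>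
     (energy a b c + energy a b d) / 2 - energy a b (\<lambda>j. 1/2 * c j + 1/2 * d j)
       + (\<Sum>j. b j * (c j - d j)\<^sup>2) / 8"
proof -
  let ?m = "\<lambda>j. 1/2 * c j + 1/2 * d j"
  let ?d = "\<lambda>j. 1 * c j + (-1) * d j"
  have fm: "fs ?m" "fs ?d" using fs_combine[OF c d] by blast+
  have Pm: "P ?m x = (P c x + P d x) / 2" "P ?d x = P c x - P d x" for x
    using P_combine[OF c d, of "1/2" "1/2" x] P_combine[OF c d, of 1 "-1" x] by auto
  note ints = P_power_integrable'[OF c, of 4] P_power_integrable'[OF d, of 4]
    P_power_integrable'[OF fm(1), of 4, unfolded Pm] P_power_integrable'[OF fm(2), of 4, unfolded Pm]
  have ints': "integrable M (\<lambda>x. ((P c x - P d x) / 2) ^ 4)"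
    using ints(4) by (simp add: power_divide)
  have "(\<integral>x. ((P c x + P d x) / 2) ^ 4 + ((P c x - P d x) / 2) ^ 4 \<partial>M)
     \<le> (\<integral>x. (P c x ^ 4 + P d x ^ 4) / 2 \<partial>M)"
    using ints ints' by (intro integral_mono Clarkson4 Bochner_Integration.integrable_add) auto
  then have 1: "(\<integral>x. P ?m x ^ 4 \<partial>M) + (\<integral>x. (P c x - P d x) ^ 4 \<partial>M) / 16
      \<le> ((\<integral>x. P c x ^ 4 \<partial>M) + (\<integral>x. P d x ^ 4 \<partial>M)) / 2"
    unfolding Pm using ints ints'
    by (subst (asm) Bochner_Integration.integral_add) (auto simp: power_divide)
  have 2: "(\<Sum>j. b j * (?m j)\<^sup>2)
     = (\<Sum>j. b j * (c j)\<^sup>2) / 2 + (\<Sum>j. b j * (d j)\<^sup>2) / 2 - (\<Sum>j. b j * (c j - d j)\<^sup>2) / 4"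
  proof -
    have "(\<lambda>j. b j * (c j)\<^sup>2 / 2 + b j * (d j)\<^sup>2 / 2 - b j * (c j - d j)\<^sup>2 / 4) sums
      ((\<Sum>j. b j * (c j)\<^sup>2) / 2 + (\<Sum>j. b j * (d j)\<^sup>2) / 2 - (\<Sum>j. b j * (c j - d j)\<^sup>2) / 4)"
      using fs_summable[OF fm(2), of b] fs_summable[OF c, of b] fs_summable[OF d, of b]
      by (intro sums_add sums_diff sums_divide summable_sums) auto
    moreover have "b j * (c j)\<^sup>2 / 2 + b j * (d j)\<^sup>2 / 2 - b j * (c j - d j)\<^sup>2 / 4 = b j * (?m j)\<^sup>2" for j
      by (simp add: power2_eq_square field_simps)
    ultimately show ?thesis by (simp add: sums_iff)
  qed
  have 3: "a / 4 * ((\<integral>x. P ?m x ^ 4 \<partial>M) + (\<integral>x. (P c x - P d x) ^ 4 \<partial>M) / 16)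
      \<le> a / 4 * (((\<integral>x. P c x ^ 4 \<partial>M) + (\<integral>x. P d x ^ 4 \<partial>M)) / 2)"
    using a by (intro mult_left_mono 1) auto
  show ?thesis
    unfolding energy_def 2 using 3 by (simp add: algebra_simps add_divide_distrib diff_divide_distrib)
qed

text \<open>A one-sided Taylor bound whose remainder depends on \<open>c\<close> only through
  \<open>K\<close> and the coefficient \<open>b j\<close>. The infimum need not be attained by a
  finite sequence, so the bound has to be passed to the limit along a minimising sequence while s
  stays fixed; the uniform remainder allows this.\<close>

lemma energy_single_shift:
  assumes a: "0 < a" and c: "fs c" and s: "\<bar>s\<bar> \<le> 1" and K: "(\<integral>x. P c x ^ 4 \<partial>M) \<le> K"
  shows "energy a b (\<lambda>i. 1 * c i + s * (if i = j then 1 else 0)) - energy a b c \<le>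
    s * (a * (\<integral>x. P c x ^ 3 * e j x \<partial>M) - b j * c j)
      + s\<^sup>2 * (a / 4 * (11 * measure M (space M) + 10 * K) + \<bar>b j\<bar> / 2)"
proof -
  let ?d = "\<lambda>i. if i = j then 1 else 0 :: real"
  have d: "fs ?d" unfolding fs_def by (intro exI[of _ "Suc j"]) auto
  have Pd: "P ?d x = e j x" for x
    by (subst P_eq[of "Suc j"]) (auto simp: if_distrib[of "\<lambda>y. y * _"] cong: if_cong)
  let ?n = "\<lambda>i. 1 * c i + s * ?d i"
  have n: "fs ?n" by (rule fs_combine[OF c d])
  have Pn: "P ?n x = P c x + s * e j x" for x
    using P_combine[OF c d, of 1 s x] Pd by simp
  note intc = P_power_integrable'[OF c] P_power_integrable[OF c e_meas e_bnd]
  have "(\<integral>x. P ?n x ^ 4 \<partial>M) \<le> (\<integral>x. P c x ^ 4 + 4 * s * (P c x ^ 3 * e j x) + s\<^sup>2 * (11 + 10 * P c x ^ 4) \<partial>M)"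
  proof (rule integral_mono)
    show "integrable M (\<lambda>x. P ?n x ^ 4)" by (rule P_power_integrable'[OF n])
    show "integrable M (\<lambda>x. P c x ^ 4 + 4 * s * (P c x ^ 3 * e j x) + s\<^sup>2 * (11 + 10 * P c x ^ 4))"
      using intc by auto
    fix x
    define y z where "y = P c x" and "z = e j x"
    have z: "\<bar>z\<bar> \<le> 1" by (simp add: z_def e_bnd)
    have z2: "z\<^sup>2 \<le> 1" using z by (simp add: abs_square_le_1)
    have s2: "s\<^sup>2 \<le> 1" using s by (simp add: abs_square_le_1)
    have sz: "\<bar>s * z\<bar> \<le> 1" using s z by (simp add: abs_mult mult_le_one)
    \<comment> \<open>The three terms beyond first order cost 6 (1 + y^4), 4 (1 + y^4) and 1, which
      add up to 11 + 10 y^4.\<close>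
    have t1: "6 * y\<^sup>2 * z\<^sup>2 \<le> 6 * (1 + y ^ 4)"
      using power_le_one_plus_power4[of 2 y] z2 mult_mono[of "y\<^sup>2" "1 + y ^ 4" "z\<^sup>2" 1] by auto
    have t2: "4 * y * (s * z) * z\<^sup>2 \<le> 4 * (1 + y ^ 4)"
    proof -
      have "y * (s * z) * z\<^sup>2 \<le> \<bar>y\<bar> * \<bar>s * z\<bar> * \<bar>z\<^sup>2\<bar>" by (metis abs_ge_self abs_mult)
      also have "\<dots> \<le> (1 + y ^ 4) * 1 * 1"
        using power_le_one_plus_power4[of 1 y] sz z2 by (intro mult_mono) auto
      finally show ?thesis by simp
    qed
    have t3: "(s * z)\<^sup>2 * z\<^sup>2 \<le> 1"
      using mult_mono[of "(s * z)\<^sup>2" 1 "z\<^sup>2" 1] sz z2 by (simp add: abs_square_le_1)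
    have "(y + s * z) ^ 4 = y ^ 4 + 4 * s * (y ^ 3 * z)
        + s\<^sup>2 * (6 * y\<^sup>2 * z\<^sup>2 + 4 * y * (s * z) * z\<^sup>2 + (s * z)\<^sup>2 * z\<^sup>2)"
      by (simp add: power2_eq_square power3_eq_cube power4_eq_xxxx algebra_simps)
    also have "\<dots> \<le> y ^ 4 + 4 * s * (y ^ 3 * z) + s\<^sup>2 * (11 + 10 * y ^ 4)"
      using t1 t2 t3 by (intro add_left_mono mult_left_mono) auto
    finally show "P ?n x ^ 4 \<le> P c x ^ 4 + 4 * s * (P c x ^ 3 * e j x) + s\<^sup>2 * (11 + 10 * P c x ^ 4)"
      unfolding Pn y_def z_def .
  qed
  also have "\<dots> = (\<integral>x. P c x ^ 4 \<partial>M) + 4 * s * (\<integral>x. P c x ^ 3 * e j x \<partial>M)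
      + s\<^sup>2 * (11 * measure M (space M) + 10 * (\<integral>x. P c x ^ 4 \<partial>M))"
    using intc by simp
  also have "\<dots> \<le> (\<integral>x. P c x ^ 4 \<partial>M) + 4 * s * (\<integral>x. P c x ^ 3 * e j x \<partial>M)
      + s\<^sup>2 * (11 * measure M (space M) + 10 * K)"
    using K by (intro add_left_mono mult_left_mono) auto
  finally have "a / 4 * (\<integral>x. P ?n x ^ 4 \<partial>M) \<le> a / 4 * ((\<integral>x. P c x ^ 4 \<partial>M) + 4 * s * (\<integral>x. P c x ^ 3 * e j x \<partial>M)
      + s\<^sup>2 * (11 * measure M (space M) + 10 * K))"
    using a by (intro mult_left_mono) auto
  then have 1: "a / 4 * (\<integral>x. P ?n x ^ 4 \<partial>M) \<le> a / 4 * (\<integral>x. P c x ^ 4 \<partial>M) + s * (a * (\<integral>x. P c x ^ 3 * e j x \<partial>M))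
      + s\<^sup>2 * (a / 4 * (11 * measure M (space M) + 10 * K))"
    by (simp add: algebra_simps)
  have 2: "(\<Sum>i. b i * (?n i)\<^sup>2) = (\<Sum>i. b i * (c i)\<^sup>2) + b j * (2 * s * c j + s\<^sup>2)"
  proof -
    have "(\<lambda>i. b i * (c i)\<^sup>2 + (if i = j then b j * (2 * s * c j + s\<^sup>2) else 0)) sums
        ((\<Sum>i. b i * (c i)\<^sup>2) + b j * (2 * s * c j + s\<^sup>2))"
      by (intro sums_add summable_sums fs_summable c sums_single)
    moreover have "b i * (c i)\<^sup>2 + (if i = j then b j * (2 * s * c j + s\<^sup>2) else 0) = b i * (?n i)\<^sup>2" for i
      by (simp add: power2_eq_square algebra_simps)
    ultimately show ?thesis by (simp add: sums_iff)
  qed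
  have 3: "- (b j * s\<^sup>2) / 2 \<le> s\<^sup>2 * (\<bar>b j\<bar> / 2)"
    using mult_right_mono[of "- b j" "\<bar>b j\<bar>" "s\<^sup>2"] by (simp add: mult.commute)
  show ?thesis
  proof -
    have "s * (a * (\<integral>x. P c x ^ 3 * e j x \<partial>M) - b j * c j)
        + s\<^sup>2 * (a / 4 * (11 * measure M (space M) + 10 * K) + \<bar>b j\<bar> / 2)
      = s * (a * (\<integral>x. P c x ^ 3 * e j x \<partial>M)) - s * (b j * c j)
        + s\<^sup>2 * (a / 4 * (11 * measure M (space M) + 10 * K)) + s\<^sup>2 * (\<bar>b j\<bar> / 2)"
      "b j * (2 * s * c j + s\<^sup>2) = 2 * (s * (b j * c j)) + b j * s\<^sup>2"
      by (simp_all add: algebra_simps)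
    moreover have "I' - (q + w) / 2 - (I - q / 2) \<le> R"
      if "I' \<le> I + p1 + p2" "- p3 / 2 \<le> p4" "R = p1 - p5 + p2 + p4" "w = 2 * p5 + p3"
      for I' I q w R p1 p2 p3 p4 p5 :: real
      using that by argo
    ultimately show ?thesis
      unfolding energy_def 2 using 1 3 by blast
  qed
qed

lemma energy_negative:
  assumes a: "0 < a" and b: "0 < b j"
  shows "\<exists>c. fs c \<and> energy a b c < 0"
proof -
  let ?d = "\<lambda>i. if i = j then 1 else 0 :: real"
  have d: "fs ?d" unfolding fs_def by (intro exI[of _ "Suc j"]) auto
  have Pd: "P ?d x = e j x" for x
    by (subst P_eq[of "Suc j"]) (auto simp: if_distrib[of "\<lambda>y. y * _"] cong: if_cong)
  define E where "E = (\<integral>x. e j x ^ 4 \<partial>M)"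
  have E: "0 \<le> E" by (simp add: E_def)
  \<comment> \<open>This choice gives a E s^2 \<le> b j < 2 b j, so the quadratic gain wins; the
    added 1 avoids a proof that E is positive.\<close>
  define s where "s = sqrt (b j / (a * E + 1))"
  have s: "0 < s\<^sup>2" "s\<^sup>2 = b j / (a * E + 1)"
    using a b E by (auto simp: s_def add_nonneg_pos)
  let ?n = "\<lambda>i. s * ?d i + 0 * ?d i"
  have n: "fs ?n" by (rule fs_combine[OF d d])
  have Pn: "P ?n x = s * e j x" for x
    using P_combine[OF d d, of s 0 x] Pd by simp
  have "(\<lambda>i. if i = j then b j * s\<^sup>2 else 0) sums (b j * s\<^sup>2)" by (rule sums_single)
  moreover have "(if i = j then b j * s\<^sup>2 else 0) = b i * (?n i)\<^sup>2" for i by simp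
  ultimately have "(\<Sum>i. b i * (?n i)\<^sup>2) = b j * s\<^sup>2" by (simp add: sums_iff)
  then have "energy a b ?n = a / 4 * (s ^ 4 * E) - b j * s\<^sup>2 / 2"
    unfolding energy_def Pn by (simp add: power_mult_distrib E_def)
  also have "\<dots> = s\<^sup>2 / 4 * (a * E * s\<^sup>2 - 2 * b j)"
    by (simp add: power2_eq_square power4_eq_xxxx algebra_simps)
  also have "\<dots> < 0"
  proof -
    have "a * E * s\<^sup>2 \<le> b j"
    proof -
      have "0 \<le> a * E" using a E by simp
      then have "a * E / (a * E + 1) * b j \<le> 1 * b j"
        using b by (intro mult_right_mono) auto
      then show ?thesis by (simp add: s(2))
    qed
    then show ?thesis using s(1) b by (intro mult_pos_neg) auto
  qed
  finally show ?thesis using n by blast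
qed

text \<open>Coercivity bounds the sequence in L^4, hence its coefficients in l^2 and each
  coordinate; a diagonal subsequence then converges in every coordinate.\<close>

lemma minimizing_sequence:
  assumes a: "0 < a" and b: "b \<longlonglongrightarrow> 0" and bpos: "0 < b j0"
  obtains c l m K4 K2 where "\<And>n. fs (c n)" "\<And>d. fs d \<Longrightarrow> m \<le> energy a b d" "m < 0"
    "(\<lambda>n. energy a b (c n)) \<longlonglongrightarrow> m" "\<And>j. (\<lambda>n. c n j) \<longlonglongrightarrow> l j"
    "\<And>n. (\<integral>x. P (c n) x ^ 4 \<partial>M) \<le> K4" "\<And>n. (\<Sum>j. (c n j)\<^sup>2) \<le> K2"
proof -
  obtain B where B: "\<And>j. \<bar>b j\<bar> \<le> B"
    using convergent_imp_Bseq[of b] b by (metis BseqE convergentI real_norm_def)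
  obtain K0 where K0: "\<And>c. fs c \<Longrightarrow> a / 8 * (\<integral>x. P c x ^ 4 \<partial>M) - K0 \<le> energy a b c"
    using energy_lower_bound[where a = a and b = b and B = B] a B by blast
  have int0: "0 \<le> (\<integral>x. P c x ^ 4 \<partial>M)" for c by simp
  have lb: "- K0 \<le> energy a b c" if "fs c" for c
  proof -
    have "0 \<le> a / 8 * (\<integral>x. P c x ^ 4 \<partial>M)" using a int0 by (intro mult_nonneg_nonneg) auto
    with K0[OF that] show ?thesis by linarith
  qed
  define m where "m = Inf (energy a b ` Collect fs)"
  have bdd: "bdd_below (energy a b ` Collect fs)" using lb by (auto intro!: bdd_belowI)
  have m: "m \<le> energy a b d" if "fs d" for d
    unfolding m_def using that by (intro cInf_lower bdd) auto
  obtain d0 where d0: "fs d0" "energy a b d0 < 0"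
    using energy_negative[of a b j0, OF a bpos] by blast
  have mneg: "m < 0" using m[OF d0(1)] d0(2) by linarith
  have "\<exists>c. fs c \<and> energy a b c < m + 1 / real (Suc n)" for n
  proof -
    have "Inf (energy a b ` Collect fs) < m + 1 / real (Suc n)" by (simp add: m_def)
    then obtain y where "y \<in> energy a b ` Collect fs" "y < m + 1 / real (Suc n)"
      by (rule cInf_lessD[rotated, THEN bexE]) (use d0 in auto)
    then show ?thesis by auto
  qed
  then obtain c where c: "\<And>n. fs (c n)" "\<And>n. energy a b (c n) < m + 1 / real (Suc n)"
    by metis
  define K4 where "K4 = 8 / a * (m + 1 + K0)"
  have K4: "(\<integral>x. P (c n) x ^ 4 \<partial>M) \<le> K4" for n
  proof -
    have "1 / real (Suc n) \<le> 1" by simp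
    then have "a / 8 * (\<integral>x. P (c n) x ^ 4 \<partial>M) \<le> m + 1 + K0" using K0[OF c(1), of n] c(2)[of n] by linarith
    then show ?thesis using a by (simp add: K4_def field_simps)
  qed
  define K2 where "K2 = (measure M (space M) + K4) / h"
  have K2: "(\<Sum>j. (c n j)\<^sup>2) \<le> K2" for n
  proof -
    have "h * (\<Sum>j. (c n j)\<^sup>2) = (\<integral>x. (P (c n) x)\<^sup>2 \<partial>M)" by (simp add: P_sq[OF c(1)])
    also have "\<dots> \<le> (\<integral>x. 1 + P (c n) x ^ 4 \<partial>M)"
      using P_power_integrable'[OF c(1)] power_le_one_plus_power4[of 2]
      by (intro integral_mono) auto
    also have "\<dots> \<le> measure M (space M) + K4"
      using P_power_integrable'[OF c(1)] K4[of n] by simp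
    finally show ?thesis using h_pos by (simp add: K2_def field_simps)
  qed
  have "norm (c n j) \<le> 1 + K2" for n j
  proof -
    have "(c n j)\<^sup>2 \<le> (\<Sum>j. (c n j)\<^sup>2)"
      using sum_le_suminf[OF fs_summable'[OF c(1)], of "{j}"] by simp
    with K2[of n] abs_le_one_plus_square[of "c n j"] show ?thesis by simp
  qed
  then obtain k where k: "strict_mono k" "\<And>j. \<exists>l. (\<lambda>n. c (k n) j) \<longlonglongrightarrow> l"
    by (rule function_convergent_subsequence[of UNIV c "1 + K2", OF countableI_type]) blast
  from k(2) obtain l where l: "\<And>j. (\<lambda>n. c (k n) j) \<longlonglongrightarrow> l j" by metis
  have lim0: "(\<lambda>n. m + 1 / real (Suc n)) \<longlonglongrightarrow> m"
    using tendsto_add[OF tendsto_const LIMSEQ_inverse_real_of_nat, of m] by (simp add: inverse_eq_divide)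
  have lim: "(\<lambda>n. energy a b (c n)) \<longlonglongrightarrow> m"
    by (rule tendsto_sandwich[OF _ _ tendsto_const lim0])
      (use m c in \<open>auto intro!: always_eventually less_imp_le\<close>)
  show ?thesis
    by (rule that[of "\<lambda>n. c (k n)" m l K4 K2])
      (use c m mneg l K4 K2 LIMSEQ_subseq_LIMSEQ[OF lim k(1)] in \<open>auto simp: o_def\<close>)
qed

lemma sum_sq_diff_le:
  assumes "fs c" "fs d"
  shows "(\<Sum>j. (c j - d j)\<^sup>2) \<le> 2 * (\<Sum>j. (c j)\<^sup>2) + 2 * (\<Sum>j. (d j)\<^sup>2)"
    "summable (\<lambda>j. (c j - d j)\<^sup>2)"
proof -
  show sm: "summable (\<lambda>j. (c j - d j)\<^sup>2)"
    using fs_summable'[OF fs_combine[OF assms, of 1 "-1"]] by simp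
  have "(\<Sum>j. (c j - d j)\<^sup>2) \<le> (\<Sum>j. 2 * (c j)\<^sup>2 + 2 * (d j)\<^sup>2)"
  proof (intro suminf_le sm summable_add fs_summable assms)
    fix j show "(c j - d j)\<^sup>2 \<le> 2 * (c j)\<^sup>2 + 2 * (d j)\<^sup>2"
      using zero_le_power2[of "c j + d j"] by (simp add: power2_eq_square algebra_simps)
  qed
  also have "\<dots> = 2 * (\<Sum>j. (c j)\<^sup>2) + 2 * (\<Sum>j. (d j)\<^sup>2)"
    using fs_summable'[OF assms(1)] fs_summable'[OF assms(2)]
    by (simp add: suminf_add[symmetric] suminf_mult summable_mult)
  finally show "(\<Sum>j. (c j - d j)\<^sup>2) \<le> 2 * (\<Sum>j. (c j)\<^sup>2) + 2 * (\<Sum>j. (d j)\<^sup>2)" .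
qed

text \<open>Midpoints have energy at least m, so two late members have a small convexity defect; the
  concave error is small because finitely many coordinates nearly agree and the others are bounded
  in l^2. Convergence is therefore strong, as the limit in the cubic term requires.\<close>

lemma minimizing_sequence_Cauchy:
  assumes a: "0 < a" and b: "b \<longlonglongrightarrow> 0"
    and c: "\<And>n. fs (c n)" and m: "\<And>d. fs d \<Longrightarrow> m \<le> energy a b d"
    and lim: "(\<lambda>n. energy a b (c n)) \<longlonglongrightarrow> m" and l: "\<And>j. (\<lambda>n. c n j) \<longlonglongrightarrow> l j"
    and K2: "\<And>n. (\<Sum>j. (c n j)\<^sup>2) \<le> K2" and \<epsilon>: "0 < \<epsilon>"
  shows "\<exists>N. \<forall>i\<ge>N. \<forall>n\<ge>N. (\<integral>x. \<bar>P (c i) x - P (c n) x\<bar> ^ 4 \<partial>M) < \<epsilon>"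
proof -
  \<comment> \<open>The energy defect is below \<epsilon>' and the concave error at most
    \<epsilon>'/8, so 2\<epsilon>' leaves enough room.\<close>
  define \<epsilon>' where "\<epsilon>' = a / 64 * \<epsilon> / 2"
  have \<epsilon>': "0 < \<epsilon>'" using a \<epsilon> by (simp add: \<epsilon>'_def)
  have "0 \<le> K2" using K2[of 0] suminf_nonneg[OF fs_summable'[OF c[of 0]]] by auto
  then have K24: "0 \<le> 4 * K2" by simp
  obtain J \<delta> where \<delta>: "0 < \<delta>" and J: "\<And>d. (\<And>j. j < J \<Longrightarrow> \<bar>d j\<bar> < \<delta>) \<Longrightarrow> summable (\<lambda>j. (d j)\<^sup>2)
      \<Longrightarrow> (\<Sum>j. (d j)\<^sup>2) \<le> 4 * K2 \<Longrightarrow> \<bar>\<Sum>j. b j * (d j)\<^sup>2\<bar> \<le> \<epsilon>'"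
    by (rule small_on_bounded_sets[OF b \<epsilon>' K24]) blast
  have "\<forall>\<^sub>F n in sequentially. \<forall>j\<in>{..<J}. \<bar>c n j - l j\<bar> < \<delta> / 2"
    using tendstoD[OF l, of "\<delta> / 2"] \<delta>
    by (intro eventually_ball_finite) (auto simp: dist_real_def)
  moreover have "\<forall>\<^sub>F n in sequentially. \<bar>energy a b (c n) - m\<bar> < \<epsilon>'"
    using tendstoD[OF lim \<epsilon>'] by (simp add: dist_real_def)
  ultimately have "\<forall>\<^sub>F n in sequentially. (\<forall>j\<in>{..<J}. \<bar>c n j - l j\<bar> < \<delta> / 2) \<and> \<bar>energy a b (c n) - m\<bar> < \<epsilon>'"
    by eventually_elim auto
  then obtain N where N1: "\<And>n j. n \<ge> N \<Longrightarrow> j < J \<Longrightarrow> \<bar>c n j - l j\<bar> < \<delta> / 2"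
    and N2: "\<And>n. n \<ge> N \<Longrightarrow> \<bar>energy a b (c n) - m\<bar> < \<epsilon>'"
    by (auto simp: eventually_sequentially)
  show ?thesis
  proof (intro exI[of _ N] allI impI)
    fix i n assume i: "N \<le> i" and n: "N \<le> n"
    have "\<bar>\<Sum>j. b j * (c i j - c n j)\<^sup>2\<bar> \<le> \<epsilon>'"
    proof (rule J)
      fix j assume "j < J"
      then show "\<bar>c i j - c n j\<bar> < \<delta>" using N1[OF i, of j] N1[OF n, of j] by linarith
    next
      show "summable (\<lambda>j. (c i j - c n j)\<^sup>2)" by (rule sum_sq_diff_le c)+
      show "(\<Sum>j. (c i j - c n j)\<^sup>2) \<le> 4 * K2"
        using sum_sq_diff_le(1)[OF c c, of i n] K2[of i] K2[of n] by linarith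
    qed
    moreover have "A < E"
      if "\<bar>q\<bar> \<le> \<epsilon>'" "A \<le> (x + y) / 2 - z + q / 8" "m \<le> z" "\<bar>x - m\<bar> < \<epsilon>'" "\<bar>y - m\<bar> < \<epsilon>'" "E = 2 * \<epsilon>'"
      for A E q x y z
      using that \<epsilon>' by (simp add: add_divide_distrib)
    ultimately have "a / 64 * (\<integral>x. (P (c i) x - P (c n) x) ^ 4 \<partial>M) < 2 * \<epsilon>'"
      using energy_midpoint[OF a c c, of i n b] m[OF fs_combine[OF c c], of "1/2" i "1/2" n] N2[OF i] N2[OF n]
      by blast
    then have "a / 64 * (\<integral>x. (P (c i) x - P (c n) x) ^ 4 \<partial>M) < a / 64 * \<epsilon>"
      by (simp add: \<epsilon>'_def mult.commute)
    then show "(\<integral>x. \<bar>P (c i) x - P (c n) x\<bar> ^ 4 \<partial>M) < \<epsilon>"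
      using a by simp
  qed
qed

text \<open>The last conclusion says which linear conditions on cubes survive the limit: whatever
  annihilates the cubes of all finite combinations annihilates \<open>v ^ 3\<close>. Through it the
  symmetries of the system are later transferred to \<open>v\<close>, which is only an almost
  everywhere limit.\<close>

lemma minimizer:
  assumes a: "0 < a" and b: "b \<longlonglongrightarrow> 0" and bpos: "0 < b j0"
  obtains c v where "v \<in> borel_measurable M" "integrable M (\<lambda>x. v x ^ 4)"
    "\<And>j. a * (\<integral>x. v x ^ 3 * e j x \<partial>M) = b j * c j"
    "summable (\<lambda>j. (c j)\<^sup>2)" "\<exists>j. c j \<noteq> 0"
    "(\<lambda>N. \<integral>x. (v x - (\<Sum>j<N. c j * e j x))\<^sup>2 \<partial>M) \<longlonglongrightarrow> 0"
    "\<And>\<phi> B. \<phi> \<in> borel_measurable M \<Longrightarrow> (\<And>x. \<bar>\<phi> x\<bar> \<le> B) \<Longrightarrow>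
       (\<And>d. fs d \<Longrightarrow> (\<integral>x. P d x ^ 3 * \<phi> x \<partial>M) = 0) \<Longrightarrow> (\<integral>x. v x ^ 3 * \<phi> x \<partial>M) = 0"
proof -
  obtain c1 l m K4 K2 where c1: "\<And>n. fs (c1 n)" and m: "\<And>d. fs d \<Longrightarrow> m \<le> energy a b d" and mneg: "m < 0"
    and lim1: "(\<lambda>n. energy a b (c1 n)) \<longlonglongrightarrow> m" and l1: "\<And>j. (\<lambda>n. c1 n j) \<longlonglongrightarrow> l j"
    and K41: "\<And>n. (\<integral>x. P (c1 n) x ^ 4 \<partial>M) \<le> K4" and K21: "\<And>n. (\<Sum>j. (c1 n j)\<^sup>2) \<le> K2"
    by (rule minimizing_sequence[OF a b bpos]) blast
  have i4: "integrable M (\<lambda>x. \<bar>P (c1 n) x\<bar> ^ 4)" for n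
    using P_power_integrable'[OF c1, of n 4] by simp
  obtain r v K where r: "strict_mono r" and v[measurable]: "v \<in> borel_measurable M" and K: "integrable M K"
    and conv: "AE x in M. (\<lambda>n. P (c1 (r n)) x) \<longlonglongrightarrow> v x"
    and dom: "\<And>n. AE x in M. \<bar>P (c1 (r n)) x\<bar> ^ 4 \<le> K x"
    by (rule Lp_Cauchy_subseq[of 4 "\<lambda>n. P (c1 n)" M])
      (use i4 minimizing_sequence_Cauchy[OF a b c1 m lim1 l1 K21] in auto)
  define c where "c n = c1 (r n)" for n
  have c: "fs (c n)" and K4: "(\<integral>x. P (c n) x ^ 4 \<partial>M) \<le> K4" and K2: "(\<Sum>j. (c n j)\<^sup>2) \<le> K2" for n
    using c1 K41 K21 by (auto simp: c_def)
  have lim: "(\<lambda>n. energy a b (c n)) \<longlonglongrightarrow> m" and l: "(\<lambda>n. c n j) \<longlonglongrightarrow> l j" for j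
    using LIMSEQ_subseq_LIMSEQ[OF lim1 r] LIMSEQ_subseq_LIMSEQ[OF l1 r] by (auto simp: c_def o_def)
  have AEall: "AE x in M. (\<lambda>n. P (c n) x) \<longlonglongrightarrow> v x \<and> (\<forall>n. P (c n) x ^ 4 \<le> K x) \<and> v x ^ 4 \<le> K x"
  proof -
    have "AE x in M. \<forall>n. P (c n) x ^ 4 \<le> K x"
      using dom by (simp add: AE_all_countable c_def)
    with conv show ?thesis
    proof eventually_elim
      case (elim x)
      then have "(\<lambda>n. P (c n) x ^ 4) \<longlonglongrightarrow> v x ^ 4" by (intro tendsto_power) (simp add: c_def)
      then have "v x ^ 4 \<le> K x" using elim(2) by (intro LIMSEQ_le_const2) auto
      with elim show ?case by (simp add: c_def)
    qed
  qed
  have v4: "integrable M (\<lambda>x. v x ^ 4)"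
    by (rule Bochner_Integration.integrable_bound[OF K]) (use AEall in \<open>auto elim!: eventually_mono simp del: AE_conj_iff\<close>)
  have v2: "integrable M (\<lambda>x. (v x)\<^sup>2)"
    by (rule Bochner_Integration.integrable_bound[of M "\<lambda>x. 1 + v x ^ 4"])
      (use v4 power_le_one_plus_power4[of 2] in \<open>auto\<close>)
  \<comment> \<open>One statement covers the coefficients (k = 1) and the cubic term (k = 3): on a
    finite measure space the majorant of the fourth powers dominates all lower powers.\<close>
  have dct: "(\<lambda>n. \<integral>x. P (c n) x ^ k * \<phi> x \<partial>M) \<longlonglongrightarrow> (\<integral>x. v x ^ k * \<phi> x \<partial>M)"
    if [measurable]: "\<phi> \<in> borel_measurable M" and \<phi>: "\<And>x. \<bar>\<phi> x\<bar> \<le> B" and k: "k \<le> 4" for \<phi> B k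
  proof (rule integral_dominated_convergence[where w = "\<lambda>x. (1 + K x) * B"])
    show "integrable M (\<lambda>x. (1 + K x) * B)" using K by auto
    show "AE x in M. (\<lambda>n. P (c n) x ^ k * \<phi> x) \<longlonglongrightarrow> v x ^ k * \<phi> x"
      using AEall by eventually_elim (auto intro!: tendsto_intros)
    show "AE x in M. norm (P (c n) x ^ k * \<phi> x) \<le> (1 + K x) * B" for n
      using AEall
    proof eventually_elim
      case (elim x)
      have "\<bar>P (c n) x\<bar> ^ k \<le> 1 + P (c n) x ^ 4" by (rule power_le_one_plus_power4[OF k])
      also have "\<dots> \<le> 1 + K x" using elim by simp
      finally have "\<bar>P (c n) x\<bar> ^ k * \<bar>\<phi> x\<bar> \<le> (1 + K x) * B"
        by (intro mult_mono \<phi>) (auto intro: order_trans[rotated])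
      then show ?case by (simp add: abs_mult power_abs)
    qed
  qed auto
  have L2: "(\<lambda>n. \<integral>x. (v x - P (c n) x)\<^sup>2 \<partial>M) \<longlonglongrightarrow> (\<integral>x. 0 \<partial>M)"
  proof (rule integral_dominated_convergence[where w = "\<lambda>x. 4 * (1 + K x)"])
    show "integrable M (\<lambda>x. 4 * (1 + K x))" using K by auto
    show "AE x in M. (\<lambda>n. (v x - P (c n) x)\<^sup>2) \<longlonglongrightarrow> 0"
      using AEall by eventually_elim (auto intro!: tendsto_eq_intros)
    show "AE x in M. norm ((v x - P (c n) x)\<^sup>2) \<le> 4 * (1 + K x)" for n
      using AEall
    proof eventually_elim
      case (elim x)
      have "(v x - P (c n) x)\<^sup>2 \<le> 2 * (v x)\<^sup>2 + 2 * (P (c n) x)\<^sup>2"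
        using zero_le_power2[of "v x + P (c n) x"] by (simp add: power2_eq_square algebra_simps)
      moreover have "(v x)\<^sup>2 \<le> 1 + K x" "(P (c n) x)\<^sup>2 \<le> 1 + K x"
        using power_le_one_plus_power4[of 2 "v x"] power_le_one_plus_power4[of 2 "P (c n) x"] elim
        by (auto intro: order_trans)
      ultimately show ?case by simp
    qed
  qed auto
  have coeff: "(\<integral>x. v x * e j x \<partial>M) = h * l j" for j
  proof -
    have "(\<lambda>n. h * c n j) \<longlonglongrightarrow> (\<integral>x. v x * e j x \<partial>M)"
      using dct[OF e_meas e_bnd, of 1 j] P_coeff[OF c] by simp
    moreover have "(\<lambda>n. h * c n j) \<longlonglongrightarrow> h * l j" by (intro tendsto_intros l)
    ultimately show ?thesis by (rule LIMSEQ_unique)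
  qed
  have EL: "a * (\<integral>x. v x ^ 3 * e j x \<partial>M) = b j * l j" for j
  proof -
    let ?A = "a * (\<integral>x. v x ^ 3 * e j x \<partial>M) - b j * l j"
    let ?C = "a / 4 * (11 * measure M (space M) + 10 * K4) + \<bar>b j\<bar> / 2"
    have K40: "0 \<le> K4" using K4[of 0] by (rule order_trans[rotated]) simp
    have "?A = 0"
    proof (rule linear_term_zero[of ?C])
      show "0 \<le> ?C" using a K40 by (auto intro!: add_nonneg_nonneg mult_nonneg_nonneg)
      fix s :: real assume s: "\<bar>s\<bar> \<le> 1"
      \<comment> \<open>The shifted sequence has energy at least m and the slack on the left tends
        to 0, so the inequality holds in the limit with s still fixed.\<close>
      have "m - energy a b (c n) \<le> s * (a * (\<integral>x. P (c n) x ^ 3 * e j x \<partial>M) - b j * c n j) + s\<^sup>2 * ?C" for n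
      proof -
        have "fs (\<lambda>i. if i = j then 1 else 0)" unfolding fs_def by (intro exI[of _ "Suc j"]) auto
        from m[OF fs_combine[OF c[of n] this, of 1 s]] energy_single_shift[OF a c s K4, of b n j]
        show ?thesis by linarith
      qed
      moreover have "(\<lambda>n. m - energy a b (c n)) \<longlonglongrightarrow> m - m"
        by (intro tendsto_intros lim)
      moreover have "(\<lambda>n. s * (a * (\<integral>x. P (c n) x ^ 3 * e j x \<partial>M) - b j * c n j) + s\<^sup>2 * ?C) \<longlonglongrightarrow> s * ?A + s\<^sup>2 * ?C"
        using dct[OF e_meas e_bnd, of 3 j] by (intro tendsto_intros l) auto
      ultimately have "m - m \<le> s * ?A + s\<^sup>2 * ?C"
        using LIMSEQ_le[of "\<lambda>n. m - energy a b (c n)" "m - m"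
          "\<lambda>n. s * (a * (\<integral>x. P (c n) x ^ 3 * e j x \<partial>M) - b j * c n j) + s\<^sup>2 * ?C"] by blast
      then show "0 \<le> s * ?A + s\<^sup>2 * ?C" by simp
    qed
    then show ?thesis by simp
  qed
  have l2: "summable (\<lambda>j. (l j)\<^sup>2)"
  proof (rule summableI_nonneg_bounded[where x = K2])
    fix N
    have "(\<lambda>n. \<Sum>j<N. (c n j)\<^sup>2) \<longlonglongrightarrow> (\<Sum>j<N. (l j)\<^sup>2)" by (intro tendsto_intros l)
    moreover have "(\<Sum>j<N. (c n j)\<^sup>2) \<le> K2" for n
      using sum_le_suminf[OF fs_summable'[OF c], of "{..<N}" n] K2[of n] by auto
    ultimately show "(\<Sum>j<N. (l j)\<^sup>2) \<le> K2" by (intro LIMSEQ_le_const2) auto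
  qed auto
  \<comment> \<open>If all limit coefficients vanished, the quadratic form would become small by
    compactness and the energies could not fall below m/2, although they tend to the negative number
    m.\<close>
  have nz: "\<exists>j. l j \<noteq> 0"
  proof (rule ccontr)
    assume "\<not> ?thesis"
    then have l0: "l j = 0" for j by blast
    have K20: "0 \<le> K2" using K2[of 0] suminf_nonneg[OF fs_summable'[OF c[of 0]]] by auto
    have m0: "0 < - m" using mneg by simp
    obtain J \<delta> where \<delta>: "0 < (\<delta>::real)" and J: "\<And>d. (\<And>j. j < J \<Longrightarrow> \<bar>d j\<bar> < \<delta>) \<Longrightarrow> summable (\<lambda>j. (d j)\<^sup>2)
      \<Longrightarrow> (\<Sum>j. (d j)\<^sup>2) \<le> K2 \<Longrightarrow> \<bar>\<Sum>j. b j * (d j)\<^sup>2\<bar> \<le> - m"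
      by (rule small_on_bounded_sets[OF b m0 K20]) blast
    have "\<forall>\<^sub>F n in sequentially. \<forall>j\<in>{..<J}. \<bar>c n j\<bar> < \<delta>"
      using tendstoD[OF l \<delta>]
      by (intro eventually_ball_finite) (auto simp: dist_real_def l0)
    then have "\<forall>\<^sub>F n in sequentially. m / 2 \<le> energy a b (c n)"
    proof eventually_elim
      case (elim n)
      have "\<bar>\<Sum>j. b j * (c n j)\<^sup>2\<bar> \<le> - m"
        using elim by (intro J fs_summable'[OF c] K2) auto
      moreover have "0 \<le> a / 4 * (\<integral>x. P (c n) x ^ 4 \<partial>M)"
        using a by (intro mult_nonneg_nonneg) auto
      ultimately show ?case unfolding energy_def by linarith
    qed
    then have "m / 2 \<le> m" by (intro tendsto_lowerbound[OF lim]) auto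
    then show False using mneg by simp
  qed
  \<comment> \<open>A partial Fourier sum is the best approximation of its length, so beyond the
    support of \<open>c n\<close> it is at least as close to \<open>v\<close> as
    \<open>P (c n)\<close>.\<close>
  have L2': "(\<lambda>N. \<integral>x. (v x - (\<Sum>j<N. l j * e j x))\<^sup>2 \<partial>M) \<longlonglongrightarrow> 0"
  proof (rule LIMSEQ_I)
    fix \<epsilon> :: real assume "0 < \<epsilon>"
    then obtain n where n: "(\<integral>x. (v x - P (c n) x)\<^sup>2 \<partial>M) < \<epsilon>"
      using LIMSEQ_D[OF L2, of \<epsilon>] by fastforce
    obtain N0 where N0: "\<And>j. j \<ge> N0 \<Longrightarrow> c n j = 0" using c[of n] by (auto simp: fs_def)
    show "\<exists>N0. \<forall>N\<ge>N0. norm ((\<integral>x. (v x - (\<Sum>j<N. l j * e j x))\<^sup>2 \<partial>M) - 0) < \<epsilon>"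
    proof (intro exI[of _ N0] allI impI)
      fix N assume "N0 \<le> N"
      then have PN: "P (c n) x = (\<Sum>j<N. c n j * e j x)" for x by (intro P_eq N0) auto
      have "(\<integral>x. (v x - P (c n) x)\<^sup>2 \<partial>M) - (\<integral>x. (v x - (\<Sum>j<N. l j * e j x))\<^sup>2 \<partial>M)
          = h * (\<Sum>j<N. (c n j - l j)\<^sup>2)"
        unfolding PN sq_dist(2)[OF v v2] coeff
        by (simp add: sum_distrib_left sum_subtractf[symmetric] sum.distrib[symmetric] power2_eq_square algebra_simps)
      moreover have "0 \<le> h * (\<Sum>j<N. (c n j - l j)\<^sup>2)"
        using h_pos by (intro mult_nonneg_nonneg sum_nonneg) auto
      ultimately have "(\<integral>x. (v x - (\<Sum>j<N. l j * e j x))\<^sup>2 \<partial>M) < \<epsilon>" using n by linarith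
      then show "norm ((\<integral>x. (v x - (\<Sum>j<N. l j * e j x))\<^sup>2 \<partial>M) - 0) < \<epsilon>" by simp
    qed
  qed
  show ?thesis
  proof (rule that[OF v v4 EL l2 nz L2'])
    fix \<phi> B assume \<phi>: "\<phi> \<in> borel_measurable M" "\<And>x. \<bar>\<phi> x\<bar> \<le> B"
      and "\<And>d. fs d \<Longrightarrow> (\<integral>x. P d x ^ 3 * \<phi> x \<partial>M) = 0"
    then have "(\<lambda>n. 0) \<longlonglongrightarrow> (\<integral>x. v x ^ 3 * \<phi> x \<partial>M)"
      using dct[OF \<phi>, of 3] c by simp
    then show "(\<integral>x. v x ^ 3 * \<phi> x \<partial>M) = 0" by (simp add: LIMSEQ_const_iff)
  qed
qed

end

section \<open>Trigonometric series on a period\<close>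

text \<open>A measure of its own instead of set integrals, so that the results on finite measure
  spaces apply directly.\<close>

abbreviation IT :: "real \<Rightarrow> real measure" where
  "IT T \<equiv> restrict_space lborel {0..T}"

lemma IT_integrable: "integrable (IT T) f \<longleftrightarrow> set_integrable lborel {0..T} f"
  for f :: "real \<Rightarrow> real"
  by (simp add: integrable_restrict_space set_integrable_def)

lemma IT_integral: "integral\<^sup>L (IT T) f = (LINT t:{0..T}|lborel. f t)"
  for f :: "real \<Rightarrow> real"
  by (simp add: integral_restrict_space set_lebesgue_integral_def)

lemma IT_finite: "finite_measure (IT T)"
  by (rule finite_measureI) (simp add: space_restrict_space emeasure_restrict_space emeasure_lborel_Icc_eq)

lemma IT_integrable_cont: "continuous_on {0..T} f \<Longrightarrow> integrable (IT T) f"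
  for f :: "real \<Rightarrow> real"
  unfolding IT_integrable by (rule borel_integrable_atLeastAtMost')

lemma IT_measurable_cont: "continuous_on {0..T} f \<Longrightarrow> f \<in> borel_measurable (IT T)"
  for f :: "real \<Rightarrow> real"
  using IT_integrable_cont by blast

lemma IT_FTC:
  fixes f F :: "real \<Rightarrow> real"
  assumes "0 \<le> T" and "\<And>t. (F has_real_derivative f t) (at t)" and "continuous_on {0..T} f"
  shows "integral\<^sup>L (IT T) f = F T - F 0"
  unfolding IT_integral set_lebesgue_integral_def
  by (rule integral_FTC_atLeastAtMost)
    (use assms in \<open>auto simp: has_real_derivative_iff_has_vector_derivative[symmetric] intro: has_field_derivative_at_within\<close>)

lemma IT_reflect: "(\<integral>t. f (T - t) \<partial>IT T) = (\<integral>t. f t \<partial>IT T)"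
  for f :: "real \<Rightarrow> real"
proof -
  have "(\<integral>t. f t \<partial>IT T) = (\<integral>t. indicator {0..T} t *\<^sub>R f t \<partial>lborel)"
    by (simp add: integral_restrict_space)
  also have "\<dots> = (\<integral>t. indicator {0..T} (T + -1 * t) *\<^sub>R f (T + -1 * t) \<partial>lborel)"
    by (subst lborel_integral_real_affine[where c = "-1" and t = T]) auto
  also have "\<dots> = (\<integral>t. indicator {0..T} t *\<^sub>R f (T - t) \<partial>lborel)"
    by (intro Bochner_Integration.integral_cong) (auto simp: indicator_def)
  finally show ?thesis by (simp add: integral_restrict_space)
qed

text \<open>The two halves of the period cancel. This is the orthogonality of odd and even
  frequencies in a form that also applies to cubes.\<close>

lemma IT_antiperiodic_zero:
  fixes f :: "real \<Rightarrow> real"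
  assumes "0 \<le> T" and f: "continuous_on {0..T} f" and anti: "\<And>t. 0 \<le> t \<Longrightarrow> t \<le> T / 2 \<Longrightarrow> f (t + T / 2) = - f t"
  shows "integral\<^sup>L (IT T) f = 0"
proof -
  have "integral\<^sup>L (IT T) f = integral {0..T} f"
    unfolding IT_integral
    by (rule set_borel_integral_eq_integral) (rule borel_integrable_atLeastAtMost'[OF f])
  also have "\<dots> = integral {0..T/2} f + integral {T/2..T} f"
    using assms by (intro Henstock_Kurzweil_Integration.integral_combine[symmetric] integrable_continuous_interval) auto
  also have "integral {T/2..T} f = integral {T/2 - T/2..T - T/2} (\<lambda>t. f (t + T/2))"
    by (rule integral_shift_real_ivl[symmetric])
  also have "\<dots> = integral {0..T/2} (\<lambda>t. - f t)"
  proof -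
    have *: "{T/2 - T/2..T - T/2} = {0..T/2}" by simp
    show ?thesis unfolding * by (rule Henstock_Kurzweil_Integration.integral_cong) (use anti in auto)
  qed
  finally show ?thesis by simp
qed

lemma cos_at_period:
  assumes "0 < \<omega>" "T = 2 * pi / \<omega>"
  shows "cos (real k * \<omega> * T) = 1" "sin (real k * \<omega> * T) = 0"
proof -
  have "real k * \<omega> * T = 2 * pi * real k" using assms by (simp add: field_simps)
  then show "cos (real k * \<omega> * T) = 1" "sin (real k * \<omega> * T) = 0"
    by (simp_all only: cos_integer_2pi sin_integer_2pi Ints_of_nat)
qed

lemma IT_cos_int:
  assumes \<omega>: "0 < \<omega>" and T: "T = 2 * pi / \<omega>"
  shows "(\<integral>t. cos (of_int n * \<omega> * t) \<partial>IT T) = (if n = 0 then T else 0)"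
proof (cases "n = 0")
  case True
  have "0 \<le> T" using \<omega> T by simp
  then have "(\<integral>t. 1 \<partial>IT T) = T - 0"
    by (intro IT_FTC[of T "\<lambda>t. t"]) (auto intro!: derivative_eq_intros)
  then show ?thesis using True by simp
next
  case False
  have "0 \<le> T" using \<omega> T by simp
  then have "(\<integral>t. cos (of_int n * \<omega> * t) \<partial>IT T) = sin (of_int n * \<omega> * T) / (of_int n * \<omega>) - sin (of_int n * \<omega> * 0) / (of_int n * \<omega>)"
    using False \<omega>
    by (intro IT_FTC) (auto intro!: derivative_eq_intros continuous_intros)
  moreover have "of_int n * \<omega> * T = 2 * pi * of_int n" using \<omega> T by (simp add: field_simps)
  ultimately show ?thesis using False by simp
qed

lemma IT_cos_cos:
  assumes \<omega>: "0 < \<omega>" and T: "T = 2 * pi / \<omega>" and ij: "i + j > 0"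
  shows "(\<integral>t. cos (real i * \<omega> * t) * cos (real j * \<omega> * t) \<partial>IT T) = (if i = j then T / 2 else 0)"
    "(\<integral>t. sin (real i * \<omega> * t) * sin (real j * \<omega> * t) \<partial>IT T) = (if i = j then T / 2 else 0)"
proof -
  have int: "integrable (IT T) (\<lambda>t. cos (c * \<omega> * t))" for c
    by (intro IT_integrable_cont continuous_intros)
  have c: "cos (real i * \<omega> * t) * cos (real j * \<omega> * t)
      = (cos (of_int (int i - int j) * \<omega> * t) + cos (of_int (int i + int j) * \<omega> * t)) / 2"
    and s: "sin (real i * \<omega> * t) * sin (real j * \<omega> * t)
      = (cos (of_int (int i - int j) * \<omega> * t) - cos (of_int (int i + int j) * \<omega> * t)) / 2" for t
    by (simp_all add: cos_times_cos sin_times_sin algebra_simps)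
  have lin: "(\<integral>t. (cos (p * \<omega> * t) + cos (q * \<omega> * t)) / 2 \<partial>IT T)
      = ((\<integral>t. cos (p * \<omega> * t) \<partial>IT T) + (\<integral>t. cos (q * \<omega> * t) \<partial>IT T)) / 2"
    "(\<integral>t. (cos (p * \<omega> * t) - cos (q * \<omega> * t)) / 2 \<partial>IT T)
      = ((\<integral>t. cos (p * \<omega> * t) \<partial>IT T) - (\<integral>t. cos (q * \<omega> * t) \<partial>IT T)) / 2" for p q
    using int by simp_all
  show "(\<integral>t. cos (real i * \<omega> * t) * cos (real j * \<omega> * t) \<partial>IT T) = (if i = j then T / 2 else 0)"
    "(\<integral>t. sin (real i * \<omega> * t) * sin (real j * \<omega> * t) \<partial>IT T) = (if i = j then T / 2 else 0)"
    unfolding c s lin IT_cos_int[OF \<omega> T] using ij by auto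
qed

lemma IT_integrable_mult_cont:
  fixes F \<phi> :: "real \<Rightarrow> real"
  assumes F: "integrable (IT T) F" and \<phi>: "continuous_on {0..T} \<phi>"
  shows "integrable (IT T) (\<lambda>t. F t * \<phi> t)"
proof -
  have "compact (\<phi> ` {0..T})" using \<phi> by (intro compact_continuous_image) auto
  then obtain B where B: "\<And>t. t \<in> {0..T} \<Longrightarrow> \<bar>\<phi> t\<bar> \<le> B"
    by (metis bounded_real compact_imp_bounded imageI)
  show ?thesis
  proof (rule Bochner_Integration.integrable_bound[of _ "\<lambda>t. B * F t"])
    show "integrable (IT T) (\<lambda>t. B * F t)" using F by simp
    show "(\<lambda>t. F t * \<phi> t) \<in> borel_measurable (IT T)"
      using F IT_measurable_cont[OF \<phi>] by (intro borel_measurable_times) auto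
    show "AE t in IT T. norm (F t * \<phi> t) \<le> norm (B * F t)"
    proof (rule AE_I2)
      fix t assume "t \<in> space (IT T)"
      then have "\<bar>\<phi> t\<bar> \<le> \<bar>B\<bar>" using B[of t] by (simp add: space_restrict_space)
      then show "norm (F t * \<phi> t) \<le> norm (B * F t)"
        by (simp add: abs_mult mult.commute[of "\<bar>B\<bar>"] mult_left_mono)
    qed
  qed
qed

text \<open>An even function of period \<^term>\<open>T\<close> is a function of \<open>cos (\<omega> t)\<close>, hence a uniform limit of
  polynomials in \<open>cos (\<omega> t)\<close>.\<close>
lemma cos_system_complete:
  fixes F \<phi> :: "real \<Rightarrow> real"
  assumes \<omega>: "0 < \<omega>" and T: "T = 2 * pi / \<omega>" and F: "integrable (IT T) F"
    and Fcos: "\<And>i. (\<integral>t. F t * cos (real i * \<omega> * t) \<partial>IT T) = 0"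
    and Frefl: "\<And>\<psi>. continuous_on {0..T} \<psi> \<Longrightarrow> (\<integral>t. F t * (\<psi> t - \<psi> (T - t)) \<partial>IT T) = 0"
    and \<phi>: "continuous_on {0..T} \<phi>"
  shows "(\<integral>t. F t * \<phi> t \<partial>IT T) = 0"
proof -
  have T0: "0 < T" using \<omega> T by simp
  define \<phi>e where "\<phi>e t = (\<phi> t + \<phi> (T - t)) / 2" for t
  have \<phi>r: "continuous_on {0..T} (\<lambda>t. \<phi> (T - t))"
    by (rule continuous_on_compose2[OF \<phi>]) (auto intro!: continuous_intros)
  have \<phi>e: "continuous_on {0..T} \<phi>e"
    unfolding \<phi>e_def by (intro continuous_intros \<phi> \<phi>r) auto
  \<comment> \<open>Multiplication by cos (\<omega> t) shifts the frequency by one in both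
    directions, so vanishing cosine coefficients propagate to all powers; n = 0 is separate because
    its lower neighbour would be -1.\<close>
  have cosm: "(\<integral>t. F t * (cos (\<omega> * t) ^ m * cos (real n * \<omega> * t)) \<partial>IT T) = 0" for m n
  proof (induction m arbitrary: n)
    case 0
    then show ?case using Fcos by simp
  next
    case (Suc m)
    have i: "integrable (IT T) (\<lambda>t. F t * (cos (\<omega> * t) ^ m * cos (real k * \<omega> * t)))" for k
      by (intro IT_integrable_mult_cont F continuous_intros)
    show ?case
    proof (cases n)
      case 0
      then show ?thesis using Suc[of 1] by (simp add: mult_ac)
    next
      case n: (Suc n')
      have eq: "F t * (cos (\<omega> * t) ^ Suc m * cos (real n * \<omega> * t))
          = (F t * (cos (\<omega> * t) ^ m * cos (real n' * \<omega> * t))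
            + F t * (cos (\<omega> * t) ^ m * cos (real (Suc n) * \<omega> * t))) / 2" for t
      proof -
        have "cos (\<omega> * t) * cos (real n * \<omega> * t) = (cos (real n' * \<omega> * t) + cos (real (Suc n) * \<omega> * t)) / 2"
          unfolding mult.commute[of "cos (\<omega> * t)"] cos_times_cos by (simp add: n algebra_simps)
        then have "F t * cos (\<omega> * t) ^ m * (cos (\<omega> * t) * cos (real n * \<omega> * t))
          = F t * cos (\<omega> * t) ^ m * ((cos (real n' * \<omega> * t) + cos (real (Suc n) * \<omega> * t)) / 2)" by simp
        then show ?thesis by (simp add: algebra_simps)
      qed
      show ?thesis unfolding eq using Suc[of n'] Suc[of "Suc n"] i[of n'] i[of "Suc n"] by simp
    qed
  qed
  have poly: "(\<integral>t. F t * g (cos (\<omega> * t)) \<partial>IT T) = 0" if gp: "real_polynomial_function g" for g :: "real \<Rightarrow> real"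
  proof -
    obtain a n where g: "g = (\<lambda>x. \<Sum>i\<le>n. a i * x ^ i)"
      using gp unfolding real_polynomial_function_iff_sum by blast
    have i: "integrable (IT T) (\<lambda>t. F t * cos (\<omega> * t) ^ k)" for k
      by (intro IT_integrable_mult_cont F continuous_intros)
    have "(\<integral>t. F t * g (cos (\<omega> * t)) \<partial>IT T) = (\<integral>t. (\<Sum>i\<le>n. a i * (F t * cos (\<omega> * t) ^ i)) \<partial>IT T)"
      unfolding g by (simp add: sum_distrib_left mult_ac)
    also have "\<dots> = (\<Sum>i\<le>n. a i * (\<integral>t. F t * cos (\<omega> * t) ^ i \<partial>IT T))"
      using i by (subst Bochner_Integration.integral_sum) auto
    also have "\<dots> = 0" using cosm[of _ 0] by simp
    finally show ?thesis .
  qed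
  \<comment> \<open>The even part in the variable s = cos (\<omega> t). \<open>arccos\<close>
    reaches only the first half of the period; the symmetry of \<open>\<phi>e\<close> about T/2
    covers the second.\<close>
  define G where "G s = \<phi>e (arccos s / \<omega>)" for s
  have G: "continuous_on {-1..1} G"
    unfolding G_def
  proof (rule continuous_on_compose2[OF \<phi>e])
    show "continuous_on {-1..1} (\<lambda>s. arccos s / \<omega>)"
      using \<omega> by (intro continuous_intros) auto
    have "arccos s / \<omega> \<le> T" if "s \<in> {-1..1}" for s
    proof -
      have "arccos s \<le> 2 * pi" using arccos_ubound[of s] that pi_gt_zero by (auto intro: order_trans)
      then show ?thesis using \<omega> T by (simp add: field_simps)
    qed
    then show "(\<lambda>s. arccos s / \<omega>) ` {-1..1} \<subseteq> {0..T}"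
      using \<omega> by (auto intro!: divide_nonneg_pos arccos_lbound)
  qed
  have Gcos: "G (cos (\<omega> * t)) = \<phi>e t" if t: "t \<in> {0..T}" for t
  proof (cases "\<omega> * t \<le> pi")
    case True
    then show ?thesis using t \<omega> by (simp add: G_def arccos_cos)
  next
    case False
    have e: "\<omega> * (T - t) = 2 * pi - \<omega> * t" using \<omega> T by (simp add: field_simps)
    have "cos (\<omega> * t) = cos (\<omega> * (T - t))" unfolding e by (simp add: cos_diff)
    moreover have "arccos (cos (\<omega> * (T - t))) = \<omega> * (T - t)"
    proof (rule arccos_cos)
      show "0 \<le> \<omega> * (T - t)" using t \<omega> by simp
      show "\<omega> * (T - t) \<le> pi" using False e by linarith
    qed
    ultimately show ?thesis using \<omega> by (simp add: G_def \<phi>e_def)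
  qed
  \<comment> \<open>What remains of \<phi> beside its even part is odd under t -> T - t and is
    annihilated by assumption.\<close>
  have "(\<integral>t. F t * \<phi> t \<partial>IT T) = (\<integral>t. F t * \<phi>e t + F t * (\<phi> t - \<phi> (T - t)) / 2 \<partial>IT T)"
    by (simp add: \<phi>e_def field_simps)
  also have "\<dots> = (\<integral>t. F t * \<phi>e t \<partial>IT T)"
    using IT_integrable_mult_cont[OF F \<phi>e] IT_integrable_mult_cont[OF F continuous_on_diff[OF \<phi> \<phi>r]] Frefl[OF \<phi>]
    by simp
  also have "\<dots> = 0"
  proof -
    have bd: "\<bar>\<integral>t. F t * \<phi>e t \<partial>IT T\<bar> \<le> \<epsilon> * (\<integral>t. \<bar>F t\<bar> \<partial>IT T)" if \<epsilon>: "0 < \<epsilon>" for \<epsilon>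
    proof -
      obtain g where g: "real_polynomial_function g" "\<And>x. x \<in> {-1..1} \<Longrightarrow> \<bar>G x - g x\<bar> < \<epsilon>"
        using Stone_Weierstrass_real_polynomial_function[OF _ G \<epsilon>] by auto
      have gc: "continuous_on {0..T} (\<lambda>t. g (cos (\<omega> * t)))"
      proof -
        obtain a n where g': "g = (\<lambda>x. \<Sum>i\<le>n. a i * x ^ i)"
          using g(1) unfolding real_polynomial_function_iff_sum by blast
        show ?thesis unfolding g' by (intro continuous_intros)
      qed
      have i1: "integrable (IT T) (\<lambda>t. F t * \<phi>e t)" "integrable (IT T) (\<lambda>t. F t * g (cos (\<omega> * t)))"
        by (intro IT_integrable_mult_cont F \<phi>e gc)+
      have "(\<integral>t. F t * \<phi>e t \<partial>IT T) = (\<integral>t. F t * \<phi>e t - F t * g (cos (\<omega> * t)) \<partial>IT T)"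
        using i1 poly[OF g(1)] by simp
      also have "\<bar>\<dots>\<bar> \<le> (\<integral>t. \<bar>F t * \<phi>e t - F t * g (cos (\<omega> * t))\<bar> \<partial>IT T)"
        by (rule integral_abs_bound)
      also have "\<dots> \<le> (\<integral>t. \<epsilon> * \<bar>F t\<bar> \<partial>IT T)"
      proof (rule integral_mono)
        show "integrable (IT T) (\<lambda>t. \<bar>F t * \<phi>e t - F t * g (cos (\<omega> * t))\<bar>)" "integrable (IT T) (\<lambda>t. \<epsilon> * \<bar>F t\<bar>)"
          using i1 F by auto
        fix t assume "t \<in> space (IT T)"
        then have t: "t \<in> {0..T}" by (simp add: space_restrict_space)
        have "\<bar>\<phi>e t - g (cos (\<omega> * t))\<bar> \<le> \<epsilon>"
          using g(2)[of "cos (\<omega> * t)"] Gcos[OF t] by simp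
        then have "\<bar>F t\<bar> * \<bar>\<phi>e t - g (cos (\<omega> * t))\<bar> \<le> \<bar>F t\<bar> * \<epsilon>" by (intro mult_left_mono) auto
        then show "\<bar>F t * \<phi>e t - F t * g (cos (\<omega> * t))\<bar> \<le> \<epsilon> * \<bar>F t\<bar>"
          by (simp add: abs_mult[symmetric] right_diff_distrib mult.commute)
      qed
      finally show ?thesis by simp
    qed
    show ?thesis
    proof (rule ccontr)
      assume nz: "(\<integral>t. F t * \<phi>e t \<partial>IT T) \<noteq> 0"
      define A where "A = (\<integral>t. \<bar>F t\<bar> \<partial>IT T)"
      have A: "0 \<le> A" by (simp add: A_def)
      define I where "I = \<bar>\<integral>t. F t * \<phi>e t \<partial>IT T\<bar>"
      have I: "0 < I" using nz by (simp add: I_def)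
      \<comment> \<open>With this \<epsilon> the bound would read I < I; the added 1 keeps the
        denominator positive when A = 0.\<close>
      have "0 < I / (2 * (A + 1))" using I A by (intro divide_pos_pos) auto
      then have "I \<le> (I / (2 * (A + 1))) * A"
        using bd unfolding A_def[symmetric] I_def[symmetric] by blast
      also have "\<dots> < I"
      proof -
        have "I * A < I * (2 * (A + 1))" using I A by (intro mult_strict_left_mono) auto
        then show ?thesis using A by (simp add: field_simps)
      qed
      finally show False by simp
    qed
  qed
  finally show ?thesis .
qed

section \<open>The minimiser in the odd cosine system\<close>

lemma cos_orth_system:
  assumes \<omega>: "0 < \<omega>" and T: "T = 2 * pi / \<omega>"
  shows "orth_system (IT T) (\<lambda>j t. cos (real (2 * j + 1) * \<omega> * t)) (T / 2)"
proof (intro orth_system.intro orth_system_axioms.intro IT_finite)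
  show "(\<lambda>t. cos (real (2 * j + 1) * \<omega> * t)) \<in> borel_measurable (IT T)" for j
    by (intro IT_measurable_cont continuous_intros)
  show "(\<integral>t. cos (real (2 * i + 1) * \<omega> * t) * cos (real (2 * j + 1) * \<omega> * t) \<partial>IT T) = (if i = j then T / 2 else 0)" for i j
    using IT_cos_cos(1)[OF \<omega> T, of "2 * i + 1" "2 * j + 1"] by simp
qed (use \<omega> T in auto)

text \<open>Criticality, known coefficient by coefficient, becomes an identity against every
  continuous function on the period. The odd cosine coefficients of the residual vanish by
  criticality; its even ones and its part odd under reflection vanish because they do so for cubes
  of trigonometric polynomials. Square summability of \<open>b\<close> is what makes the linear side
  a uniformly convergent series.\<close>

lemma periodic_minimizer:
  fixes a \<omega> T :: real and b :: "nat \<Rightarrow> real"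
  assumes \<omega>: "0 < \<omega>" and T: "T = 2 * pi / \<omega>" and a: "0 < a"
    and b2: "summable (\<lambda>j. (b j)\<^sup>2)" and bpos: "0 < b j0"
  obtains c v where "v \<in> borel_measurable (IT T)" "integrable (IT T) (\<lambda>t. v t ^ 4)"
    "summable (\<lambda>j. (c j)\<^sup>2)" "\<exists>j. c j \<noteq> 0"
    "(\<lambda>N. \<integral>t. (v t - (\<Sum>j<N. c j * cos (real (2 * j + 1) * \<omega> * t)))\<^sup>2 \<partial>IT T) \<longlonglongrightarrow> 0"
    "\<And>\<phi>. continuous_on {0..T} \<phi> \<Longrightarrow>
      (\<lambda>j. 2 / T * b j * c j * (\<integral>t. cos (real (2 * j + 1) * \<omega> * t) * \<phi> t \<partial>IT T))
        sums (a * (\<integral>t. v t ^ 3 * \<phi> t \<partial>IT T))"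
proof -
  have T0: "0 < T" using \<omega> T by simp
  define e where "e j t = cos (real (2 * j + 1) * \<omega> * t)" for j t
  interpret orth_system "IT T" e "T / 2"
    unfolding e_def by (rule cos_orth_system[OF \<omega> T])
  have e_cont: "continuous_on A (e j)" for A j unfolding e_def by (intro continuous_intros)
  have b: "b \<longlonglongrightarrow> 0"
    using summable_LIMSEQ_zero[OF b2] by simp
  obtain c v where v[measurable]: "v \<in> borel_measurable (IT T)" and v4: "integrable (IT T) (\<lambda>x. v x ^ 4)"
    and EL: "\<And>j. a * (\<integral>x. v x ^ 3 * e j x \<partial>IT T) = b j * c j"
    and c2: "summable (\<lambda>j. (c j)\<^sup>2)" and nz: "\<exists>j. c j \<noteq> 0"
    and L2: "(\<lambda>N. \<integral>x. (v x - (\<Sum>j<N. c j * e j x))\<^sup>2 \<partial>IT T) \<longlonglongrightarrow> 0"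
    and ann: "\<And>\<phi> B. \<phi> \<in> borel_measurable (IT T) \<Longrightarrow> (\<And>x. \<bar>\<phi> x\<bar> \<le> B) \<Longrightarrow>
       (\<And>d. fs d \<Longrightarrow> (\<integral>x. P d x ^ 3 * \<phi> x \<partial>IT T) = 0) \<Longrightarrow> (\<integral>x. v x ^ 3 * \<phi> x \<partial>IT T) = 0"
    by (rule minimizer[OF a b bpos]) blast
  have v3: "integrable (IT T) (\<lambda>t. v t ^ 3)"
    by (rule Bochner_Integration.integrable_bound[of _ "\<lambda>t. 1 + v t ^ 4"])
      (use v4 power_le_one_plus_power4[of 3] in \<open>auto simp: power_abs[symmetric]\<close>)
  have P_cont: "continuous_on A (P d)" if d: "fs d" for d A
  proof -
    obtain N where N: "\<And>j. j \<ge> N \<Longrightarrow> d j = 0" using d by (auto simp: fs_def)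
    have "P d = (\<lambda>t. \<Sum>j<N. d j * e j t)" by (intro ext P_eq N)
    then show ?thesis by (auto intro!: continuous_intros e_cont)
  qed
  have e_anti: "e j (t + T / 2) = - e j t" for j t
  proof -
    have "real (2 * j + 1) * \<omega> * (t + T / 2) = (real (2 * j + 1) * \<omega> * t + pi) + 2 * pi * real j"
      using \<omega> T by (simp add: field_simps)
    then show ?thesis unfolding e_def by (simp add: cos_add cos_integer_2pi sin_integer_2pi)
  qed
  have e_refl: "e j (T - t) = e j t" for j t
  proof -
    have "real (2 * j + 1) * \<omega> * (T - t) = 2 * pi * real (2 * j + 1) - real (2 * j + 1) * \<omega> * t"
      using \<omega> T by (simp add: field_simps)
    then show ?thesis unfolding e_def
      by (simp only: cos_diff cos_integer_2pi sin_integer_2pi Ints_of_nat)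
  qed
  have P_anti: "P d (t + T / 2) = - P d t" if d: "fs d" for d t
  proof -
    obtain N where N: "\<And>j. j \<ge> N \<Longrightarrow> d j = 0" using d by (auto simp: fs_def)
    show ?thesis using N by (simp add: P_eq[of N] e_anti sum_negf)
  qed
  have P_refl: "P d (T - t) = P d t" if "fs d" for d t
    unfolding P_def e_refl ..
  \<comment> \<open>The annihilation property asks for a globally bounded function, so \<phi> is cut
    off outside the period, which integrals over \<open>IT T\<close> do not see.\<close>
  have ann': "(\<integral>t. v t ^ 3 * \<phi> t \<partial>IT T) = 0"
    if \<phi>: "continuous_on {0..T} \<phi>" and 0: "\<And>d. fs d \<Longrightarrow> (\<integral>x. P d x ^ 3 * \<phi> x \<partial>IT T) = 0" for \<phi>
  proof -
    have "compact (\<phi> ` {0..T})" using \<phi> by (intro compact_continuous_image) auto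
    then obtain B where B: "\<And>t. t \<in> {0..T} \<Longrightarrow> \<bar>\<phi> t\<bar> \<le> B"
      by (metis bounded_real compact_imp_bounded imageI)
    define \<psi> where "\<psi> t = (if t \<in> {0..T} then \<phi> t else 0)" for t
    have cong: "(\<integral>t. f t * \<psi> t \<partial>IT T) = (\<integral>t. f t * \<phi> t \<partial>IT T)" for f
      by (intro Bochner_Integration.integral_cong) (auto simp: \<psi>_def space_restrict_space)
    have "(\<integral>t. v t ^ 3 * \<psi> t \<partial>IT T) = 0"
    proof (rule ann)
      show "\<psi> \<in> borel_measurable (IT T)"
        by (rule measurable_cong[THEN iffD2, OF _ IT_measurable_cont[OF \<phi>]])
          (auto simp: \<psi>_def space_restrict_space)
      show "\<bar>\<psi> t\<bar> \<le> \<bar>B\<bar>" for t using B[of t] by (auto simp: \<psi>_def)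
      show "(\<integral>x. P d x ^ 3 * \<psi> x \<partial>IT T) = 0" if "fs d" for d
        using 0[OF that] cong by simp
    qed
    then show ?thesis using cong by simp
  qed
  have bc: "summable (\<lambda>j. \<bar>b j * c j\<bar>)"
  proof (rule summable_comparison_test)
    show "summable (\<lambda>j. (b j)\<^sup>2 + (c j)\<^sup>2)" by (intro summable_add b2 c2)
    have "\<bar>b j * c j\<bar> \<le> (b j)\<^sup>2 + (c j)\<^sup>2" for j
    proof -
      have "2 * (\<bar>b j\<bar> * \<bar>c j\<bar>) \<le> (b j)\<^sup>2 + (c j)\<^sup>2"
        using sum_squares_bound[of "\<bar>b j\<bar>" "\<bar>c j\<bar>"] by simp
      moreover have "0 \<le> \<bar>b j\<bar> * \<bar>c j\<bar>" by simp
      ultimately show ?thesis unfolding abs_mult by linarith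
    qed
    then show "\<exists>N. \<forall>j\<ge>N. norm \<bar>b j * c j\<bar> \<le> (b j)\<^sup>2 + (c j)\<^sup>2" by simp
  qed
  define G where "G t = (\<Sum>j. b j * c j * e j t)" for t
  have Gcont: "continuous_on UNIV G" and Gterm: "\<And>t. (\<lambda>j. b j * c j * e j t) sums G t"
  proof -
    have le: "norm (b j * c j * e j t) \<le> \<bar>b j * c j\<bar>" for j t
      using e_bnd[of j t] by (simp add: abs_mult mult_left_le)
    have ul: "uniform_limit UNIV (\<lambda>n t. \<Sum>j<n. b j * c j * e j t) G sequentially"
      unfolding G_def by (rule Weierstrass_m_test[OF le bc])
    show "continuous_on UNIV G"
      by (rule uniform_limit_theorem[OF _ ul])
        (auto intro!: always_eventually continuous_intros e_cont)
    show "(\<lambda>j. b j * c j * e j t) sums G t" for t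
      unfolding G_def by (intro summable_sums summable_norm_cancel[OF summable_comparison_test[OF _ bc]])
        (use le in auto)
  qed
  have Gsum: "(\<lambda>j. b j * c j * (\<integral>t. e j t * \<phi> t \<partial>IT T)) sums (\<integral>t. G t * \<phi> t \<partial>IT T)"
    if \<phi>: "continuous_on {0..T} \<phi>" for \<phi>
  proof -
    have ie: "integrable (IT T) (\<lambda>t. e j t * \<phi> t)" for j
      by (intro IT_integrable_cont continuous_intros e_cont \<phi>)
    have i\<phi>: "integrable (IT T) (\<lambda>t. \<bar>\<phi> t\<bar>)"
      by (intro IT_integrable_cont continuous_intros \<phi>)
    have "(\<lambda>N. \<integral>t. (\<Sum>j<N. b j * c j * e j t) * \<phi> t \<partial>IT T) \<longlonglongrightarrow> (\<integral>t. G t * \<phi> t \<partial>IT T)"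
    proof (rule integral_dominated_convergence[where w = "\<lambda>t. (\<Sum>j. \<bar>b j * c j\<bar>) * \<bar>\<phi> t\<bar>"])
      show "(\<lambda>t. G t * \<phi> t) \<in> borel_measurable (IT T)"
        by (intro IT_measurable_cont continuous_intros \<phi> continuous_on_subset[OF Gcont]) auto
      show "(\<lambda>t. (\<Sum>j<N. b j * c j * e j t) * \<phi> t) \<in> borel_measurable (IT T)" for N
        by (intro IT_measurable_cont continuous_intros \<phi> e_cont)
      show "integrable (IT T) (\<lambda>t. (\<Sum>j. \<bar>b j * c j\<bar>) * \<bar>\<phi> t\<bar>)" using i\<phi> by simp
      show "AE t in IT T. (\<lambda>N. (\<Sum>j<N. b j * c j * e j t) * \<phi> t) \<longlonglongrightarrow> G t * \<phi> t"
        using Gterm by (intro AE_I2 tendsto_intros) (auto simp: sums_def)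
      show "AE t in IT T. norm ((\<Sum>j<N. b j * c j * e j t) * \<phi> t) \<le> (\<Sum>j. \<bar>b j * c j\<bar>) * \<bar>\<phi> t\<bar>" for N
      proof (rule AE_I2)
        fix t
        have "\<bar>\<Sum>j<N. b j * c j * e j t\<bar> \<le> (\<Sum>j<N. \<bar>b j * c j\<bar>)" by (rule sum_bdd)
        also have "\<dots> \<le> (\<Sum>j. \<bar>b j * c j\<bar>)" by (intro sum_le_suminf bc) auto
        finally show "norm ((\<Sum>j<N. b j * c j * e j t) * \<phi> t) \<le> (\<Sum>j. \<bar>b j * c j\<bar>) * \<bar>\<phi> t\<bar>"
          by (simp add: abs_mult mult_right_mono)
      qed
    qed
    moreover have "(\<integral>t. (\<Sum>j<N. b j * c j * e j t) * \<phi> t \<partial>IT T) = (\<Sum>j<N. b j * c j * (\<integral>t. e j t * \<phi> t \<partial>IT T))" for N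
      unfolding sum_distrib_right mult.assoc using ie
      by (subst Bochner_Integration.integral_sum) auto
    ultimately show ?thesis by (simp add: sums_def)
  qed
  have G_zero: "(\<integral>t. G t * \<phi> t \<partial>IT T) = 0"
    if "continuous_on {0..T} \<phi>" "\<And>j. (\<integral>t. e j t * \<phi> t \<partial>IT T) = 0" for \<phi>
    using Gsum[OF that(1)] that(2) by (simp add: sums_iff)
  \<comment> \<open>The residual of the Euler-Lagrange equation; 2/T compensates the squared norm
    T/2 of the cosines.\<close>
  define F where "F t = a * v t ^ 3 - 2 / T * G t" for t
  have iG: "integrable (IT T) G" by (intro IT_integrable_cont continuous_on_subset[OF Gcont]) auto
  have F: "integrable (IT T) F" unfolding F_def using v3 iG by auto
  have F_eq: "(\<integral>t. F t * \<phi> t \<partial>IT T) = a * (\<integral>t. v t ^ 3 * \<phi> t \<partial>IT T) - 2 / T * (\<integral>t. G t * \<phi> t \<partial>IT T)"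
    if \<phi>: "continuous_on {0..T} \<phi>" for \<phi>
    using IT_integrable_mult_cont[OF v3 \<phi>] IT_integrable_mult_cont[OF iG \<phi>]
    by (simp add: F_def left_diff_distrib mult.assoc)
  have F0: "(\<integral>t. F t * \<phi> t \<partial>IT T) = 0" if \<phi>: "continuous_on {0..T} \<phi>" for \<phi>
  proof (rule cos_system_complete[OF \<omega> T F _ _ \<phi>])
    fix i
    let ?c = "\<lambda>t. cos (real i * \<omega> * t)"
    have cc: "continuous_on A ?c" for A by (intro continuous_intros)
    show "(\<integral>t. F t * ?c t \<partial>IT T) = 0"
    proof (cases "odd i")
      case True
      then obtain j where j: "i = 2 * j + 1" by (elim oddE)
      then have ce: "?c t = e j t" for t by (simp add: e_def)
      have "(\<integral>t. G t * e j t \<partial>IT T) = b j * c j * (T / 2)"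
      proof -
        have "(\<lambda>i. b i * c i * (\<integral>t. e i t * e j t \<partial>IT T)) sums (\<integral>t. G t * e j t \<partial>IT T)"
          by (rule Gsum[OF e_cont])
        moreover have "b i * c i * (\<integral>t. e i t * e j t \<partial>IT T) = (if i = j then b j * c j * (T / 2) else 0)" for i
          by (simp add: orth)
        ultimately show ?thesis
          using sums_single[of j "\<lambda>_. b j * c j * (T / 2)"] by (simp add: sums_iff)
      qed
      then show ?thesis unfolding ce F_eq[OF e_cont] using EL[of j] T0 by (simp add: field_simps)
    next
      case False
      have cp: "?c (t + T / 2) = ?c t" for t
      proof -
        obtain k where "i = 2 * k" using False by (auto elim: evenE)
        then have "real i * \<omega> * (t + T / 2) = real i * \<omega> * t + 2 * pi * real k"
          using \<omega> T by (simp add: field_simps)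
        then show ?thesis by (simp add: cos_add cos_integer_2pi sin_integer_2pi)
      qed
      \<comment> \<open>For even i the cosine has period T/2, while the cube of an odd trigonometric
        polynomial changes sign under that shift.\<close>
      have 1: "(\<integral>t. v t ^ 3 * ?c t \<partial>IT T) = 0"
      proof (rule ann'[OF cc])
        fix d assume d: "fs d"
        show "(\<integral>t. P d t ^ 3 * ?c t \<partial>IT T) = 0"
        proof (rule IT_antiperiodic_zero)
          fix t show "P d (t + T / 2) ^ 3 * ?c (t + T / 2) = - (P d t ^ 3 * ?c t)"
            unfolding P_anti[OF d] cp by (simp add: power3_eq_cube)
        qed (use T0 in \<open>auto intro!: continuous_intros P_cont d\<close>)
      qed
      have 2: "(\<integral>t. G t * ?c t \<partial>IT T) = 0"
      proof (rule G_zero[OF cc])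
        fix j show "(\<integral>t. e j t * ?c t \<partial>IT T) = 0"
        proof (rule IT_antiperiodic_zero)
          fix t show "e j (t + T / 2) * ?c (t + T / 2) = - (e j t * ?c t)"
            unfolding e_anti cp by simp
        qed (use T0 in \<open>auto intro!: continuous_intros e_cont\<close>)
      qed
      show ?thesis unfolding F_eq[OF cc] 1 2 by simp
    qed
  next
    fix \<psi> :: "real \<Rightarrow> real" assume \<psi>: "continuous_on {0..T} \<psi>"
    have \<psi>r: "continuous_on {0..T} (\<lambda>t. \<psi> (T - t))"
      by (rule continuous_on_compose2[OF \<psi>]) (auto intro!: continuous_intros)
    have d: "continuous_on {0..T} (\<lambda>t. \<psi> t - \<psi> (T - t))" by (intro continuous_intros \<psi> \<psi>r)
    have sym: "(\<integral>t. f t * (\<psi> t - \<psi> (T - t)) \<partial>IT T) = 0"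
      if "continuous_on {0..T} f" "\<And>t. f (T - t) = f t" for f
    proof -
      have "integrable (IT T) (\<lambda>t. f t * \<psi> t)" "integrable (IT T) (\<lambda>t. f t * \<psi> (T - t))"
        by (intro IT_integrable_cont continuous_intros that \<psi> \<psi>r)+
      moreover have "(\<integral>t. f t * \<psi> (T - t) \<partial>IT T) = (\<integral>t. f t * \<psi> t \<partial>IT T)"
        using IT_reflect[of T "\<lambda>t. f t * \<psi> t"] that(2) by simp
      ultimately show ?thesis by (simp add: right_diff_distrib)
    qed
    have 1: "(\<integral>t. v t ^ 3 * (\<psi> t - \<psi> (T - t)) \<partial>IT T) = 0"
      by (rule ann'[OF d], rule sym) (auto intro!: continuous_intros P_cont simp: P_refl)
    have 2: "(\<integral>t. G t * (\<psi> t - \<psi> (T - t)) \<partial>IT T) = 0"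
      by (rule G_zero[OF d], rule sym) (auto intro!: e_cont simp: e_refl)
    show "(\<integral>t. F t * (\<psi> t - \<psi> (T - t)) \<partial>IT T) = 0"
      unfolding F_eq[OF d] 1 2 by simp
  qed
  show ?thesis
  proof (rule that[OF v v4 c2 nz])
    show "(\<lambda>N. \<integral>t. (v t - (\<Sum>j<N. c j * cos (real (2 * j + 1) * \<omega> * t)))\<^sup>2 \<partial>IT T) \<longlonglongrightarrow> 0"
      using L2 by (simp only: e_def)
    fix \<phi> :: "real \<Rightarrow> real" assume \<phi>: "continuous_on {0..T} \<phi>"
    have "a * (\<integral>t. v t ^ 3 * \<phi> t \<partial>IT T) = 2 / T * (\<integral>t. G t * \<phi> t \<partial>IT T)"
      using F0[OF \<phi>] F_eq[OF \<phi>] by simp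
    then show "(\<lambda>j. 2 / T * b j * c j * (\<integral>t. cos (real (2 * j + 1) * \<omega> * t) * \<phi> t \<partial>IT T))
        sums (a * (\<integral>t. v t ^ 3 * \<phi> t \<partial>IT T))"
      using sums_mult[OF Gsum[OF \<phi>], of "2 / T"] by (simp only: e_def mult.assoc)
  qed
qed

section \<open>Mollified hat functions\<close>

text \<open>\<open>smooth1\<close> speaks about iterates of \<open>deriv\<close>; a class of
  functions closed under differentiation avoids computing any of them.\<close>

lemma smooth1_coinduct:
  assumes f: "f \<in> S" and S: "\<And>g. g \<in> S \<Longrightarrow> \<exists>g'\<in>S. \<forall>x. (g has_real_derivative g' x) (at x)"
  shows "smooth1 f"
proof -
  have "(deriv ^^ n) f \<in> S" for n
  proof (induction n)
    case (Suc n)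
    then obtain g' where "g' \<in> S" "\<forall>x. ((deriv ^^ n) f has_real_derivative g' x) (at x)" using S by blast
    moreover from this have "deriv ((deriv ^^ n) f) = g'" by (auto intro!: DERIV_imp_deriv)
    ultimately show ?case by simp
  qed (use f in simp)
  then show ?thesis
    unfolding smooth1_def using S real_differentiable_def by blast
qed

lemma smooth1_has_deriv: "smooth1 f \<Longrightarrow> (f has_real_derivative deriv f x) (at x)"
  unfolding smooth1_def using DERIV_deriv_iff_real_differentiable by (metis funpow_0)

lemma smooth1_deriv: "smooth1 f \<Longrightarrow> smooth1 (deriv f)"
  unfolding smooth1_def by (metis funpow_Suc_right o_apply)

lemma smooth1_primitive:
  assumes "\<And>x. (F has_real_derivative f x) (at x)" and "smooth1 f"
  shows "smooth1 F"
proof (rule smooth1_coinduct)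
  show "F \<in> insert F (Collect smooth1)" by simp
  fix g assume "g \<in> insert F (Collect smooth1)"
  then show "\<exists>g'\<in>insert F (Collect smooth1). \<forall>x. (g has_real_derivative g' x) (at x)"
    using assms smooth1_has_deriv smooth1_deriv by (cases "g = F") (auto, blast)
qed

lemma smooth1_continuous: "smooth1 f \<Longrightarrow> continuous_on A f"
  using smooth1_has_deriv by (metis DERIV_continuous_on has_field_derivative_at_within)

text \<open>The Leibniz rule keeps sums of products inside this class, so that products are smooth
  without a formula for higher derivatives.\<close>

inductive_set smooth_products :: "(real \<Rightarrow> real) set" where
  prod: "smooth1 f \<Longrightarrow> smooth1 g \<Longrightarrow> (\<lambda>x. f x * g x) \<in> smooth_products"
| add: "f \<in> smooth_products \<Longrightarrow> g \<in> smooth_products \<Longrightarrow> (\<lambda>x. f x + g x) \<in> smooth_products"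

lemma smooth_products_deriv:
  "h \<in> smooth_products \<Longrightarrow> \<exists>h'\<in>smooth_products. \<forall>x. (h has_real_derivative h' x) (at x)"
proof (induction rule: smooth_products.induct)
  case (prod f g)
  have A: "(\<lambda>x. deriv f x * g x + f x * deriv g x) \<in> smooth_products"
    using prod smooth1_deriv by (intro smooth_products.intros)
  have B: "((\<lambda>x. f x * g x) has_real_derivative deriv f x * g x + f x * deriv g x) (at x)" for x
    using smooth1_has_deriv[OF prod(1)] smooth1_has_deriv[OF prod(2)]
    by (auto intro!: derivative_eq_intros)
  show ?case by (rule bexI[OF _ A]) (use B in simp)
next
  case (add f g)
  then obtain f' g' where "f' \<in> smooth_products" "g' \<in> smooth_products"
    "\<forall>x. (f has_real_derivative f' x) (at x)" "\<forall>x. (g has_real_derivative g' x) (at x)" by blast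
  then show ?case
    by (intro bexI[of _ "\<lambda>x. f' x + g' x"] smooth_products.add) (auto intro!: derivative_intros)
qed

lemma smooth1_mult: "smooth1 f \<Longrightarrow> smooth1 g \<Longrightarrow> smooth1 (\<lambda>x. f x * g x)"
  by (rule smooth1_coinduct[OF smooth_products.prod smooth_products_deriv])

lemma smooth1_affine_compose:
  assumes "smooth1 f"
  shows "smooth1 (\<lambda>x. a * f (b * x + c))"
proof (rule smooth1_coinduct)
  let ?S = "{\<lambda>x. a * f (b * x + c) |a f. smooth1 f}"
  show "(\<lambda>x. a * f (b * x + c)) \<in> ?S" using assms by blast
  fix g assume "g \<in> ?S"
  then obtain a f where g: "g = (\<lambda>x. a * f (b * x + c))" and f: "smooth1 f" by blast
  have A: "(\<lambda>x. (a * b) * deriv f (b * x + c)) \<in> ?S" using smooth1_deriv[OF f] by blast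
  have B: "(g has_real_derivative (a * b) * deriv f (b * x + c)) (at x)" for x
  proof -
    have "((\<lambda>x. f (b * x + c)) has_real_derivative deriv f (b * x + c) * b) (at x)"
      by (rule DERIV_chain'[OF _ smooth1_has_deriv[OF f]]) (auto intro!: derivative_eq_intros)
    from DERIV_cmult[OF this, of a] show ?thesis by (simp add: g mult_ac)
  qed
  show "\<exists>g'\<in>?S. \<forall>x. (g has_real_derivative g' x) (at x)" by (rule bexI[OF _ A]) (use B in simp)
qed

lemma smooth1_add:
  assumes "smooth1 f" "smooth1 g" shows "smooth1 (\<lambda>x. f x + g x)"
proof (rule smooth1_coinduct)
  let ?S = "{\<lambda>x. f x + g x |f g. smooth1 f \<and> smooth1 g}"
  show "(\<lambda>x. f x + g x) \<in> ?S" using assms by blast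
  fix h assume "h \<in> ?S"
  then obtain f g where h: "h = (\<lambda>x. f x + g x)" and fg: "smooth1 f" "smooth1 g" by blast
  have A: "(\<lambda>x. deriv f x + deriv g x) \<in> ?S" using smooth1_deriv fg by blast
  have B: "(h has_real_derivative deriv f x + deriv g x) (at x)" for x
    unfolding h using fg by (intro derivative_intros smooth1_has_deriv)
  show "\<exists>g'\<in>?S. \<forall>x. (h has_real_derivative g' x) (at x)" by (rule bexI[OF _ A]) (use B in simp)
qed

text \<open>With y = 1/x the derivative of p(y) exp(-y) in x is y^2 (p(y) - p'(y)) exp(-y). The
  family is thus closed under differentiation and serves as its own invariant class.\<close>

definition flat :: "real poly \<Rightarrow> real \<Rightarrow> real" where
  "flat p x = (if x \<le> 0 then 0 else poly p (1 / x) * exp (- 1 / x))"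

lemma poly_exp_decay: "((\<lambda>y. poly p y * exp (- y)) \<longlongrightarrow> 0) at_top" for p :: "real poly"
proof (induction p)
  case 0
  then show ?case by simp
next
  case (pCons a p)
  have 1: "((\<lambda>y::real. a * exp (- y)) \<longlongrightarrow> 0) at_top"
    using tendsto_mult[OF tendsto_const tendsto_power_div_exp_0[of 0], of a] by (simp add: exp_minus field_simps)
  have "((\<lambda>y. y * poly p y * exp (- y)) \<longlongrightarrow> 0) at_top"
  proof -
    have "((\<lambda>y. (\<Sum>i\<le>degree p. coeff p i * (y ^ Suc i / exp y))) \<longlongrightarrow> (\<Sum>i\<le>degree p. coeff p i * 0)) at_top"
      by (intro tendsto_sum tendsto_mult tendsto_const tendsto_power_div_exp_0)
    moreover have "(\<Sum>i\<le>degree p. coeff p i * (y ^ Suc i / exp y)) = y * poly p y * exp (- y)" for y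
      by (simp add: poly_altdef sum_distrib_left sum_distrib_right exp_minus field_simps)
    ultimately show ?thesis by simp
  qed
  from tendsto_add[OF 1 this] show ?case by (simp add: algebra_simps)
qed

lemma flat_deriv: "(flat p has_real_derivative flat ([:0, 0, 1:] * (p - pderiv p)) x) (at x)"
proof (cases "x = 0")
  case False
  show ?thesis
  proof (cases "x < 0")
    case True
    have "((\<lambda>x. 0) has_real_derivative 0) (at x)" by simp
    then have "(flat p has_real_derivative 0) (at x)"
      by (rule has_field_derivative_transform_within_open[of _ _ _ "{..<0}"]) (use True in \<open>auto simp: flat_def\<close>)
    then show ?thesis using True by (simp add: flat_def)
  next
    case False
    with \<open>x \<noteq> 0\<close> have x: "0 < x" by simp
    have "((\<lambda>x. poly p (1 / x) * exp (- 1 / x)) has_real_derivative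
        (poly (pderiv p) (1 / x) * (- 1 / x\<^sup>2)) * exp (- 1 / x) + poly p (1 / x) * (exp (- 1 / x) * (1 / x\<^sup>2))) (at x)"
      using x by (auto intro!: derivative_eq_intros DERIV_chain'[of "\<lambda>x. 1 / x" _ _ _ "poly p"] poly_DERIV simp: power2_eq_square)
    moreover have "(poly (pderiv p) (1 / x) * (- 1 / x\<^sup>2)) * exp (- 1 / x) + poly p (1 / x) * (exp (- 1 / x) * (1 / x\<^sup>2))
        = flat ([:0, 0, 1:] * (p - pderiv p)) x"
      using x by (simp add: flat_def field_simps power2_eq_square)
    ultimately have "((\<lambda>x. poly p (1 / x) * exp (- 1 / x)) has_real_derivative flat ([:0, 0, 1:] * (p - pderiv p)) x) (at x)"
      by simp
    then show ?thesis
      by (rule has_field_derivative_transform_within_open[of _ _ _ "{0<..}"]) (use x in \<open>auto simp: flat_def\<close>)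
  qed
next
  case True
  \<comment> \<open>At 0 the difference quotient is again a polynomial in 1/y times the exponential,
    with polynomial \<open>pCons 0 p\<close>.\<close>
  have "((\<lambda>y. flat p y / y) \<longlongrightarrow> 0) (at 0)"
  proof (rule filterlim_split_at)
    show "((\<lambda>y. flat p y / y) \<longlongrightarrow> 0) (at_left 0)"
      by (rule tendsto_eventually) (auto simp: eventually_at_left_field flat_def intro!: exI[of _ "-1"])
    have "((\<lambda>y. poly (pCons 0 p) (inverse y) * exp (- inverse y)) \<longlongrightarrow> 0) (at_right 0)"
      by (rule filterlim_compose[OF poly_exp_decay filterlim_inverse_at_top_right])
    moreover have "\<forall>\<^sub>F y in at_right 0. poly (pCons 0 p) (inverse y) * exp (- inverse y) = flat p y / y"
      by (auto simp: eventually_at_right_field flat_def field_simps intro!: exI[of _ 1])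
    ultimately show "((\<lambda>y. flat p y / y) \<longlongrightarrow> 0) (at_right 0)"
      by (rule Lim_transform_eventually)
  qed
  then have "(flat p has_real_derivative 0) (at 0)"
    by (simp add: has_field_derivative_iff flat_def)
  then show ?thesis using True by (simp add: flat_def)
qed

lemma flat_smooth: "smooth1 (flat p)"
  by (rule smooth1_coinduct[of _ "range flat"]) (use flat_deriv in auto)

lemma ex_bump: "\<exists>\<eta>. smooth1 \<eta> \<and> (\<forall>x. 0 \<le> \<eta> x) \<and> (\<forall>x. x \<notin> {0..1} \<longrightarrow> \<eta> x = 0) \<and>
    integrable lborel \<eta> \<and> (\<integral>x. \<eta> x \<partial>lborel) = 1"
proof -
  define \<beta> where "\<beta> x = flat 1 x * flat 1 (1 - x)" for x
  have f0: "0 \<le> flat 1 x" for x by (simp add: flat_def)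
  have \<beta>s: "smooth1 \<beta>"
    unfolding \<beta>_def using smooth1_mult[OF flat_smooth smooth1_affine_compose[OF flat_smooth, of 1 1 "-1" 1]] by simp
  have \<beta>0: "0 \<le> \<beta> x" for x by (simp add: \<beta>_def f0)
  have \<beta>z: "\<beta> x = 0" if "x \<notin> {0..1}" for x using that by (auto simp: \<beta>_def flat_def)
  have i: "set_integrable lborel {0..1} \<beta>"
    by (intro borel_integrable_atLeastAtMost' smooth1_continuous \<beta>s)
  have eq: "(\<lambda>x. indicator {0..1} x *\<^sub>R \<beta> x) = \<beta>" using \<beta>z by (auto simp: indicator_def fun_eq_iff)
  have i': "integrable lborel \<beta>" using i unfolding set_integrable_def eq .
  have pos: "0 < (\<integral>x. \<beta> x \<partial>lborel)"
  proof -
    have "(\<integral>x. \<beta> x \<partial>lborel) \<noteq> 0"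
    proof
      assume "(\<integral>x. \<beta> x \<partial>lborel) = 0"
      then have "AE x in lborel. \<beta> x = 0"
        using integral_nonneg_eq_0_iff_AE[OF i'] \<beta>0 by simp
      then have "AE x in lborel. x \<notin> {0<..<1::real}"
        by eventually_elim (auto simp: \<beta>_def flat_def)
      then have "{0<..<1::real} \<in> null_sets lborel"
        by (subst AE_iff_null_sets) auto
      then show False by (simp add: null_sets_def emeasure_lborel_Ioo)
    qed
    moreover have "0 \<le> (\<integral>x. \<beta> x \<partial>lborel)" using \<beta>0 by simp
    ultimately show ?thesis by simp
  qed
  define I where "I = (\<integral>x. \<beta> x \<partial>lborel)"
  show ?thesis
  proof (intro exI[of _ "\<lambda>x. 1 / I * \<beta> (1 * x + 0)"] conjI)
    show "smooth1 (\<lambda>x. 1 / I * \<beta> (1 * x + 0))" by (rule smooth1_affine_compose[OF \<beta>s])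
  qed (use pos \<beta>0 \<beta>z i' in \<open>auto simp: I_def\<close>)
qed

lemma integrable_exp_decay:
  fixes a :: real
  assumes "0 < a"
  shows "integrable lborel (\<lambda>x. indicator {0..} x * exp (- a * x))"
proof (rule integrableI_nn_integral_finite[where x = "1 / a"])
  have "(\<integral>\<^sup>+x. ennreal (exp (- a * x)) * indicator {0..} x \<partial>lborel) = ennreal (0 - (- exp (- a * 0) / a))"
  proof (rule nn_integral_FTC_atLeast)
    show "((\<lambda>x. - exp (- a * x) / a) has_real_derivative exp (- a * x)) (at x)" for x
      using assms by (auto intro!: derivative_eq_intros)
    have "((\<lambda>x. exp (- (a * x))) \<longlongrightarrow> 0) at_top"
      by (intro filterlim_compose[OF exp_at_bot] filterlim_compose[OF filterlim_uminus_at_bot_at_top]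
          filterlim_tendsto_pos_mult_at_top[OF tendsto_const] assms filterlim_ident)
    from tendsto_divide[OF tendsto_minus[OF this] tendsto_const[of a]]
    show "((\<lambda>x. - exp (- a * x) / a) \<longlongrightarrow> 0) at_top" using assms by simp
  qed auto
  then show "(\<integral>\<^sup>+x. ennreal (indicator {0..} x * exp (- a * x)) \<partial>lborel) = ennreal (1 / a)"
    by (simp add: ennreal_mult' ennreal_indicator mult.commute)
qed (use assms in auto)

lemma integrable_exp_abs_decay:
  fixes a :: real
  assumes "0 < a"
  shows "integrable lborel (\<lambda>x. exp (- a * \<bar>x\<bar>))"
proof (rule Bochner_Integration.integrable_bound)
  let ?f = "\<lambda>x::real. indicator {0..} x * exp (- a * x)"
  have "integrable lborel (\<lambda>x. ?f (0 + -1 * x))"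
    by (rule lborel_integrable_real_affine[OF integrable_exp_decay[OF assms]]) simp
  then show "integrable lborel (\<lambda>x. ?f x + ?f (0 + -1 * x))"
    using integrable_exp_decay[OF assms] by (intro Bochner_Integration.integrable_add)
  show "AE x in lborel. norm (exp (- a * \<bar>x\<bar>)) \<le> norm (?f x + ?f (0 + -1 * x))"
    by (intro AE_I2) (auto simp: indicator_def abs_if)
qed auto

text \<open>A smooth version of max 0 x, the second primitive of a bump of mass one. It is exactly
  affine outside \<open>{0..1}\<close> and within a constant of max 0 x, so rescaling by n leaves an
  error of order 1/n, while the second derivative becomes an approximate identity.\<close>

lemma smooth_ramp:
  obtains H H1 \<eta> :: "real \<Rightarrow> real" and C :: real where "smooth1 H" "smooth1 \<eta>"
    "\<And>x. (H has_real_derivative H1 x) (at x)" "\<And>x. (H1 has_real_derivative \<eta> x) (at x)"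
    "\<And>x. 0 \<le> \<eta> x" "\<And>x. x \<notin> {0..1} \<Longrightarrow> \<eta> x = 0" "integrable lborel \<eta>" "(\<integral>x. \<eta> x \<partial>lborel) = 1"
    "\<And>x. x \<le> 0 \<Longrightarrow> H x = 0" "\<And>x. x \<ge> 1 \<Longrightarrow> H x = x - 1 + H 1" "\<And>x. \<bar>H x - max 0 x\<bar> \<le> C"
proof -
  obtain \<eta> where \<eta>: "smooth1 \<eta>" "\<And>x. 0 \<le> \<eta> x" "\<And>x. x \<notin> {0..1} \<Longrightarrow> \<eta> x = 0"
    "integrable lborel \<eta>" "(\<integral>x. \<eta> x \<partial>lborel) = 1"
    using ex_bump by auto
  have anti: "\<exists>F. F 0 = 0 \<and> (\<forall>x. (F has_real_derivative f x) (at x))" if f: "continuous_on UNIV f" for f :: "real \<Rightarrow> real"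
  proof -
    obtain F where "\<And>x. (F has_vector_derivative f x) (at x)"
      using einterval_antiderivative[of "-\<infinity>" "\<infinity>" f] f continuous_on_eq_continuous_at[OF open_UNIV, of f]
      by auto
    then show ?thesis
      by (intro exI[of _ "\<lambda>x. F x - F 0"])
        (auto intro!: derivative_eq_intros simp: has_real_derivative_iff_has_vector_derivative)
  qed
  obtain H1 where H1: "H1 0 = 0" "\<And>x. (H1 has_real_derivative \<eta> x) (at x)"
    using anti[OF smooth1_continuous[OF \<eta>(1)]] by blast
  have sH1: "smooth1 H1" by (rule smooth1_primitive[OF H1(2) \<eta>(1)])
  obtain H where H: "H 0 = 0" "\<And>x. (H has_real_derivative H1 x) (at x)"
    using anti[OF smooth1_continuous[OF sH1]] by blast
  have sH: "smooth1 H" by (rule smooth1_primitive[OF H(2) sH1])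
  have H1neg: "H1 x = 0" if "x \<le> 0" for x
  proof (cases "x = 0")
    case False
    then have "x < 0" using that by simp
    then have "\<exists>z. z > x \<and> z < 0 \<and> H1 0 - H1 x = (0 - x) * \<eta> z"
      by (intro MVT2) (use H1 in auto)
    then show ?thesis using \<eta>(3) H1(1) by auto
  qed (use H1 in simp)
  have H1one: "H1 x = 1" if "x \<ge> 1" for x
  proof -
    have "(\<integral>x. indicator {0..1} x *\<^sub>R \<eta> x \<partial>lborel) = H1 1 - H1 0"
      by (rule integral_FTC_atLeastAtMost)
        (auto simp: has_real_derivative_iff_has_vector_derivative[symmetric] intro!: has_field_derivative_at_within H1 smooth1_continuous \<eta>)
    moreover have "(\<lambda>x. indicator {0..1} x *\<^sub>R \<eta> x) = \<eta>" using \<eta>(3) by (auto simp: fun_eq_iff indicator_def)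
    ultimately have 1: "H1 1 = 1" using \<eta>(5) H1(1) by simp
    show ?thesis
    proof (cases "x = 1")
      case False
      then have "1 < x" using that by simp
      then have "\<exists>z. z > 1 \<and> z < x \<and> H1 x - H1 1 = (x - 1) * \<eta> z"
        by (intro MVT2) (use H1 in auto)
      then show ?thesis using \<eta>(3) 1 by auto
    qed (use 1 in simp)
  qed
  have Hneg: "H x = 0" if "x \<le> 0" for x
  proof (cases "x = 0")
    case False
    then have "x < 0" using that by simp
    then have "\<exists>z. z > x \<and> z < 0 \<and> H 0 - H x = (0 - x) * H1 z"
      by (intro MVT2) (use H in auto)
    then show ?thesis using H1neg H(1) by auto
  qed (use H in simp)
  have Hone: "H x = x - 1 + H 1" if "x \<ge> 1" for x
  proof (cases "x = 1")
    case False
    then have "1 < x" using that by simp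
    then have "\<exists>z. z > 1 \<and> z < x \<and> H x - H 1 = (x - 1) * H1 z"
      by (intro MVT2) (use H in auto)
    then show ?thesis using H1one by auto
  qed simp
  have "compact ((\<lambda>x. H x - max 0 x) ` {0..1})"
    by (intro compact_continuous_image continuous_intros smooth1_continuous[OF sH]) auto
  from compact_imp_bounded[OF this] obtain C where C: "\<And>x. x \<in> {0..1} \<Longrightarrow> \<bar>H x - max 0 x\<bar> \<le> C"
    unfolding bounded_real by blast
  have HC: "\<bar>H x - max 0 x\<bar> \<le> C" for x
  proof -
    consider "x < 0" | "0 \<le> x \<and> x \<le> 1" | "x > 1" by linarith
    then show ?thesis
    proof cases
      case 1
      then show ?thesis using C[of 0] Hneg[of x] by auto
    next
      case 3
      then show ?thesis using C[of 1] Hone[of x] by auto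
    qed (use C in auto)
  qed
  show ?thesis
    by (rule that[of H \<eta> H1 C]) (fact sH \<eta> H(2) H1(2) Hneg Hone HC)+
qed

lemma bump_approx_identity:
  fixes \<Psi> \<eta> :: "real \<Rightarrow> real"
  assumes \<Psi>: "continuous_on UNIV \<Psi>" and \<Psi>b: "\<And>x. \<bar>\<Psi> x\<bar> \<le> M"
    and \<eta>: "continuous_on UNIV \<eta>" "\<And>x. 0 \<le> \<eta> x" "integrable lborel \<eta>" "(\<integral>x. \<eta> x \<partial>lborel) = 1"
  shows "(\<lambda>n. \<integral>x. real (Suc n) * \<eta> (real (Suc n) * (x - a)) * \<Psi> x \<partial>lborel) \<longlonglongrightarrow> \<Psi> a"
    "integrable lborel (\<lambda>x. real (Suc n) * \<eta> (real (Suc n) * (x - a)) * \<Psi> x)"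
proof -
  have m[measurable]: "\<Psi> \<in> borel_measurable borel" "\<eta> \<in> borel_measurable borel"
    using \<Psi> \<eta>(1) by (auto intro: borel_measurable_continuous_onI)
  \<comment> \<open>Rescaling about a moves the index into the argument of \<Psi>, where continuity
    and boundedness give dominated convergence.\<close>
  have eq: "(\<integral>x. real (Suc n) * \<eta> (real (Suc n) * (x - a)) * \<Psi> x \<partial>lborel) = (\<integral>y. \<eta> y * \<Psi> (a + y / real (Suc n)) \<partial>lborel)" for n
    by (subst lborel_integral_real_affine[where c = "1 / real (Suc n)" and t = a])
      (auto simp: mult.assoc simp del: of_nat_Suc)
  have "(\<lambda>n. \<integral>y. \<eta> y * \<Psi> (a + y / real (Suc n)) \<partial>lborel) \<longlonglongrightarrow> (\<integral>y. \<eta> y * \<Psi> a \<partial>lborel)"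
  proof (rule integral_dominated_convergence[where w = "\<lambda>y. \<eta> y * M"])
    show "AE y in lborel. (\<lambda>n. \<eta> y * \<Psi> (a + y / real (Suc n))) \<longlonglongrightarrow> \<eta> y * \<Psi> a"
    proof (intro AE_I2 tendsto_intros)
      fix y
      have "(\<lambda>n. a + y * inverse (real (Suc n))) \<longlonglongrightarrow> a + y * 0"
        by (intro tendsto_intros LIMSEQ_inverse_real_of_nat)
      then have "(\<lambda>n. a + y / real (Suc n)) \<longlonglongrightarrow> a" by (simp add: divide_inverse)
      then show "(\<lambda>n. \<Psi> (a + y / real (Suc n))) \<longlonglongrightarrow> \<Psi> a"
        using \<Psi> by (intro continuous_on_tendsto_compose[of UNIV \<Psi>]) auto
    qed
    show "AE y in lborel. norm (\<eta> y * \<Psi> (a + y / real (Suc n))) \<le> \<eta> y * M" for n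
      using \<Psi>b \<eta>(2) by (intro AE_I2) (auto simp: abs_mult intro!: mult_left_mono)
  qed (use \<eta> in auto)
  then show "(\<lambda>n. \<integral>x. real (Suc n) * \<eta> (real (Suc n) * (x - a)) * \<Psi> x \<partial>lborel) \<longlonglongrightarrow> \<Psi> a"
    unfolding eq using \<eta>(4) by simp
  show "integrable lborel (\<lambda>x. real (Suc n) * \<eta> (real (Suc n) * (x - a)) * \<Psi> x)"
  proof (rule Bochner_Integration.integrable_bound)
    have "integrable lborel (\<lambda>x. \<eta> (- (real (Suc n) * a) + real (Suc n) * x))"
      by (rule lborel_integrable_real_affine[OF \<eta>(3)]) simp
    then show "integrable lborel (\<lambda>x. (real (Suc n) * M) * \<eta> (real (Suc n) * (x - a)))"
      by (intro integrable_mult_right) (simp add: algebra_simps)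
    have "\<bar>\<Psi> x\<bar> \<le> \<bar>M\<bar>" for x using \<Psi>b[of x] by simp
    then show "AE x in lborel. norm (real (Suc n) * \<eta> (real (Suc n) * (x - a)) * \<Psi> x) \<le> norm ((real (Suc n) * M) * \<eta> (real (Suc n) * (x - a)))"
      using \<eta>(2) by (intro AE_I2) (simp add: abs_mult mult_mono mult.commute mult.left_commute mult_left_mono del: of_nat_Suc)
  qed measurable
qed

lemma deriv_support:
  assumes "\<And>x. x \<notin> {a..b} \<Longrightarrow> \<phi> x = 0" and "x \<notin> {a..b}"
  shows "deriv \<phi> x = (0::real)"
proof (rule DERIV_imp_deriv)
  have "((\<lambda>x. 0) has_real_derivative 0) (at x)" by simp
  then show "(\<phi> has_real_derivative 0) (at x)"
    by (rule has_field_derivative_transform_within_open[of _ _ _ "- {a..b}"]) (use assms in auto)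
qed

lemma test_fun_onI:
  assumes "smooth1 \<phi>" "0 < a" "\<And>x. x \<notin> {a..b} \<Longrightarrow> \<phi> x = 0"
  shows "test_fun_on {0<..} \<phi>"
proof -
  have "closure {x. \<phi> x \<noteq> 0} \<subseteq> {a..b}"
    by (rule closure_minimal) (use assms(3) in blast, simp)
  moreover from this have "compact (closure {x. \<phi> x \<noteq> 0})"
    by (meson bounded_closed_interval bounded_subset closed_closure compact_eq_bounded_closed)
  moreover have "{a..b} \<subseteq> {0<..}" using assms(2) by auto
  ultimately show ?thesis
    unfolding test_fun_on_def using assms(1) by blast
qed

text \<open>The test functions are mollifications of the piecewise linear hat function with nodes \<open>a < b < c\<close>,
  so no regularity of the first weak derivative is needed.\<close>
lemma weak_second_derivative_hat:
  fixes \<Phi> \<Psi> p1 p2 q :: "real \<Rightarrow> real"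
  assumes w1: "weak_deriv_on {0<..} \<Phi> p1" and w2: "weak_deriv_on {0<..} p1 p2"
    and pq: "AE x in lborel. 0 < x \<longrightarrow> p2 x = q x" and q0: "\<And>x. x \<le> 0 \<Longrightarrow> q x = 0"
    and qi: "integrable lborel q" and qx: "integrable lborel (\<lambda>x. x * q x)"
    and \<Psi>: "continuous_on UNIV \<Psi>" "\<And>x. \<bar>\<Psi> x\<bar> \<le> M" "\<And>x. 0 < x \<Longrightarrow> \<Psi> x = \<Phi> x"
    and abc: "0 < a" "a < b" "b < c"
    and E: "\<And>x. E x = \<Psi> x - (\<integral>y. q y * max 0 (y - x) \<partial>lborel)"
  shows "(c - b) * E a - (c - a) * E b + (b - a) * E c = 0"
proof -
  have q_meas[measurable]: "q \<in> borel_measurable lborel" using qi by auto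
  have iS: "integrable lborel (\<lambda>y. q y * max 0 (y - x))" for x
  proof (rule Bochner_Integration.integrable_bound)
    show "integrable lborel (\<lambda>y. \<bar>y * q y\<bar> + \<bar>x\<bar> * \<bar>q y\<bar>)" using qi qx by auto
    have "\<bar>q y * max 0 (y - x)\<bar> \<le> \<bar>y * q y\<bar> + \<bar>x\<bar> * \<bar>q y\<bar>" for y
    proof -
      have "\<bar>q y\<bar> * \<bar>max 0 (y - x)\<bar> \<le> \<bar>q y\<bar> * (\<bar>y\<bar> + \<bar>x\<bar>)" by (intro mult_left_mono) auto
      then show ?thesis by (simp add: abs_mult algebra_simps)
    qed
    then show "AE y in lborel. norm (q y * max 0 (y - x)) \<le> norm (\<bar>y * q y\<bar> + \<bar>x\<bar> * \<bar>q y\<bar>)" by simp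
  qed auto
  obtain H H1 \<eta> C where sH: "smooth1 H" and s\<eta>: "smooth1 \<eta>"
    and H: "\<And>x. (H has_real_derivative H1 x) (at x)" and H1: "\<And>x. (H1 has_real_derivative \<eta> x) (at x)"
    and \<eta>: "\<And>x. 0 \<le> \<eta> x" "\<And>x. x \<notin> {0..1} \<Longrightarrow> \<eta> x = 0" "integrable lborel \<eta>" "(\<integral>x. \<eta> x \<partial>lborel) = 1"
    and Hneg: "\<And>x. x \<le> 0 \<Longrightarrow> H x = 0" and Hone: "\<And>x. x \<ge> 1 \<Longrightarrow> H x = x - 1 + H 1"
    and C: "\<And>x. \<bar>H x - max 0 x\<bar> \<le> C"
    by (rule smooth_ramp) blast
  \<comment> \<open>\<open>h n z\<close> smooths max 0 (x - z) at scale 1/(n+1); the argument is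
    spelt as an affine function to fit \<open>smooth1_affine_compose\<close>.\<close>
  define h where "h n z x = 1 / real (Suc n) * H (real (Suc n) * x + - (real (Suc n) * z))" for n z x
  have sh: "smooth1 (\<lambda>x. d * h n z x)" for n z d
    using smooth1_affine_compose[OF sH, of "d * (1 / real (Suc n))" "real (Suc n)" "- (real (Suc n) * z)"]
    by (simp only: h_def mult.assoc)
  \<comment> \<open>The weights annihilate constants and linear functions, so the three ramps cancel
    to the right of c + 1. The claim is correspondingly that a second divided difference of
    \<open>E\<close> vanishes.\<close>
  define \<phi> where "\<phi> n x = (c - b) * h n a x + (- (c - a) * h n b x + (b - a) * h n c x)" for n x
  have s\<phi>: "smooth1 (\<phi> n)" for n unfolding \<phi>_def by (intro smooth1_add sh)
  have h1: "(h n z has_real_derivative H1 (real (Suc n) * (x - z))) (at x)" for n z x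
  proof -
    have "((\<lambda>x. H (real (Suc n) * x + - (real (Suc n) * z))) has_real_derivative H1 (real (Suc n) * x + - (real (Suc n) * z)) * real (Suc n)) (at x)"
      by (rule DERIV_chain'[OF _ H]) (auto intro!: derivative_eq_intros)
    from DERIV_cmult[OF this, of "1 / real (Suc n)"] show ?thesis
      unfolding h_def by (simp add: right_diff_distrib del: of_nat_Suc)
  qed
  have h2: "((\<lambda>x. H1 (real (Suc n) * (x - z))) has_real_derivative real (Suc n) * \<eta> (real (Suc n) * (x - z))) (at x)" for n z x
  proof -
    have "((\<lambda>x. H1 (real (Suc n) * (x - z))) has_real_derivative \<eta> (real (Suc n) * (x - z)) * real (Suc n)) (at x)"
      by (rule DERIV_chain'[OF _ H1]) (auto intro!: derivative_eq_intros)
    then show ?thesis by (simp add: mult.commute del: of_nat_Suc)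
  qed
  have \<phi>1: "deriv (\<phi> n) = (\<lambda>x. (c - b) * H1 (real (Suc n) * (x - a)) + (- (c - a) * H1 (real (Suc n) * (x - b)) + (b - a) * H1 (real (Suc n) * (x - c))))" for n
    unfolding \<phi>_def by (intro ext DERIV_imp_deriv DERIV_add DERIV_cmult h1)
  have \<phi>2: "deriv (deriv (\<phi> n)) x = (c - b) * (real (Suc n) * \<eta> (real (Suc n) * (x - a)))
       + (- (c - a) * (real (Suc n) * \<eta> (real (Suc n) * (x - b))) + (b - a) * (real (Suc n) * \<eta> (real (Suc n) * (x - c))))" for n x
    unfolding \<phi>1 by (intro DERIV_imp_deriv DERIV_add DERIV_cmult h2)
  have \<phi>supp: "\<phi> n x = 0" if x: "x \<notin> {a..c + 1}" for n x
  proof -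
    consider "x < a" | "x > c + 1" using x by (auto simp: not_le)
    then show ?thesis
    proof cases
      case 1
      have "h n z x = 0" if "x < z" for z
      proof -
        have "real (Suc n) * x \<le> real (Suc n) * z" using that by (intro mult_left_mono) auto
        then show ?thesis unfolding h_def using Hneg[of "real (Suc n) * x + - (real (Suc n) * z)"] by simp
      qed
      then show ?thesis using 1 abc by (simp add: \<phi>_def)
    next
      case 2
      \<comment> \<open>Each ramp is affine here with the same offset, which drops out because the
        weights add up to 0.\<close>
      define r where "r = (H 1 - 1) / real (Suc n)"
      have "h n z x = (x - z) + r" if "x > z + 1" for z
      proof -
        have "1 * 1 \<le> real (Suc n) * (x - z)" using that by (intro mult_mono) auto
        then have "H (real (Suc n) * x + - (real (Suc n) * z)) = real (Suc n) * (x - z) - 1 + H 1"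
          using Hone[of "real (Suc n) * x + - (real (Suc n) * z)"] by (simp add: algebra_simps)
        then show ?thesis unfolding h_def r_def by (simp add: field_simps del: of_nat_Suc)
      qed
      then have hh: "h n a x = (x - a) + r" "h n b x = (x - b) + r" "h n c x = (x - c) + r"
        using 2 abc by auto
      show ?thesis unfolding \<phi>_def hh by (simp add: algebra_simps del: of_nat_Suc)
    qed
  qed
  have \<phi>supp1: "deriv (\<phi> n) x = 0" if "x \<notin> {a..c + 1}" for n x
    using that \<phi>supp by (rule deriv_support[of a "c + 1" "\<phi> n", rotated])
  have \<phi>supp2: "deriv (deriv (\<phi> n)) x = 0" if "x \<notin> {a..c + 1}" for n x
    using that \<phi>supp1 by (rule deriv_support[of a "c + 1" "deriv (\<phi> n)", rotated])
  have t: "test_fun_on {0<..} (\<phi> n)" "test_fun_on {0<..} (deriv (\<phi> n))" for n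
  proof -
    show "test_fun_on {0<..} (\<phi> n)" by (rule test_fun_onI[OF s\<phi> abc(1) \<phi>supp])
    show "test_fun_on {0<..} (deriv (\<phi> n))"
      by (rule test_fun_onI[OF smooth1_deriv[OF s\<phi>] abc(1) \<phi>supp1])
  qed
  \<comment> \<open>Testing the first weak derivative with \<phi>' and the second with \<phi>
    eliminates \<open>p1\<close>.\<close>
  have weak: "(\<integral>x. deriv (deriv (\<phi> n)) x * \<Phi> x \<partial>lborel) = (\<integral>x. \<phi> n x * p2 x \<partial>lborel)" for n
    using w1[unfolded weak_deriv_on_def, rule_format, OF t(2)[of n]]
      w2[unfolded weak_deriv_on_def, rule_format, OF t(1)[of n]] by simp
  let ?I = "\<lambda>n z. \<integral>x. real (Suc n) * \<eta> (real (Suc n) * (x - z)) * \<Psi> x \<partial>lborel"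
  note approx = bump_approx_identity[OF \<Psi>(1,2) smooth1_continuous[OF s\<eta>] \<eta>(1,3,4)]
  have lhs: "(\<integral>x. deriv (deriv (\<phi> n)) x * \<Phi> x \<partial>lborel) = (c - b) * ?I n a + (- (c - a) * ?I n b + (b - a) * ?I n c)" for n
  proof -
    have "(\<integral>x. deriv (deriv (\<phi> n)) x * \<Phi> x \<partial>lborel) = (\<integral>x. deriv (deriv (\<phi> n)) x * \<Psi> x \<partial>lborel)"
    proof (intro Bochner_Integration.integral_cong refl)
      fix x show "deriv (deriv (\<phi> n)) x * \<Phi> x = deriv (deriv (\<phi> n)) x * \<Psi> x"
      proof (cases "0 < x")
        case True then show ?thesis using \<Psi>(3) by simp
      next
        case False
        then show ?thesis using \<phi>supp2[of x n] abc by auto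
      qed
    qed
    also have "\<dots> = (\<integral>x. (c - b) * (real (Suc n) * \<eta> (real (Suc n) * (x - a)) * \<Psi> x)
       + (- (c - a) * (real (Suc n) * \<eta> (real (Suc n) * (x - b)) * \<Psi> x) + (b - a) * (real (Suc n) * \<eta> (real (Suc n) * (x - c)) * \<Psi> x)) \<partial>lborel)"
      unfolding \<phi>2 by (intro Bochner_Integration.integral_cong refl) (simp add: algebra_simps del: of_nat_Suc)
    also have "\<dots> = (c - b) * ?I n a + (- (c - a) * ?I n b + (b - a) * ?I n c)"
      using approx(2)[of n a] approx(2)[of n b] approx(2)[of n c] by (simp del: of_nat_Suc)
    finally show ?thesis .
  qed
  have lhs_lim: "(\<lambda>n. \<integral>x. \<phi> n x * p2 x \<partial>lborel) \<longlonglongrightarrow> (c - b) * \<Psi> a + (- (c - a) * \<Psi> b + (b - a) * \<Psi> c)"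
    unfolding weak[symmetric] lhs by (intro tendsto_intros approx(1))
  have hb: "\<bar>h n z x - max 0 (x - z)\<bar> \<le> C / real (Suc n)" for n z x
  proof -
    have "max 0 (x - z) = 1 / real (Suc n) * max 0 (real (Suc n) * x + - (real (Suc n) * z))"
    proof -
      have "max 0 (real (Suc n) * x + - (real (Suc n) * z)) = real (Suc n) * max 0 (x - z)"
        by (simp add: max_mult_distrib_left right_diff_distrib del: of_nat_Suc)
      then show ?thesis by (simp del: of_nat_Suc)
    qed
    then have "\<bar>h n z x - max 0 (x - z)\<bar> = 1 / real (Suc n) * \<bar>H (real (Suc n) * x + - (real (Suc n) * z)) - max 0 (real (Suc n) * x + - (real (Suc n) * z))\<bar>"
      unfolding h_def by (simp add: diff_divide_distrib[symmetric] del: of_nat_Suc)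
    also have "\<dots> \<le> 1 / real (Suc n) * C" by (intro mult_left_mono C) auto
    finally show ?thesis by simp
  qed
  define S where "S x = (\<integral>y. q y * max 0 (y - x) \<partial>lborel)" for x
  define hat where "hat x = (c - b) * max 0 (x - a) + (- (c - a) * max 0 (x - b) + (b - a) * max 0 (x - c))" for x
  have hat_int: "integrable lborel (\<lambda>y. q y * hat y)"
    "(\<integral>y. q y * hat y \<partial>lborel) = (c - b) * S a + (- (c - a) * S b + (b - a) * S c)"
  proof -
    have eq: "q y * hat y = (c - b) * (q y * max 0 (y - a)) + (- (c - a) * (q y * max 0 (y - b)) + (b - a) * (q y * max 0 (y - c)))" for y
      by (simp add: hat_def algebra_simps)
    show "integrable lborel (\<lambda>y. q y * hat y)" unfolding eq using iS by auto
    show "(\<integral>y. q y * hat y \<partial>lborel) = (c - b) * S a + (- (c - a) * S b + (b - a) * S c)"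
      unfolding eq S_def using iS by simp
  qed
  have rhs: "(\<integral>x. \<phi> n x * p2 x \<partial>lborel) = (\<integral>x. \<phi> n x * q x \<partial>lborel)" for n
  proof (rule integral_cong_AE)
    show "AE x in lborel. \<phi> n x * p2 x = \<phi> n x * q x"
      using pq
    proof eventually_elim
      case (elim x)
      show ?case
      proof (cases "0 < x")
        case False
        then show ?thesis using \<phi>supp[of x n] abc by auto
      qed (use elim in simp)
    qed
    have "integrable lborel (\<lambda>x. \<phi> n x * p2 x)"
      using w2[unfolded weak_deriv_on_def, rule_format, OF t(1)[of n]] by simp
    then show "(\<lambda>x. \<phi> n x * p2 x) \<in> borel_measurable lborel" by auto
    have "\<phi> n \<in> borel_measurable borel" by (intro borel_measurable_continuous_onI smooth1_continuous s\<phi>)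
    then show "(\<lambda>x. \<phi> n x * q x) \<in> borel_measurable lborel" by simp
  qed
  define K where "K = (\<bar>c - b\<bar> + \<bar>c - a\<bar> + \<bar>b - a\<bar>) * C"
  have rhs_lim: "(\<lambda>n. \<integral>x. \<phi> n x * q x \<partial>lborel) \<longlonglongrightarrow> (\<integral>y. q y * hat y \<partial>lborel)"
  proof (rule LIM_zero_cancel, rule tendsto_rabs_zero_cancel, rule tendsto_sandwich[where f = "\<lambda>_. 0"])
    have d: "\<bar>\<phi> n x - hat x\<bar> \<le> K / real (Suc n)" for n x
    proof -
      have "\<phi> n x - hat x = (c - b) * (h n a x - max 0 (x - a)) - (c - a) * (h n b x - max 0 (x - b)) + (b - a) * (h n c x - max 0 (x - c))"
        by (simp add: \<phi>_def hat_def algebra_simps)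
      also have "\<bar>\<dots>\<bar> \<le> \<bar>c - b\<bar> * \<bar>h n a x - max 0 (x - a)\<bar> + \<bar>c - a\<bar> * \<bar>h n b x - max 0 (x - b)\<bar> + \<bar>b - a\<bar> * \<bar>h n c x - max 0 (x - c)\<bar>"
        unfolding abs_mult[symmetric] by linarith
      also have "\<dots> \<le> \<bar>c - b\<bar> * (C / real (Suc n)) + \<bar>c - a\<bar> * (C / real (Suc n)) + \<bar>b - a\<bar> * (C / real (Suc n))"
        by (intro add_mono mult_left_mono hb) auto
      also have "\<dots> = K / real (Suc n)" by (simp add: K_def add_divide_distrib distrib_right del: of_nat_Suc)
      finally show ?thesis .
    qed
    have [measurable]: "\<phi> n \<in> borel_measurable borel" for n
      by (intro borel_measurable_continuous_onI smooth1_continuous s\<phi>)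
    have hat_meas[measurable]: "hat \<in> borel_measurable borel" unfolding hat_def by measurable
    have pw: "\<bar>(\<phi> n x - hat x) * q x\<bar> \<le> K / real (Suc n) * \<bar>q x\<bar>" for n x
      unfolding abs_mult by (intro mult_right_mono d) auto
    have di: "integrable lborel (\<lambda>x. (\<phi> n x - hat x) * q x)" for n
    proof (rule Bochner_Integration.integrable_bound)
      show "integrable lborel (\<lambda>x. K / real (Suc n) * \<bar>q x\<bar>)" using qi by simp
      show "AE x in lborel. norm ((\<phi> n x - hat x) * q x) \<le> norm (K / real (Suc n) * \<bar>q x\<bar>)"
        unfolding real_norm_def by (intro AE_I2 order_trans[OF pw abs_ge_self])
    qed simp
    have eq: "(\<integral>x. \<phi> n x * q x \<partial>lborel) - (\<integral>y. q y * hat y \<partial>lborel) = (\<integral>x. (\<phi> n x - hat x) * q x \<partial>lborel)" for n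
    proof -
      have "(\<integral>x. \<phi> n x * q x \<partial>lborel) = (\<integral>x. (\<phi> n x - hat x) * q x + q x * hat x \<partial>lborel)"
        by (simp add: algebra_simps)
      also have "\<dots> = (\<integral>x. (\<phi> n x - hat x) * q x \<partial>lborel) + (\<integral>y. q y * hat y \<partial>lborel)"
        using di hat_int(1) by simp
      finally show ?thesis by simp
    qed
    show "\<forall>\<^sub>F n in sequentially. \<bar>(\<integral>x. \<phi> n x * q x \<partial>lborel) - (\<integral>y. q y * hat y \<partial>lborel)\<bar> \<le> K * (\<integral>x. \<bar>q x\<bar> \<partial>lborel) * inverse (real (Suc n))"
    proof (intro always_eventually allI)
      fix n
      have "\<bar>\<integral>x. (\<phi> n x - hat x) * q x \<partial>lborel\<bar> \<le> (\<integral>x. \<bar>(\<phi> n x - hat x) * q x\<bar> \<partial>lborel)"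
        by (rule integral_abs_bound)
      also have "\<dots> \<le> (\<integral>x. K / real (Suc n) * \<bar>q x\<bar> \<partial>lborel)"
        using di[of n] qi by (intro integral_mono pw) auto
      finally show "\<bar>(\<integral>x. \<phi> n x * q x \<partial>lborel) - (\<integral>y. q y * hat y \<partial>lborel)\<bar> \<le> K * (\<integral>x. \<bar>q x\<bar> \<partial>lborel) * inverse (real (Suc n))"
        unfolding eq by (simp add: divide_inverse mult_ac del: of_nat_Suc)
    qed
    show "(\<lambda>n. K * (\<integral>x. \<bar>q x\<bar> \<partial>lborel) * inverse (real (Suc n))) \<longlonglongrightarrow> 0"
      using tendsto_mult[OF tendsto_const LIMSEQ_inverse_real_of_nat] by simp
  qed auto
  have "(c - b) * \<Psi> a + (- (c - a) * \<Psi> b + (b - a) * \<Psi> c) = (c - b) * S a + (- (c - a) * S b + (b - a) * S c)"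
    using LIMSEQ_unique[OF lhs_lim rhs_lim[folded rhs]] hat_int(2) by simp
  then show ?thesis unfolding E S_def by (simp add: algebra_simps)
qed

section \<open>Decaying solutions on the half line\<close>

lemma integrable_lborel_prod_mult:
  fixes f g :: "real \<Rightarrow> real"
  assumes f: "integrable lborel f" and g: "integrable lborel g"
  shows "integrable (lborel \<Otimes>\<^sub>M lborel) (\<lambda>(x, y). f x * g y)"
proof (rule lborel_pair.Fubini_integrable)
  note [measurable] = borel_measurable_integrable[OF f] borel_measurable_integrable[OF g]
  show "(\<lambda>(x, y). f x * g y) \<in> borel_measurable (lborel \<Otimes>\<^sub>M lborel)" by measurable
  have "(\<integral>y. norm (case (x, y) of (x, y) \<Rightarrow> f x * g y) \<partial>lborel) = \<bar>f x\<bar> * (\<integral>y. \<bar>g y\<bar> \<partial>lborel)" for x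
    by (simp add: abs_mult)
  then show "integrable lborel (\<lambda>x. \<integral>y. norm (case (x, y) of (x, y) \<Rightarrow> f x * g y) \<partial>lborel)"
    using f by simp
  show "AE x in lborel. integrable lborel (\<lambda>y. case (x, y) of (x, y) \<Rightarrow> f x * g y)"
    using g by simp
qed

text \<open>Here \<open>q\<close> stands for the second derivative of a decaying solution on the
  half line, extended by 0. Its tail integrals give explicit representatives of the solution and of
  its first derivative.\<close>

locale exp_tail =
  fixes q :: "real \<Rightarrow> real" and Q \<rho> :: real
  assumes q_meas[measurable]: "q \<in> borel_measurable borel"
    and rho_pos: "0 < \<rho>" and q_zero: "\<And>x. x \<le> 0 \<Longrightarrow> q x = 0"
    and q_bnd: "\<And>x. 0 < x \<Longrightarrow> \<bar>q x\<bar> \<le> Q * exp (- \<rho> * x)"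
begin

text \<open>The primitive of \<open>q\<close> that vanishes at infinity, hence the derivative of
  \<open>S\<close>.\<close>

definition A :: "real \<Rightarrow> real" where "A x = - (\<integral>y. q y * indicator {x<..} y \<partial>lborel)"

text \<open>The iterated tail integral, written as a single one. It also makes sense for negative x,
  where it is affine, so that two-sided derivatives are available at 0.\<close>

definition S :: "real \<Rightarrow> real" where "S x = (\<integral>y. q y * max 0 (y - x) \<partial>lborel)"

lemma Q_nonneg: "0 \<le> Q"
  using q_bnd[of 1] by (smt (verit) exp_gt_zero zero_le_mult_iff)

lemma q_le: "\<bar>q x\<bar> \<le> Q"
proof (cases "0 < x")
  case True
  have "Q * exp (- \<rho> * x) \<le> Q * 1" using True rho_pos Q_nonneg by (intro mult_left_mono) auto
  then show ?thesis using q_bnd[OF True] by simp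
qed (use q_zero Q_nonneg in auto)

lemma q_le_exp: "\<bar>q x\<bar> \<le> Q * (indicator {0..} x * exp (- \<rho> * x))"
  using q_bnd[of x] q_zero[of x] by (cases "0 < x") (auto simp: indicator_def Q_nonneg)

lemma q_integrable: "integrable lborel q"
proof (rule Bochner_Integration.integrable_bound)
  show "integrable lborel (\<lambda>x. Q * (indicator {0..} x * exp (- \<rho> * x)))"
    using integrable_exp_decay[OF rho_pos] by simp
  show "AE x in lborel. norm (q x) \<le> norm (Q * (indicator {0..} x * exp (- \<rho> * x)))"
    using q_le_exp by (intro AE_I2) (metis abs_ge_self order_trans real_norm_def)
qed simp

lemma xq_integrable: "integrable lborel (\<lambda>x. x * q x)"
proof (rule Bochner_Integration.integrable_bound)
  show "integrable lborel (\<lambda>x. Q * (2 / \<rho>) * (indicator {0..} x * exp (- (\<rho> / 2) * x)))"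
    using integrable_exp_decay[of "\<rho> / 2"] rho_pos by simp
  have "\<bar>x * q x\<bar> \<le> Q * (2 / \<rho>) * (indicator {0..} x * exp (- (\<rho> / 2) * x))" for x
  proof (cases "0 < x")
    case True
    \<comment> \<open>Half of the decay rate is spent on the factor x.\<close>
    have "\<rho> / 2 * x \<le> exp (\<rho> / 2 * x)" using exp_ge_add_one_self[of "\<rho> / 2 * x"] by linarith
    then have x: "x \<le> 2 / \<rho> * exp (\<rho> / 2 * x)" using rho_pos by (simp add: field_simps)
    have "\<bar>x * q x\<bar> \<le> (2 / \<rho> * exp (\<rho> / 2 * x)) * (Q * exp (- \<rho> * x))"
      unfolding abs_mult by (intro mult_mono q_bnd True) (use x True rho_pos in auto)
    also have "\<dots> = Q * (2 / \<rho>) * (exp (\<rho> / 2 * x) * exp (- \<rho> * x))" by simp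
    also have "exp (\<rho> / 2 * x) * exp (- \<rho> * x) = exp (- (\<rho> / 2) * x)"
      unfolding exp_add[symmetric] by (simp add: algebra_simps)
    finally show ?thesis using True by simp
  next
    case False
    then show ?thesis using q_zero[of x] Q_nonneg rho_pos by simp
  qed
  then show "AE x in lborel. norm (x * q x) \<le> norm (Q * (2 / \<rho>) * (indicator {0..} x * exp (- (\<rho> / 2) * x)))"
    by (intro AE_I2) (metis abs_ge_self order_trans real_norm_def)
qed simp

lemma A_integrable: "integrable lborel (\<lambda>y. q y * indicator {x<..} y)"
  using q_integrable by (intro integrable_real_mult_indicator) auto

lemma S_integrable: "integrable lborel (\<lambda>y. q y * max 0 (y - x))"
proof (rule Bochner_Integration.integrable_bound)
  show "integrable lborel (\<lambda>y. \<bar>y * q y\<bar> + \<bar>x\<bar> * \<bar>q y\<bar>)" using xq_integrable q_integrable by auto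
  have "\<bar>q y * max 0 (y - x)\<bar> \<le> \<bar>y * q y\<bar> + \<bar>x\<bar> * \<bar>q y\<bar>" for y
  proof -
    have "\<bar>q y * max 0 (y - x)\<bar> \<le> \<bar>q y\<bar> * (\<bar>y\<bar> + \<bar>x\<bar>)"
      unfolding abs_mult by (intro mult_left_mono) auto
    then show ?thesis by (simp add: abs_mult algebra_simps)
  qed
  then show "AE y in lborel. norm (q y * max 0 (y - x)) \<le> norm (\<bar>y * q y\<bar> + \<bar>x\<bar> * \<bar>q y\<bar>)"
    by (intro AE_I2) (metis abs_ge_self order_trans real_norm_def)
qed simp

text \<open>The kernel of the Taylor remainder is supported between x and z and bounded by |x - z|,
  so only the size of \<open>q\<close> there enters. The global bound on \<open>q\<close> then gives
  differentiability, the local one the interpolation inequality for \<open>A\<close>.\<close>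

lemma S_increment:
  assumes C: "\<And>y. min x z \<le> y \<Longrightarrow> y \<le> max x z \<Longrightarrow> \<bar>q y\<bar> \<le> C"
  shows "\<bar>S x - S z - (x - z) * A z\<bar> \<le> C * (x - z)\<^sup>2"
proof -
  let ?f = "\<lambda>y. q y * max 0 (y - x) - q y * max 0 (y - z) + (x - z) * (q y * indicator {z<..} y)"
  have i: "integrable lborel ?f" using S_integrable A_integrable by auto
  have eq: "S x - S z - (x - z) * A z = (\<integral>y. ?f y \<partial>lborel)"
    unfolding S_def A_def using S_integrable A_integrable by simp
  let ?I = "\<lambda>y. C * \<bar>x - z\<bar> * indicator {min x z..max x z} y"
  have iI: "integrable lborel ?I"
    by (intro integrable_mult_right) (simp add: emeasure_lborel_Icc_eq)
  have b: "\<bar>?f y\<bar> \<le> ?I y" for y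
  proof -
    have "\<bar>max 0 (y - x) - max 0 (y - z) + (x - z) * indicator {z<..} y\<bar> \<le> \<bar>x - z\<bar> * indicator {min x z..max x z} y"
      by (auto simp: indicator_def max_def min_def)
    moreover have "?f y = q y * (max 0 (y - x) - max 0 (y - z) + (x - z) * indicator {z<..} y)"
      by (simp add: algebra_simps)
    ultimately have "\<bar>?f y\<bar> \<le> \<bar>q y\<bar> * (\<bar>x - z\<bar> * indicator {min x z..max x z} y)"
      unfolding abs_mult by (metis abs_ge_zero abs_mult mult_left_mono)
    also have "\<dots> \<le> C * (\<bar>x - z\<bar> * indicator {min x z..max x z} y)"
      using C[of y] by (cases "y \<in> {min x z..max x z}") (auto intro!: mult_right_mono)
    finally show ?thesis by (simp add: mult.assoc)
  qed
  have "\<bar>\<integral>y. ?f y \<partial>lborel\<bar> \<le> (\<integral>y. \<bar>?f y\<bar> \<partial>lborel)" by (rule integral_abs_bound)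
  also have "\<dots> \<le> (\<integral>y. ?I y \<partial>lborel)"
    using i iI by (intro integral_mono b) auto
  also have "\<dots> = C * (x - z)\<^sup>2"
    by (cases "x \<le> z") (auto simp: power2_eq_square algebra_simps)
  finally show ?thesis unfolding eq .
qed

lemma S_deriv: "(S has_real_derivative A z) (at z)"
  unfolding has_field_derivative_def
proof (rule has_derivativeI_sandwich[where e = 1 and H = "\<lambda>x. Q * \<bar>x - z\<bar>"])
  show "bounded_linear ((*) (A z))" by (rule bounded_linear_mult_right)
  show "(\<lambda>x. Q * \<bar>x - z\<bar>) \<midarrow>z\<rightarrow> 0" by (auto intro!: tendsto_eq_intros)
  fix x assume "x \<noteq> z"
  have "\<bar>S x - S z - A z * (x - z)\<bar> \<le> Q * (\<bar>x - z\<bar> * \<bar>x - z\<bar>)"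
    using S_increment[of x z Q] q_le by (simp add: mult.commute power2_eq_square)
  then show "norm (S x - S z - A z * (x - z)) / norm (x - z) \<le> Q * \<bar>x - z\<bar>"
    using \<open>x \<noteq> z\<close> by (simp add: divide_le_eq mult.assoc)
qed auto

lemma S_continuous: "continuous_on X S"
  by (meson S_deriv DERIV_continuous_on has_field_derivative_at_within)

lemma A_Lipschitz: "\<bar>A x - A z\<bar> \<le> Q * \<bar>x - z\<bar>"
proof -
  have "(\<integral>y. (q y * indicator {z<..} y - q y * indicator {x<..} y) \<partial>lborel) = A x - A z"
    unfolding A_def using A_integrable by simp
  moreover have "\<bar>\<integral>y. (q y * indicator {z<..} y - q y * indicator {x<..} y) \<partial>lborel\<bar>
     \<le> (\<integral>y. \<bar>q y * indicator {z<..} y - q y * indicator {x<..} y\<bar> \<partial>lborel)" by (rule integral_abs_bound)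
  moreover have "\<dots> \<le> (\<integral>y. Q * indicator {min x z..max x z} y \<partial>lborel)"
  proof (intro integral_mono)
    show "integrable lborel (\<lambda>y. \<bar>q y * indicator {z<..} y - q y * indicator {x<..} y\<bar>)"
      using A_integrable by (intro integrable_abs Bochner_Integration.integrable_diff)
    show "integrable lborel (\<lambda>y. Q * indicator {min x z..max x z} y)"
      by (intro integrable_mult_right) (simp add: emeasure_lborel_Icc_eq)
    show "\<bar>q y * indicator {z<..} y - q y * indicator {x<..} y\<bar> \<le> Q * indicator {min x z..max x z} y" for y
      using q_le[of y] Q_nonneg by (auto simp: indicator_def max_def min_def)
  qed
  moreover have "(\<integral>y. Q * indicator {min x z..max x z} y \<partial>lborel) = Q * \<bar>x - z\<bar>"
    by (auto simp: min_def max_def abs_if)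
  ultimately show ?thesis by linarith
qed

lemma A_isCont: "isCont A z"
proof -
  have "((\<lambda>x. A x - A z) \<longlongrightarrow> 0) (at z)"
  proof (rule Lim_null_comparison)
    show "\<forall>\<^sub>F x in at z. norm (A x - A z) \<le> Q * \<bar>x - z\<bar>" using A_Lipschitz by auto
    show "(\<lambda>x. Q * \<bar>x - z\<bar>) \<midarrow>z\<rightarrow> 0" by (auto intro!: tendsto_eq_intros)
  qed
  then show ?thesis unfolding isCont_def using LIM_zero_cancel by blast
qed

lemma S_tendsto_0: "(\<lambda>n. S (real n)) \<longlonglongrightarrow> 0"
proof -
  have "(\<lambda>n. S (real n)) \<longlonglongrightarrow> (\<integral>(y::real). 0 \<partial>lborel)"
    unfolding S_def
  proof (rule integral_dominated_convergence[where s = "\<lambda>n y. q y * max 0 (y - real n)" and f = "\<lambda>_. 0" and w = "\<lambda>y. \<bar>y * q y\<bar>"])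
    show "integrable lborel (\<lambda>y. \<bar>y * q y\<bar>)" using xq_integrable by auto
    show "AE y in lborel. (\<lambda>n. q y * max 0 (y - real n)) \<longlonglongrightarrow> 0"
    proof (intro AE_I2 tendsto_eventually)
      fix y
      obtain N where "y \<le> real N" using real_arch_simple by blast
      then show "\<forall>\<^sub>F n in sequentially. q y * max 0 (y - real n) = 0"
        by (intro eventually_sequentiallyI[of N]) auto
    qed
    show "AE y in lborel. norm (q y * max 0 (y - real n)) \<le> \<bar>y * q y\<bar>" for n
    proof (intro AE_I2)
      fix y
      show "norm (q y * max 0 (y - real n)) \<le> \<bar>y * q y\<bar>"
      proof (cases "0 < y")
        case True
        then have "\<bar>q y\<bar> * \<bar>max 0 (y - real n)\<bar> \<le> \<bar>q y\<bar> * \<bar>y\<bar>" by (intro mult_left_mono) auto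
        then show ?thesis by (simp add: abs_mult mult.commute)
      qed (simp add: q_zero)
    qed
  qed auto
  then show ?thesis by simp
qed

text \<open>The difference of \<Phi> and \<open>S\<close> has vanishing second divided differences
  on the open half line, so it is affine there; both functions tend to 0 along the integers, so it
  is 0. In this way the weak solution acquires a classical first derivative.\<close>

lemma weak_solution_eq_S:
  fixes \<Phi> p1 p2 :: "real \<Rightarrow> real"
  assumes w: "weak_deriv_on {0<..} \<Phi> p1" "weak_deriv_on {0<..} p1 p2"
    and pq: "AE x in lborel. 0 < x \<longrightarrow> p2 x = q x"
    and \<Phi>c: "continuous_on {0..} \<Phi>" and \<Phi>b: "\<And>x. 0 \<le> x \<Longrightarrow> \<bar>\<Phi> x\<bar> \<le> M * exp (- \<rho> * x)"
    and x: "0 \<le> x"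
  shows "\<Phi> x = S x"
proof -
  \<comment> \<open>Constant extension to the left, which supplies the global continuity and
    boundedness that the hat function argument asks for.\<close>
  define \<Psi> where "\<Psi> x = \<Phi> (max 0 x)" for x
  have \<Psi>c: "continuous_on UNIV \<Psi>" unfolding \<Psi>_def
    by (rule continuous_on_compose2[OF \<Phi>c]) (auto intro!: continuous_intros)
  have M: "0 \<le> M" using \<Phi>b[of 0] by auto
  have \<Psi>b: "\<bar>\<Psi> x\<bar> \<le> M" for x
  proof -
    have "M * exp (- \<rho> * max 0 x) \<le> M * 1" using rho_pos M by (intro mult_left_mono) auto
    then show ?thesis using \<Phi>b[of "max 0 x"] by (auto simp: \<Psi>_def)
  qed
  define E where "E x = \<Psi> x - S x" for x
  have E3: "(c - b) * E a - (c - a) * E b + (b - a) * E c = 0" if "0 < a" "a < b" "b < c" for a b c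
    by (rule weak_second_derivative_hat[OF w pq q_zero q_integrable xq_integrable \<Psi>c \<Psi>b _ that])
      (auto simp: E_def S_def \<Psi>_def)
  have \<Psi>0: "(\<lambda>n. \<Psi> (real n)) \<longlonglongrightarrow> 0"
  proof (rule Lim_null_comparison)
    show "\<forall>\<^sub>F n in sequentially. norm (\<Psi> (real n)) \<le> M * exp (- \<rho>) ^ n"
      using \<Phi>b[of "real n" for n] by (intro always_eventually) (simp add: \<Psi>_def exp_of_nat_mult[symmetric] mult.commute)
    show "(\<lambda>n. M * exp (- \<rho>) ^ n) \<longlonglongrightarrow> 0"
      using rho_pos by (intro tendsto_mult_right_zero LIMSEQ_power_zero) auto
  qed
  have E0: "(\<lambda>n. E (real n)) \<longlonglongrightarrow> 0"
    unfolding E_def using tendsto_diff[OF \<Psi>0 S_tendsto_0] by simp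
  have Eeq: "E a = E b" if ab: "0 < a" "a < b" for a b
  proof -
    \<comment> \<open>The three-point identity with last node n, divided by n: in the limit its last
      term disappears and E a = E b remains.\<close>
    have lim: "(\<lambda>n. (1 - b * inverse (real n)) * E a - (1 - a * inverse (real n)) * E b + (b - a) * (inverse (real n) * E (real n)))
        \<longlonglongrightarrow> (1 - b * 0) * E a - (1 - a * 0) * E b + (b - a) * (0 * 0)"
      by (intro tendsto_intros lim_inverse_n E0)
    have ev: "\<forall>\<^sub>F n in sequentially. (1 - b * inverse (real n)) * E a - (1 - a * inverse (real n)) * E b + (b - a) * (inverse (real n) * E (real n)) = 0"
    proof -
      obtain N where N: "b < real N" using reals_Archimedean2 by blast
      show ?thesis
      proof (rule eventually_sequentiallyI[of N])
        fix n assume "N \<le> n"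
        then have n: "b < real n" "real n \<noteq> 0" using N ab by auto
        then have *: "((real n - b) * E a - (real n - a) * E b + (b - a) * E (real n)) * inverse (real n) = 0"
          using E3[OF ab] by simp
        show "(1 - b * inverse (real n)) * E a - (1 - a * inverse (real n)) * E b + (b - a) * (inverse (real n) * E (real n)) = 0"
        proof -
          have "((real n - b) * E a - (real n - a) * E b + (b - a) * E (real n)) * i
              = (real n * i - b * i) * E a - (real n * i - a * i) * E b + (b - a) * (i * E (real n))" for i
            by (simp add: algebra_simps)
          from this[of "inverse (real n)"] * show ?thesis unfolding right_inverse[OF n(2)] by simp
        qed
      qed
    qed
    show ?thesis using LIMSEQ_unique[OF lim tendsto_eventually[OF ev]] by simp
  qed
  have Epos: "E y = 0" if "0 < y" for y
  proof -
    obtain N where N: "y < real N" using reals_Archimedean2 by blast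
    have "(\<lambda>n. E (real n)) \<longlonglongrightarrow> E y"
      by (intro tendsto_eventually eventually_sequentiallyI[of N]) (use N in \<open>auto intro!: Eeq[OF that, symmetric] elim: less_le_trans\<close>)
    then show ?thesis using E0 LIMSEQ_unique by blast
  qed
  have "E x = 0"
  proof (cases "x = 0")
    case True
    have "continuous_on UNIV E" unfolding E_def by (intro continuous_intros \<Psi>c S_continuous)
    then have "isCont E 0" by (simp add: continuous_on_eq_continuous_at)
    then have "(\<lambda>n. E (inverse (real (Suc n)))) \<longlonglongrightarrow> E 0"
      by (rule isCont_tendsto_compose) (rule LIMSEQ_inverse_real_of_nat)
    then show ?thesis using Epos True by (simp add: LIMSEQ_const_iff)
  qed (use Epos x in auto)
  then show ?thesis using x by (simp add: E_def \<Psi>_def)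
qed

text \<open>Landau's interpolation inequality between \<open>S\<close> and \<open>q = S''\<close>.\<close>
lemma A_bound:
  assumes Sb: "\<And>x. 0 \<le> x \<Longrightarrow> \<bar>S x\<bar> \<le> M * exp (- \<rho> * x)" and h: "0 < h" and x: "0 \<le> x"
  shows "\<bar>A x\<bar> \<le> (2 * M / h + Q * h) * exp (- \<rho> * x)"
proof -
  have M: "0 \<le> M" using Sb[of 0] by auto
  have mono: "exp (- \<rho> * y) \<le> exp (- \<rho> * x)" if "x \<le> y" for y using that rho_pos by simp
  have "\<bar>S (x + h) - S x - (x + h - x) * A x\<bar> \<le> Q * exp (- \<rho> * x) * (x + h - x)\<^sup>2"
  proof (rule S_increment)
    fix y assume y: "min (x + h) x \<le> y" "y \<le> max (x + h) x"
    then have "x \<le> y" using h by auto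
    show "\<bar>q y\<bar> \<le> Q * exp (- \<rho> * x)"
    proof (cases "0 < y")
      case True
      from q_bnd[OF this] show ?thesis using mult_left_mono[OF mono[OF \<open>x \<le> y\<close>] Q_nonneg] by linarith
    qed (use q_zero Q_nonneg in simp)
  qed
  moreover have "\<bar>S (x + h)\<bar> \<le> M * exp (- \<rho> * x)"
    using Sb[of "x + h"] mult_left_mono[OF mono[of "x + h"] M] h x by linarith
  moreover have "\<bar>S x\<bar> \<le> M * exp (- \<rho> * x)" by (rule Sb[OF x])
  ultimately have "\<bar>h * A x\<bar> \<le> 2 * M * exp (- \<rho> * x) + Q * exp (- \<rho> * x) * h\<^sup>2" by simp
  also have "\<dots> = h * ((2 * M / h + Q * h) * exp (- \<rho> * x))"
    using h by (simp add: field_simps power2_eq_square)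
  finally show ?thesis using h by (simp add: abs_mult)
qed

text \<open>The function \<open>A\<close> need not be differentiable where \<open>q\<close> jumps,
  so integration by parts is replaced by Fubini on the triangle 0 \<le> x < y: integrating \<eta>'
  in x first leaves \<eta> y - \<eta> 0 against \<open>q\<close>.\<close>

lemma A_ibp:
  fixes \<eta> \<eta>' :: "real \<Rightarrow> real"
  assumes d: "\<And>x. (\<eta> has_real_derivative \<eta>' x) (at x)" and c: "continuous_on UNIV \<eta>'"
    and i: "integrable lborel \<eta>'" and b: "\<And>x. \<bar>\<eta> x\<bar> \<le> C"
  shows "integrable lborel (\<lambda>x. indicator {0..} x * (A x * \<eta>' x))"
    "(\<integral>x. indicator {0..} x * (A x * \<eta>' x) \<partial>lborel) = - A 0 * \<eta> 0 - (\<integral>x. q x * \<eta> x \<partial>lborel)"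
proof -
  have [measurable]: "\<eta>' \<in> borel_measurable borel" by (rule borel_measurable_continuous_onI[OF c])
  have \<eta>c: "continuous_on UNIV \<eta>" by (meson d DERIV_continuous_on has_field_derivative_at_within)
  have [measurable]: "\<eta> \<in> borel_measurable borel" by (rule borel_measurable_continuous_onI[OF \<eta>c])
  define F where "F x y = indicator {0..} x * \<eta>' x * (q y * indicator {x<..} y)" for x y
  have F_eq: "F x y = (if 0 \<le> x \<and> x < y then \<eta>' x * q y else 0)" for x y by (auto simp: F_def)
  have Fm: "(\<lambda>(x, y). F x y) \<in> borel_measurable (lborel \<Otimes>\<^sub>M lborel)" unfolding F_eq by measurable
  have Fi: "integrable (lborel \<Otimes>\<^sub>M lborel) (\<lambda>(x, y). F x y)"
  proof (rule Bochner_Integration.integrable_bound[OF integrable_lborel_prod_mult[OF i q_integrable] Fm])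
    show "AE z in lborel \<Otimes>\<^sub>M lborel. norm (case z of (x, y) \<Rightarrow> F x y) \<le> norm (case z of (x, y) \<Rightarrow> \<eta>' x * q y)"
      by (intro AE_I2) (auto simp: F_eq)
  qed
  have y_int: "(\<integral>y. F x y \<partial>lborel) = - (indicator {0..} x * (A x * \<eta>' x))" for x
    unfolding F_def A_def by simp
  have x_int: "(\<integral>x. F x y \<partial>lborel) = q y * \<eta> y - \<eta> 0 * q y" for y
  proof (cases "0 < y")
    case True
    have "(\<integral>x. F x y \<partial>lborel) = (\<integral>x. q y * (\<eta>' x * indicator {0..y} x) \<partial>lborel)"
    proof (rule integral_cong_AE)
      have "AE x in lborel. x \<noteq> y" by (rule AE_lborel_singleton)
      then show "AE x in lborel. F x y = q y * (\<eta>' x * indicator {0..y} x)"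
        by eventually_elim (auto simp: F_eq indicator_def)
    qed (auto simp: F_eq)
    also have "\<dots> = q y * (\<integral>x. \<eta>' x * indicator {0..y} x \<partial>lborel)" by simp
    also have "(\<integral>x. \<eta>' x * indicator {0..y} x \<partial>lborel) = \<eta> y - \<eta> 0"
      using True d c by (intro integral_FTC_Icc_real) (auto simp: continuous_on_eq_continuous_at)
    finally show ?thesis by (simp add: algebra_simps)
  next
    case False
    then have "F x y = 0" for x by (auto simp: F_eq)
    then show ?thesis using False q_zero by simp
  qed
  have "integrable lborel (\<lambda>x. \<integral>y. F x y \<partial>lborel)"
    using lborel_pair.integrable_fst'[OF Fi] by simp
  then show "integrable lborel (\<lambda>x. indicator {0..} x * (A x * \<eta>' x))" unfolding y_int by simp
  have q\<eta>: "integrable lborel (\<lambda>x. q x * \<eta> x)"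
  proof (rule Bochner_Integration.integrable_bound)
    show "integrable lborel (\<lambda>x. C * \<bar>q x\<bar>)" using q_integrable by simp
    have "\<bar>q x * \<eta> x\<bar> \<le> C * \<bar>q x\<bar>" for x
      unfolding abs_mult mult.commute[of "\<bar>q x\<bar>"] by (intro mult_right_mono b) auto
    then show "AE x in lborel. norm (q x * \<eta> x) \<le> norm (C * \<bar>q x\<bar>)"
      by (intro AE_I2) (metis abs_ge_self order_trans real_norm_def)
  qed simp
  have A0: "(\<integral>y. q y \<partial>lborel) = - A 0"
  proof -
    have "q y * indicator {0<..} y = q y" for y using q_zero[of y] by (auto simp: indicator_def)
    then show ?thesis unfolding A_def by (simp only: minus_minus)
  qed
  have "- (\<integral>x. indicator {0..} x * (A x * \<eta>' x) \<partial>lborel) = (\<integral>x. (\<integral>y. F x y \<partial>lborel) \<partial>lborel)"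
    unfolding y_int by simp
  also have "\<dots> = (\<integral>y. (\<integral>x. F x y \<partial>lborel) \<partial>lborel)"
    by (rule lborel_pair.Fubini_integral[OF Fi, symmetric])
  also have "\<dots> = (\<integral>x. q x * \<eta> x \<partial>lborel) - \<eta> 0 * (\<integral>y. q y \<partial>lborel)"
    unfolding x_int using q\<eta> q_integrable by simp
  finally show "(\<integral>x. indicator {0..} x * (A x * \<eta>' x) \<partial>lborel) = - A 0 * \<eta> 0 - (\<integral>x. q x * \<eta> x \<partial>lborel)"
    unfolding A0 by (simp add: algebra_simps)
qed

text \<open>Since \<open>S\<close> is continuously differentiable, the product rule suffices. The
  test function has to vanish only far to the right; the boundary term at 0 is kept, because the two
  half lines are joined there later.\<close>

lemma S_ibp:
  fixes \<eta> \<eta>' :: "real \<Rightarrow> real"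
  assumes d: "\<And>x. (\<eta> has_real_derivative \<eta>' x) (at x)" and c: "continuous_on UNIV \<eta>'"
    and supp: "\<And>x. R < x \<Longrightarrow> \<eta> x = 0" "\<And>x. R < x \<Longrightarrow> \<eta>' x = 0"
  shows "integrable lborel (\<lambda>x. indicator {0..} x * (S x * \<eta>' x))"
    "integrable lborel (\<lambda>x. indicator {0..} x * (A x * \<eta> x))"
    "(\<integral>x. indicator {0..} x * (S x * \<eta>' x) \<partial>lborel)
      = - S 0 * \<eta> 0 - (\<integral>x. indicator {0..} x * (A x * \<eta> x) \<partial>lborel)"
proof -
  have \<eta>c: "continuous_on UNIV \<eta>" by (meson d DERIV_continuous_on has_field_derivative_at_within)
  have Ac: "continuous_on X A" for X using A_isCont continuous_at_imp_continuous_on by blast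
  \<comment> \<open>Beyond R, so that \<eta> vanishes there, and positive even if R is not.\<close>
  define R' where "R' = max 1 (R + 1)"
  have e: "indicator {0..} x * (f x * h x) = indicator {0..R'} x *\<^sub>R (f x * h x)" if "\<And>x. R < x \<Longrightarrow> h x = 0" for f h :: "real \<Rightarrow> real" and x
    using that[of x] by (cases "R < x") (auto simp: indicator_def R'_def)
  note e1 = e[of \<eta>' _ S, OF supp(2)] and e2 = e[of \<eta> _ A, OF supp(1)]
  have c1: "continuous_on {0..R'} (\<lambda>x. S x * \<eta>' x)" "continuous_on {0..R'} (\<lambda>x. A x * \<eta> x)"
    by (intro continuous_intros S_continuous Ac continuous_on_subset[OF c] continuous_on_subset[OF \<eta>c]; simp)+
  have i1: "integrable lborel (\<lambda>x. indicator {0..R'} x *\<^sub>R (S x * \<eta>' x))"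
     "integrable lborel (\<lambda>x. indicator {0..R'} x *\<^sub>R (A x * \<eta> x))"
    using c1[THEN borel_integrable_atLeastAtMost'] unfolding set_integrable_def by auto
  show "integrable lborel (\<lambda>x. indicator {0..} x * (S x * \<eta>' x))"
    "integrable lborel (\<lambda>x. indicator {0..} x * (A x * \<eta> x))"
    using i1 by (simp_all only: e1 e2)
  have "(\<integral>x. (S x * \<eta>' x + A x * \<eta> x) * indicator {0..R'} x \<partial>lborel) = S R' * \<eta> R' - S 0 * \<eta> 0"
  proof (rule integral_FTC_Icc_real)
    show "0 \<le> R'" by (simp add: R'_def)
    show "((\<lambda>x. S x * \<eta> x) has_real_derivative S x * \<eta>' x + A x * \<eta> x) (at x)" for x
      using DERIV_mult[OF S_deriv d] by (simp add: algebra_simps)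
    show "isCont (\<lambda>x. S x * \<eta>' x + A x * \<eta> x) x" for x
      using c \<eta>c A_isCont S_deriv[THEN DERIV_isCont]
      by (intro continuous_intros) (auto simp: continuous_on_eq_continuous_at)
  qed
  moreover have "\<eta> R' = 0" by (rule supp) (simp add: R'_def)
  moreover have "(\<integral>x. (S x * \<eta>' x + A x * \<eta> x) * indicator {0..R'} x \<partial>lborel)
      = (\<integral>x. indicator {0..R'} x *\<^sub>R (S x * \<eta>' x) \<partial>lborel) + (\<integral>x. indicator {0..R'} x *\<^sub>R (A x * \<eta> x) \<partial>lborel)"
    unfolding Bochner_Integration.integral_add[OF i1, symmetric] by (simp add: algebra_simps)
  moreover have "(\<integral>x. indicator {0..} x * (S x * \<eta>' x) \<partial>lborel) = (\<integral>x. indicator {0..R'} x *\<^sub>R (S x * \<eta>' x) \<partial>lborel)"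
    "(\<integral>x. indicator {0..} x * (A x * \<eta> x) \<partial>lborel) = (\<integral>x. indicator {0..R'} x *\<^sub>R (A x * \<eta> x) \<partial>lborel)"
    by (simp_all only: e1 e2)
  ultimately show "(\<integral>x. indicator {0..} x * (S x * \<eta>' x) \<partial>lborel)
      = - S 0 * \<eta> 0 - (\<integral>x. indicator {0..} x * (A x * \<eta> x) \<partial>lborel)"
    by simp
qed

end

section \<open>Series in \<open>L\<^sup>2\<close> of the space-time strip\<close>

lemma abs_mult_le_weighted_squares:
  fixes x y \<delta> :: real
  assumes "0 < \<delta>"
  shows "\<bar>x * y\<bar> \<le> \<delta> * x\<^sup>2 + y\<^sup>2 / \<delta>"
proof -
  have "0 \<le> (\<delta> * \<bar>x\<bar> - \<bar>y\<bar>)\<^sup>2" by simp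
  then have "2 * (\<delta> * \<bar>x * y\<bar>) \<le> \<delta>\<^sup>2 * x\<^sup>2 + y\<^sup>2"
    by (simp add: power2_eq_square algebra_simps abs_mult)
  moreover have "0 \<le> \<delta> * \<bar>x * y\<bar>" using assms by simp
  ultimately have "\<delta> * \<bar>x * y\<bar> \<le> \<delta>\<^sup>2 * x\<^sup>2 + y\<^sup>2" by linarith
  also have "\<dots> = \<delta> * (\<delta> * x\<^sup>2 + y\<^sup>2 / \<delta>)" using assms by (simp add: field_simps power2_eq_square)
  finally show ?thesis using assms by simp
qed

lemma integrable_mult_squares:
  fixes f g :: "'a \<Rightarrow> real"
  assumes [measurable]: "f \<in> borel_measurable M" "g \<in> borel_measurable M"
    and f: "integrable M (\<lambda>x. (f x)\<^sup>2)" and g: "integrable M (\<lambda>x. (g x)\<^sup>2)"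
  shows "integrable M (\<lambda>x. f x * g x)"
proof (rule Bochner_Integration.integrable_bound)
  show "integrable M (\<lambda>x. (f x)\<^sup>2 + (g x)\<^sup>2)" using f g by auto
  show "AE x in M. norm (f x * g x) \<le> norm ((f x)\<^sup>2 + (g x)\<^sup>2)"
    using abs_mult_le_weighted_squares[of 1] by (intro AE_I2) simp
qed auto

lemma integrable_diff_square:
  fixes f g :: "'a \<Rightarrow> real"
  assumes [measurable]: "f \<in> borel_measurable M" "g \<in> borel_measurable M"
    and f: "integrable M (\<lambda>x. (f x)\<^sup>2)" and g: "integrable M (\<lambda>x. (g x)\<^sup>2)"
  shows "integrable M (\<lambda>x. (f x - g x)\<^sup>2)"
proof -
  have "(f x - g x)\<^sup>2 = (f x)\<^sup>2 - 2 * (f x * g x) + (g x)\<^sup>2" for x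
    by (simp add: power2_eq_square algebra_simps)
  then show ?thesis using f g integrable_mult_squares[OF assms] by simp
qed

text \<open>Young's inequality in place of Cauchy-Schwarz: the weight \<delta> is taken so large
  that the fixed function contributes at most r/2.\<close>

lemma integral_mult_tendsto_zero:
  fixes f :: "nat \<Rightarrow> 'a \<Rightarrow> real" and g :: "'a \<Rightarrow> real"
  assumes [measurable]: "\<And>n. f n \<in> borel_measurable M" "g \<in> borel_measurable M"
    and f: "\<And>n. integrable M (\<lambda>x. (f n x)\<^sup>2)" and g: "integrable M (\<lambda>x. (g x)\<^sup>2)"
    and lim: "(\<lambda>n. \<integral>x. (f n x)\<^sup>2 \<partial>M) \<longlonglongrightarrow> 0"
  shows "(\<lambda>n. \<integral>x. f n x * g x \<partial>M) \<longlonglongrightarrow> 0"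
proof (rule LIMSEQ_I)
  fix r :: real assume r: "0 < r"
  define G where "G = (\<integral>x. (g x)\<^sup>2 \<partial>M)"
  have G: "0 \<le> G" by (simp add: G_def)
  define \<delta> where "\<delta> = 2 * (G + 1) / r"
  have \<delta>: "0 < \<delta>" using r G by (simp add: \<delta>_def)
  have "0 < r / (2 * \<delta>)" using r \<delta> by simp
  from LIMSEQ_D[OF lim this] obtain N where N: "\<And>n. n \<ge> N \<Longrightarrow> (\<integral>x. (f n x)\<^sup>2 \<partial>M) < r / (2 * \<delta>)"
    by auto
  have "norm ((\<integral>x. f n x * g x \<partial>M) - 0) < r" if "n \<ge> N" for n
  proof -
    have "\<bar>\<integral>x. f n x * g x \<partial>M\<bar> \<le> (\<integral>x. \<bar>f n x * g x\<bar> \<partial>M)" by (rule integral_abs_bound)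
    also have "\<dots> \<le> (\<integral>x. \<delta> * (f n x)\<^sup>2 + (g x)\<^sup>2 / \<delta> \<partial>M)"
      using f[of n] g \<delta> by (intro integral_mono abs_mult_le_weighted_squares integrable_abs integrable_mult_squares) auto
    also have "\<dots> = \<delta> * (\<integral>x. (f n x)\<^sup>2 \<partial>M) + G / \<delta>" using f[of n] g by (simp add: G_def)
    also have "\<dots> < \<delta> * (r / (2 * \<delta>)) + G / \<delta>" using N[OF that] \<delta> by (intro add_strict_right_mono mult_strict_left_mono) auto
    also have "\<dots> = r / 2 + G / \<delta>" using \<delta> by simp
    also have "G / \<delta> \<le> r / 2" using r G by (simp add: \<delta>_def field_simps)
    finally show ?thesis by simp
  qed
  then show "\<exists>N. \<forall>n\<ge>N. norm ((\<integral>x. f n x * g x \<partial>M) - 0) < r" by blast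
qed

text \<open>The limit comes from a subsequence. Comparing a fixed late \<open>f m\<close> with that
  subsequence under dominated convergence transfers the Cauchy estimate to the whole
  sequence.\<close>

lemma L2_complete:
  fixes f :: "nat \<Rightarrow> 'a \<Rightarrow> real"
  assumes meas[measurable]: "\<And>n. f n \<in> borel_measurable M"
    and int: "\<And>n. integrable M (\<lambda>x. (f n x)\<^sup>2)"
    and Cauchy: "\<And>\<epsilon>. 0 < \<epsilon> \<Longrightarrow> \<exists>N. \<forall>m\<ge>N. \<forall>n\<ge>N. (\<integral>x. (f m x - f n x)\<^sup>2 \<partial>M) < \<epsilon>"
  obtains u where "u \<in> borel_measurable M" "integrable M (\<lambda>x. (u x)\<^sup>2)"
    "(\<lambda>n. \<integral>x. (f n x - u x)\<^sup>2 \<partial>M) \<longlonglongrightarrow> 0"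
proof -
  have i2: "integrable M (\<lambda>x. \<bar>f n x\<bar> ^ 2)" for n using int by simp
  have C2: "\<exists>N. \<forall>m\<ge>N. \<forall>n\<ge>N. (\<integral>x. \<bar>f m x - f n x\<bar> ^ 2 \<partial>M) < \<epsilon>" if "0 < \<epsilon>" for \<epsilon>
    using Cauchy[OF that] by simp
  obtain r u K where r: "strict_mono r" and u[measurable]: "u \<in> borel_measurable M" and K: "integrable M K"
    and lim: "AE x in M. (\<lambda>n. f (r n) x) \<longlonglongrightarrow> u x"
    and dom: "\<And>n. AE x in M. \<bar>f (r n) x\<bar> ^ 2 \<le> K x"
    by (rule Lp_Cauchy_subseq[OF zero_less_numeral meas i2 C2]) (auto intro: that)
  have dom': "AE x in M. \<forall>n. (f (r n) x)\<^sup>2 \<le> K x" using dom by (simp add: AE_all_countable)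
  have u2: "AE x in M. (u x)\<^sup>2 \<le> K x"
    using lim dom'
  proof eventually_elim
    case (elim x)
    from tendsto_power[OF elim(1), of 2] show ?case by (rule LIMSEQ_le_const2) (use elim(2) in auto)
  qed
  have ui: "integrable M (\<lambda>x. (u x)\<^sup>2)"
    by (rule Bochner_Integration.integrable_bound[OF K]) (use u2 in auto)
  have "(\<lambda>n. \<integral>x. (f n x - u x)\<^sup>2 \<partial>M) \<longlonglongrightarrow> 0"
  proof (rule LIMSEQ_I)
    fix \<epsilon> :: real assume \<epsilon>: "0 < \<epsilon>"
    then obtain N where N: "\<And>m n. m \<ge> N \<Longrightarrow> n \<ge> N \<Longrightarrow> (\<integral>x. (f m x - f n x)\<^sup>2 \<partial>M) < \<epsilon> / 2"
      using Cauchy[of "\<epsilon> / 2"] by auto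
    have "norm ((\<integral>x. (f m x - u x)\<^sup>2 \<partial>M) - 0) < \<epsilon>" if "m \<ge> N" for m
    proof -
      have "(\<lambda>n. \<integral>x. (f m x - f (r n) x)\<^sup>2 \<partial>M) \<longlonglongrightarrow> (\<integral>x. (f m x - u x)\<^sup>2 \<partial>M)"
      proof (rule integral_dominated_convergence[where w = "\<lambda>x. 2 * ((f m x)\<^sup>2 + K x)"])
        show "integrable M (\<lambda>x. 2 * ((f m x)\<^sup>2 + K x))" using int K by auto
        show "AE x in M. (\<lambda>n. (f m x - f (r n) x)\<^sup>2) \<longlonglongrightarrow> (f m x - u x)\<^sup>2"
          using lim by eventually_elim (intro tendsto_intros)
        show "AE x in M. norm ((f m x - f (r n) x)\<^sup>2) \<le> 2 * ((f m x)\<^sup>2 + K x)" for n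
          using dom[of n]
        proof eventually_elim
          case (elim x)
          have "(f m x - f (r n) x)\<^sup>2 + (f m x + f (r n) x)\<^sup>2 = 2 * (f m x)\<^sup>2 + 2 * (f (r n) x)\<^sup>2"
            by (simp add: power2_eq_square algebra_simps)
          moreover have "0 \<le> (f m x + f (r n) x)\<^sup>2" "0 \<le> (f m x)\<^sup>2" "0 \<le> (f (r n) x)\<^sup>2" by auto
          moreover have "a \<le> 2 * (c + k)" if "a + b = 2 * c + 2 * d" "0 \<le> b" "0 \<le> c" "0 \<le> d" "d \<le> k" for a b c d k :: real
            using that by simp
          ultimately show ?case using elim unfolding real_norm_def abs_power2 power2_abs by blast
        qed
      qed auto
      moreover have "\<exists>N0. \<forall>n\<ge>N0. (\<integral>x. (f m x - f (r n) x)\<^sup>2 \<partial>M) \<le> \<epsilon> / 2"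
      proof (intro exI[of _ N] allI impI)
        fix n assume "N \<le> n"
        then have "N \<le> r n" using seq_suble[OF r, of n] by linarith
        then show "(\<integral>x. (f m x - f (r n) x)\<^sup>2 \<partial>M) \<le> \<epsilon> / 2" using N[OF that] by (simp add: less_imp_le)
      qed
      ultimately have "(\<integral>x. (f m x - u x)\<^sup>2 \<partial>M) \<le> \<epsilon> / 2" by (rule LIMSEQ_le_const2)
      then show ?thesis using \<epsilon> by simp
    qed
    then show "\<exists>N. \<forall>n\<ge>N. norm ((\<integral>x. (f n x - u x)\<^sup>2 \<partial>M) - 0) < \<epsilon>" by blast
  qed
  with u ui show ?thesis by (rule that)
qed

section \<open>Integration over one period strip\<close>

abbreviation DT :: "real \<Rightarrow> (real \<times> real) measure" where
  "DT T \<equiv> restrict_space lborel (UNIV \<times> {0..T})"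

lemma strip_borel: "UNIV \<times> {0..T} \<in> sets (borel :: (real \<times> real) measure)"
  by (intro borel_closed closed_Times) auto

lemma DT_integrable: "integrable (DT T) (\<lambda>z. F (fst z) (snd z)) \<longleftrightarrow> integrableD T F"
  using strip_borel by (simp add: integrable_restrict_space integrableD_def set_integrable_def)

lemma DT_integral: "(\<integral>z. F (fst z) (snd z) \<partial>DT T) = intD T F"
  using strip_borel by (simp add: integral_restrict_space intD_def set_lebesgue_integral_def)

lemma DT_measurable:
  fixes F :: "real \<Rightarrow> real \<Rightarrow> real"
  shows
  "(\<lambda>z. F (fst z) (snd z)) \<in> borel_measurable (DT T) \<longleftrightarrow>
    (\<lambda>z. indicator (UNIV \<times> {0..T}) z * F (fst z) (snd z)) \<in> borel_measurable lborel"
  using strip_borel by (simp add: borel_measurable_restrict_space_iff)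

lemma L2_D_iff: "L2_D T F \<longleftrightarrow> (\<lambda>z. F (fst z) (snd z)) \<in> borel_measurable (DT T) \<and>
    integrable (DT T) (\<lambda>z. (F (fst z) (snd z))\<^sup>2)"
  unfolding L2_D_def DT_measurable by (subst DT_integrable[where F = "\<lambda>x t. (F x t)\<^sup>2"]) simp

lemma integrableD_mult:
  assumes "L2_D T F" "L2_D T G"
  shows "integrableD T (\<lambda>x t. F x t * G x t)"
  unfolding DT_integrable[symmetric]
  using assms unfolding L2_D_iff by (intro integrable_mult_squares) auto

lemma intD_Fubini:
  assumes "integrableD T F"
  shows "intD T F = (\<integral>x. (\<integral>t. F x t \<partial>IT T) \<partial>lborel)" (is ?x)
    and "intD T F = (\<integral>t. (\<integral>x. F x t \<partial>lborel) \<partial>IT T)" (is ?t)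
proof -
  let ?F = "\<lambda>x t. indicator {0..T} t * F x t"
  have eq: "(\<lambda>z. indicator (UNIV \<times> {0..T}) z *\<^sub>R F (fst z) (snd z)) = (\<lambda>(x, t). ?F x t)"
    by (auto simp: indicator_def)
  have i: "integrable (lborel \<Otimes>\<^sub>M lborel) (\<lambda>(x, t). ?F x t)"
    using assms unfolding integrableD_def set_integrable_def eq lborel_prod .
  have e: "intD T F = integral\<^sup>L (lborel \<Otimes>\<^sub>M lborel) (\<lambda>(x, t). ?F x t)"
    unfolding intD_def set_lebesgue_integral_def eq lborel_prod ..
  show ?x unfolding e IT_integral set_lebesgue_integral_def
    using lborel_pair.integral_fst'[OF i] by simp
  show ?t unfolding e IT_integral set_lebesgue_integral_def
    using lborel_pair.integral_snd[OF i] by simp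
qed

lemma integrableD_exp_bound:
  assumes m: "(\<lambda>z. F (fst z) (snd z)) \<in> borel_measurable borel" and a: "0 < a"
    and b: "\<And>x t. 0 \<le> t \<Longrightarrow> t \<le> T \<Longrightarrow> \<bar>F x t\<bar> \<le> C * exp (- a * \<bar>x\<bar>)"
  shows "integrableD T F"
  unfolding integrableD_def set_integrable_def lborel_prod[symmetric]
proof (rule Bochner_Integration.integrable_bound)
  have "integrable lborel (\<lambda>x. C * exp (- a * \<bar>x\<bar>))" using integrable_exp_abs_decay[OF a] by simp
  moreover have "integrable lborel (indicator {0..T} :: real \<Rightarrow> real)" by (simp add: emeasure_lborel_Icc_eq)
  ultimately show "integrable (lborel \<Otimes>\<^sub>M lborel) (\<lambda>(x, t). C * exp (- a * \<bar>x\<bar>) * indicator {0..T} t)"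
    by (rule integrable_lborel_prod_mult)
  show "(\<lambda>z. indicator (UNIV \<times> {0..T}) z *\<^sub>R F (fst z) (snd z)) \<in> borel_measurable (lborel \<Otimes>\<^sub>M lborel)"
    unfolding lborel_prod using m strip_borel by (intro borel_measurable_scaleR borel_measurable_indicator) auto
  show "AE z in lborel \<Otimes>\<^sub>M lborel. norm (indicator (UNIV \<times> {0..T}) z *\<^sub>R F (fst z) (snd z))
      \<le> norm (case z of (x, t) \<Rightarrow> C * exp (- a * \<bar>x\<bar>) * indicator {0..T} t)"
    using order_trans[OF b abs_ge_self] by (intro AE_I2) (auto simp: indicator_def)
qed

lemma L2_D_exp_bound:
  assumes m: "(\<lambda>z. F (fst z) (snd z)) \<in> borel_measurable borel" and a: "0 < a"
    and b: "\<And>x t. 0 \<le> t \<Longrightarrow> t \<le> T \<Longrightarrow> \<bar>F x t\<bar> \<le> C * exp (- a * \<bar>x\<bar>)"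
  shows "L2_D T F"
  unfolding L2_D_def
proof
  show "(\<lambda>z. indicator (UNIV \<times> {0..T}) z * F (fst z) (snd z)) \<in> borel_measurable lborel"
    using m strip_borel by (intro borel_measurable_times borel_measurable_indicator) auto
  show "integrableD T (\<lambda>x t. (F x t)\<^sup>2)"
  proof (rule integrableD_exp_bound[where C = "C\<^sup>2" and a = "2 * a"])
    show "(\<lambda>z. (F (fst z) (snd z))\<^sup>2) \<in> borel_measurable borel" using m by measurable
    fix x t :: real assume "0 \<le> t" "t \<le> T"
    from b[OF this] have "\<bar>F x t\<bar>\<^sup>2 \<le> (C * exp (- a * \<bar>x\<bar>))\<^sup>2" by (intro power_mono) auto
    then show "\<bar>(F x t)\<^sup>2\<bar> \<le> C\<^sup>2 * exp (- (2 * a) * \<bar>x\<bar>)"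
      by (simp add: power_mult_distrib exp_double[symmetric] mult.assoc)
  qed (use a in simp)
qed

text \<open>Orthogonality in t bounds the squared L^2 norm of a block of the series by its squared
  coefficients, although absolute convergence may fail. The limit is described by its pairings with
  L^2 functions, which is the form that weak derivatives and the weak equation use.\<close>

lemma L2_D_series:
  fixes e a :: "nat \<Rightarrow> real \<Rightarrow> real" and c :: "nat \<Rightarrow> real"
  assumes orth: "orth_system (IT T) e h" and e[measurable]: "\<And>j. e j \<in> borel_measurable borel"
    and a[measurable]: "\<And>j. a j \<in> borel_measurable borel"
    and \<rho>: "0 < \<rho>" and K: "\<And>j x. \<bar>a j x\<bar> \<le> K * exp (- \<rho> * \<bar>x\<bar>)"
    and c: "summable (\<lambda>j. (c j)\<^sup>2)"
  obtains u where "L2_D T u"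
    "\<And>\<kappa>. L2_D T \<kappa> \<Longrightarrow>
      (\<lambda>N. \<Sum>j<N. c j * intD T (\<lambda>x t. a j x * e j t * \<kappa> x t)) \<longlonglongrightarrow> intD T (\<lambda>x t. u x t * \<kappa> x t)"
proof -
  interpret orth_system "IT T" e h by (rule orth)
  have K0: "0 \<le> K" using K[of 0 0] by simp
  define s where "s N x t = (\<Sum>j<N. c j * (a j x * e j t))" for N x t
  have ae: "L2_D T (\<lambda>x t. a j x * e j t)" for j
  proof (rule L2_D_exp_bound[OF _ \<rho>])
    show "\<bar>a j x * e j t\<bar> \<le> K * exp (- \<rho> * \<bar>x\<bar>)" for x t
      using mult_mono[OF K[of j x] e_bnd[of j t]] K0 by (simp add: abs_mult)
    show "(\<lambda>z. a j (fst z) * e j (snd z)) \<in> borel_measurable borel"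
      unfolding borel_prod[symmetric] by measurable
  qed
  have dm: "(\<lambda>z. \<Sum>j<N. d j * (a j (fst z) * e j (snd z))) \<in> borel_measurable borel" for d :: "nat \<Rightarrow> real" and N
    unfolding borel_prod[symmetric] by measurable
  have dL2: "L2_D T (\<lambda>x t. \<Sum>j<N. d j * (a j x * e j t))" for d N
  proof (rule L2_D_exp_bound[OF dm \<rho>, where C = "(\<Sum>j<N. \<bar>d j\<bar> * K)"])
    fix x t
    have "\<bar>\<Sum>j<N. d j * (a j x * e j t)\<bar> \<le> (\<Sum>j<N. \<bar>d j * (a j x * e j t)\<bar>)" by (rule sum_abs)
    also have "\<dots> \<le> (\<Sum>j<N. \<bar>d j\<bar> * (K * exp (- \<rho> * \<bar>x\<bar>)))"
    proof (intro sum_mono)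
      fix j
      have "\<bar>a j x * e j t\<bar> \<le> K * exp (- \<rho> * \<bar>x\<bar>)"
        using mult_mono[OF K[of j x] e_bnd[of j t]] K0 by (simp add: abs_mult)
      then show "\<bar>d j * (a j x * e j t)\<bar> \<le> \<bar>d j\<bar> * (K * exp (- \<rho> * \<bar>x\<bar>))"
        unfolding abs_mult[of "d j"] by (rule mult_left_mono) simp
    qed
    also have "\<dots> = (\<Sum>j<N. \<bar>d j\<bar> * K) * exp (- \<rho> * \<bar>x\<bar>)" by (simp add: sum_distrib_right mult.assoc)
    finally show "\<bar>\<Sum>j<N. d j * (a j x * e j t)\<bar> \<le> (\<Sum>j<N. \<bar>d j\<bar> * K) * exp (- \<rho> * \<bar>x\<bar>)" .
  qed
  \<comment> \<open>The squared norm in time multiplied by the space integral of the squared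
    envelope.\<close>
  define W where "W = h * K\<^sup>2 * (\<integral>x. exp (- (2 * \<rho>) * \<bar>x\<bar>) \<partial>lborel)"
  have W0: "0 \<le> W" unfolding W_def using h_pos by simp
  have sq: "intD T (\<lambda>x t. (\<Sum>j<N. d j * (a j x * e j t))\<^sup>2) \<le> W * (\<Sum>j<N. (d j)\<^sup>2)" for d N
  proof -
    have inner: "(\<integral>t. (\<Sum>j<N. d j * (a j x * e j t))\<^sup>2 \<partial>IT T) = h * (\<Sum>j<N. (d j * a j x)\<^sup>2)" for x
      using sq_dist(2)[where v = "\<lambda>_. 0" and N = N and d = "\<lambda>j. d j * a j x"] by (simp add: mult.assoc)
    have "intD T (\<lambda>x t. (\<Sum>j<N. d j * (a j x * e j t))\<^sup>2) = (\<integral>x. h * (\<Sum>j<N. (d j * a j x)\<^sup>2) \<partial>lborel)"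
      using intD_Fubini(1)[of T "\<lambda>x t. (\<Sum>j<N. d j * (a j x * e j t))\<^sup>2"] dL2[of d N]
      unfolding inner L2_D_def by simp
    also have "\<dots> \<le> (\<integral>x. (h * K\<^sup>2 * (\<Sum>j<N. (d j)\<^sup>2)) * exp (- (2 * \<rho>) * \<bar>x\<bar>) \<partial>lborel)"
    proof (rule Bochner_Integration.integral_mono')
      show "integrable lborel (\<lambda>x. (h * K\<^sup>2 * (\<Sum>j<N. (d j)\<^sup>2)) * exp (- (2 * \<rho>) * \<bar>x\<bar>))"
        using integrable_exp_abs_decay[of "2 * \<rho>"] \<rho> by simp
      fix x
      have "(d j * a j x)\<^sup>2 \<le> (d j)\<^sup>2 * (K\<^sup>2 * exp (- (2 * \<rho>) * \<bar>x\<bar>))" for j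
      proof -
        have "\<bar>a j x\<bar>\<^sup>2 \<le> (K * exp (- \<rho> * \<bar>x\<bar>))\<^sup>2" by (intro power_mono K) auto
        also have "\<dots> = K\<^sup>2 * exp (- (2 * \<rho>) * \<bar>x\<bar>)" by (simp add: power_mult_distrib exp_double[symmetric] mult.assoc)
        finally show ?thesis unfolding power_mult_distrib by (intro mult_left_mono) auto
      qed
      then have "h * (\<Sum>j<N. (d j * a j x)\<^sup>2) \<le> h * (\<Sum>j<N. (d j)\<^sup>2 * (K\<^sup>2 * exp (- (2 * \<rho>) * \<bar>x\<bar>)))"
        using h_pos by (intro mult_left_mono sum_mono) auto
      then show *: "h * (\<Sum>j<N. (d j * a j x)\<^sup>2) \<le> (h * K\<^sup>2 * (\<Sum>j<N. (d j)\<^sup>2)) * exp (- (2 * \<rho>) * \<bar>x\<bar>)"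
        by (simp add: sum_distrib_right sum_distrib_left mult_ac)
      have "0 \<le> h * (\<Sum>j<N. (d j * a j x)\<^sup>2)" using h_pos by (intro mult_nonneg_nonneg sum_nonneg) auto
      from order_trans[OF this *] show "0 \<le> (h * K\<^sup>2 * (\<Sum>j<N. (d j)\<^sup>2)) * exp (- (2 * \<rho>) * \<bar>x\<bar>)" .
    qed
    also have "\<dots> = W * (\<Sum>j<N. (d j)\<^sup>2)" by (simp add: W_def)
    finally show ?thesis .
  qed
  let ?f = "\<lambda>N z. s N (fst z) (snd z)"
  have f: "?f N \<in> borel_measurable (DT T)" "integrable (DT T) (\<lambda>z. (?f N z)\<^sup>2)" for N
    using dL2[of c N] unfolding L2_D_iff s_def by auto
  have Cauchy: "\<exists>N. \<forall>m\<ge>N. \<forall>n\<ge>N. (\<integral>z. (?f m z - ?f n z)\<^sup>2 \<partial>DT T) < \<epsilon>" if \<epsilon>: "0 < \<epsilon>" for \<epsilon>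
  proof -
    have key: "(\<integral>z. (?f m z - ?f n z)\<^sup>2 \<partial>DT T) \<le> W * (\<Sum>j=n..<m. (c j)\<^sup>2)" if "n \<le> m" for m n
    proof -
      \<comment> \<open>Zeroing the first n coefficients presents a block as a full partial sum, to
        which \<open>sq\<close> applies.\<close>
      define d where "d j = (if n \<le> j then c j else 0)" for j
      have "s m x t - s n x t = (\<Sum>j<m. d j * (a j x * e j t))" for x t
      proof -
        have "s m x t - s n x t = (\<Sum>j\<in>{..<m} - {..<n}. c j * (a j x * e j t))"
          unfolding s_def using that by (subst sum_diff) auto
        also have "\<dots> = (\<Sum>j<m. d j * (a j x * e j t))"
          by (rule sum.mono_neutral_cong_left) (auto simp: d_def)
        finally show ?thesis .
      qed
      then have "(\<integral>z. (?f m z - ?f n z)\<^sup>2 \<partial>DT T) = intD T (\<lambda>x t. (\<Sum>j<m. d j * (a j x * e j t))\<^sup>2)"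
        unfolding DT_integral[symmetric] by simp
      also have "\<dots> \<le> W * (\<Sum>j<m. (d j)\<^sup>2)" by (rule sq)
      also have "(\<Sum>j<m. (d j)\<^sup>2) = (\<Sum>j=n..<m. (c j)\<^sup>2)"
        by (rule sum.mono_neutral_cong_right) (auto simp: d_def)
      finally show ?thesis .
    qed
    have "0 < \<epsilon> / (W + 1)" using \<epsilon> W0 by simp
    then obtain N where N: "\<And>m n. m \<ge> N \<Longrightarrow> norm (\<Sum>j=m..<n. (c j)\<^sup>2) < \<epsilon> / (W + 1)"
      using c unfolding summable_Cauchy by blast
    have le: "(\<integral>z. (?f m z - ?f n z)\<^sup>2 \<partial>DT T) < \<epsilon>" if "n \<le> m" "N \<le> n" for m n
    proof -
      have "W * (\<Sum>j=n..<m. (c j)\<^sup>2) \<le> W * (\<epsilon> / (W + 1))"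
        using N[OF that(2), of m] W0 by (intro mult_left_mono) auto
      also have "\<dots> < \<epsilon>" using \<epsilon> W0 by (simp add: field_simps)
      finally show ?thesis using key[OF that(1)] by linarith
    qed
    have "(\<integral>z. (?f m z - ?f n z)\<^sup>2 \<partial>DT T) < \<epsilon>" if "N \<le> m" "N \<le> n" for m n
    proof (cases "n \<le> m")
      case False
      then show ?thesis using le[of m n] that by (simp add: power2_commute[of "?f m _"])
    qed (use le that in auto)
    then show ?thesis by blast
  qed
  obtain u where u: "u \<in> borel_measurable (DT T)" "integrable (DT T) (\<lambda>x. (u x)\<^sup>2)"
    "(\<lambda>n. \<integral>x. (?f n x - u x)\<^sup>2 \<partial>DT T) \<longlonglongrightarrow> 0"
    by (rule L2_complete[of ?f "DT T"]) (use f Cauchy in auto)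
  show ?thesis
  proof (rule that[of "\<lambda>x t. u (x, t)"])
    show uL: "L2_D T (\<lambda>x t. u (x, t))" using u by (simp add: L2_D_iff)
    fix \<kappa> assume \<kappa>: "L2_D T \<kappa>"
    then have \<kappa>': "(\<lambda>z. \<kappa> (fst z) (snd z)) \<in> borel_measurable (DT T)" "integrable (DT T) (\<lambda>z. (\<kappa> (fst z) (snd z))\<^sup>2)"
      by (auto simp: L2_D_iff)
    have "(\<lambda>n. \<integral>z. (?f n z - u z) * \<kappa> (fst z) (snd z) \<partial>DT T) \<longlonglongrightarrow> 0"
      using f u \<kappa>' by (intro integral_mult_tendsto_zero integrable_diff_square) auto
    moreover have "(\<integral>z. (?f n z - u z) * \<kappa> (fst z) (snd z) \<partial>DT T)
        = (\<Sum>j<n. c j * intD T (\<lambda>x t. a j x * e j t * \<kappa> x t)) - intD T (\<lambda>x t. u (x, t) * \<kappa> x t)" for n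
    proof -
      have "(\<integral>z. (?f n z - u z) * \<kappa> (fst z) (snd z) \<partial>DT T)
          = (\<integral>z. ?f n z * \<kappa> (fst z) (snd z) \<partial>DT T) - (\<integral>z. u z * \<kappa> (fst z) (snd z) \<partial>DT T)"
        unfolding left_diff_distrib
        using f u \<kappa>' by (intro Bochner_Integration.integral_diff integrable_mult_squares) auto
      also have "(\<integral>z. u z * \<kappa> (fst z) (snd z) \<partial>DT T) = intD T (\<lambda>x t. u (x, t) * \<kappa> x t)"
        unfolding DT_integral[symmetric] by simp
      also have "(\<integral>z. ?f n z * \<kappa> (fst z) (snd z) \<partial>DT T)
          = (\<integral>z. (\<Sum>j<n. c j * (a j (fst z) * e j (snd z) * \<kappa> (fst z) (snd z))) \<partial>DT T)"
        by (simp add: s_def sum_distrib_right mult.assoc)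
      also have "\<dots> = (\<Sum>j<n. \<integral>z. c j * (a j (fst z) * e j (snd z) * \<kappa> (fst z) (snd z)) \<partial>DT T)"
      proof (intro Bochner_Integration.integral_sum integrable_mult_right)
        show "integrable (DT T) (\<lambda>z. a j (fst z) * e j (snd z) * \<kappa> (fst z) (snd z))" for j
          using integrableD_mult[OF ae[of j] \<kappa>] DT_integrable[where F = "\<lambda>x t. a j x * e j t * \<kappa> x t"] by simp
      qed
      also have "\<dots> = (\<Sum>j<n. c j * intD T (\<lambda>x t. a j x * e j t * \<kappa> x t))"
        unfolding DT_integral[symmetric] by simp
      finally show ?thesis .
    qed
    ultimately have "(\<lambda>n. (\<Sum>j<n. c j * intD T (\<lambda>x t. a j x * e j t * \<kappa> x t)) - intD T (\<lambda>x t. u (x, t) * \<kappa> x t)) \<longlonglongrightarrow> 0"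
      by simp
    then show "(\<lambda>N. \<Sum>j<N. c j * intD T (\<lambda>x t. a j x * e j t * \<kappa> x t)) \<longlonglongrightarrow> intD T (\<lambda>x t. u (x, t) * \<kappa> x t)"
      by (rule LIM_zero_cancel)
  qed
qed

section \<open>Testing a single mode\<close>

lemma integral_split_at_0:
  fixes f f1 f2 :: "real \<Rightarrow> real"
  assumes [measurable]: "f \<in> borel_measurable borel"
    and i: "integrable lborel (\<lambda>x. indicator {0..} x * f1 x)" "integrable lborel (\<lambda>x. indicator {0..} x * f2 x)"
    and f: "\<And>x. 0 < x \<Longrightarrow> f x = f1 x" "\<And>x. 0 < x \<Longrightarrow> f (- x) = f2 x"
  shows "integrable lborel f"
    "(\<integral>x. f x \<partial>lborel) = (\<integral>x. indicator {0..} x * f1 x \<partial>lborel) + (\<integral>x. indicator {0..} x * f2 x \<partial>lborel)"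
proof -
  let ?g = "\<lambda>x. indicator {0..} (- x) * f2 (- x)"
  have i2: "integrable lborel ?g"
    using lborel_integrable_real_affine[OF i(2), of "-1" 0] by simp
  have e2: "(\<integral>x. ?g x \<partial>lborel) = (\<integral>x. indicator {0..} x * f2 x \<partial>lborel)"
    using lborel_integral_real_affine[of "-1" "\<lambda>x. indicator {0..} x * f2 x" 0] by simp
  have "AE x in lborel. x \<noteq> (0::real)" by (rule AE_lborel_singleton)
  then have ae: "AE x in lborel. f x = indicator {0..} x * f1 x + ?g x"
  proof eventually_elim
    case (elim x)
    then consider "0 < x" | "0 < - x" by linarith
    then show ?case using f(1)[of x] f(2)[of "- x"] by cases auto
  qed
  have isum: "integrable lborel (\<lambda>x. indicator {0..} x * f1 x + ?g x)" using i(1) i2 by simp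
  show "integrable lborel f"
    using isum by (subst integrable_cong_AE[OF _ _ ae]) auto
  have "(\<integral>x. f x \<partial>lborel) = (\<integral>x. indicator {0..} x * f1 x + ?g x \<partial>lborel)"
    using isum by (intro integral_cong_AE ae) auto
  then show "(\<integral>x. f x \<partial>lborel) = (\<integral>x. indicator {0..} x * f1 x \<partial>lborel) + (\<integral>x. indicator {0..} x * f2 x \<partial>lborel)"
    using i(1) i2 e2 by simp
qed

section \<open>Test functions on the space-time cylinder\<close>

lemma smooth2_cont:
  assumes "smooth2 \<psi>"
  shows "continuous_on UNIV (\<lambda>z. \<psi> (fst z) (snd z))" "continuous_on UNIV (\<lambda>z. dx \<psi> (fst z) (snd z))"
    "continuous_on UNIV (\<lambda>z. dt \<psi> (fst z) (snd z))"
    "((\<lambda>y. \<psi> y t) has_real_derivative dx \<psi> x t) (at x)" "((\<lambda>s. \<psi> x s) has_real_derivative dt \<psi> x t) (at t)"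
proof -
  note s = assms[unfolded smooth2_def, rule_format]
  show "continuous_on UNIV (\<lambda>z. \<psi> (fst z) (snd z))" "continuous_on UNIV (\<lambda>z. dx \<psi> (fst z) (snd z))"
    "continuous_on UNIV (\<lambda>z. dt \<psi> (fst z) (snd z))"
    using s[of "[]"] s[of "[True]"] s[of "[False]"] by auto
  have "(\<lambda>y. \<psi> y t) differentiable at x" "(\<lambda>s. \<psi> x s) differentiable at t" using s[of "[]"] by auto
  then show "((\<lambda>y. \<psi> y t) has_real_derivative dx \<psi> x t) (at x)" "((\<lambda>s. \<psi> x s) has_real_derivative dt \<psi> x t) (at t)"
    unfolding dx_def dt_def by (simp_all add: DERIV_deriv_iff_real_differentiable)
qed

lemma smooth2_support:
  assumes z: "\<And>x t. R < \<bar>x\<bar> \<Longrightarrow> \<psi> x t = 0" and x: "R < \<bar>x\<bar>"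
  shows "dx \<psi> x t = 0" "dt \<psi> x t = 0"
proof -
  have "open {x. R < \<bar>x\<bar>}" by (intro open_Collect_less continuous_intros)
  then have "((\<lambda>y. \<psi> y t) has_real_derivative 0) (at x)"
    by (intro has_field_derivative_transform_within_open[OF DERIV_const[of 0], where S = "{x. R < \<bar>x\<bar>}"])
      (use x z in auto)
  then show "dx \<psi> x t = 0" unfolding dx_def by (rule DERIV_imp_deriv)
  show "dt \<psi> x t = 0" unfolding dt_def using z[OF x] by (simp add: DERIV_imp_deriv ext[of "\<psi> x" "\<lambda>_. 0"])
qed

text \<open>Compact support in x allows any rate \<rho>, which puts test functions and modes under
  the same exponential integrability criterion.\<close>

lemma continuous_compact_support_exp_bound:
  fixes F :: "real \<Rightarrow> real \<Rightarrow> real"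
  assumes c: "continuous_on UNIV (\<lambda>z. F (fst z) (snd z))" and s: "\<And>x t. R < \<bar>x\<bar> \<Longrightarrow> F x t = 0"
  shows "\<exists>C\<ge>0. \<forall>x t. 0 \<le> t \<longrightarrow> t \<le> T \<longrightarrow> \<bar>F x t\<bar> \<le> C * exp (- \<rho> * \<bar>x\<bar>)"
proof -
  have "compact ((\<lambda>z. F (fst z) (snd z) * exp (\<rho> * \<bar>fst z\<bar>)) ` ({-R..R} \<times> {0..T}))"
    by (intro compact_continuous_image compact_Times continuous_intros continuous_on_subset[OF c]) auto
  then have "bounded ((\<lambda>z. F (fst z) (snd z) * exp (\<rho> * \<bar>fst z\<bar>)) ` ({-R..R} \<times> {0..T}))"
    by (rule compact_imp_bounded)
  then obtain C where C: "\<And>x t. x \<in> {-R..R} \<Longrightarrow> t \<in> {0..T} \<Longrightarrow> \<bar>F x t * exp (\<rho> * \<bar>x\<bar>)\<bar> \<le> C"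
    unfolding bounded_iff by force
  have "\<bar>F x t\<bar> \<le> max 0 C * exp (- \<rho> * \<bar>x\<bar>)" if "0 \<le> t" "t \<le> T" for x t
  proof (cases "x \<in> {-R..R}")
    case True
    have "\<bar>F x t\<bar> * exp (\<rho> * \<bar>x\<bar>) \<le> max 0 C" using C[OF True] that by (simp add: abs_mult le_max_iff_disj)
    then show ?thesis by (simp add: exp_minus field_simps)
  next
    case False
    then have "F x t = 0" using s by auto
    then show ?thesis by simp
  qed
  then show ?thesis by (intro exI[of _ "max 0 C"]) auto
qed

locale test_function =
  fixes T :: real and \<psi> :: "real \<Rightarrow> real \<Rightarrow> real"
  assumes test: "test_fun_D T \<psi>"
begin

lemma cont: "continuous_on UNIV (\<lambda>z. \<psi> (fst z) (snd z))" "continuous_on UNIV (\<lambda>z. dx \<psi> (fst z) (snd z))"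
    "continuous_on UNIV (\<lambda>z. dt \<psi> (fst z) (snd z))"
  and deriv: "((\<lambda>y. \<psi> y t) has_real_derivative dx \<psi> x t) (at x)" "((\<lambda>s. \<psi> x s) has_real_derivative dt \<psi> x t) (at t)"
  using test smooth2_cont[of \<psi>] unfolding test_fun_D_def by auto

lemma periodic: "\<psi> x (t + T) = \<psi> x t"
  using test unfolding test_fun_D_def by auto

lemma support: "\<exists>R\<ge>0. \<forall>x t. R < \<bar>x\<bar> \<longrightarrow> \<psi> x t = 0 \<and> dx \<psi> x t = 0 \<and> dt \<psi> x t = 0"
proof -
  obtain R where R: "\<And>x t. R < \<bar>x\<bar> \<Longrightarrow> \<psi> x t = 0" using test unfolding test_fun_D_def by blast
  then have z: "\<And>x t. max 0 R < \<bar>x\<bar> \<Longrightarrow> \<psi> x t = 0" by auto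
  show ?thesis using z smooth2_support[where R = "max 0 R" and \<psi> = \<psi>, OF z] by (intro exI[of _ "max 0 R"]) simp
qed

lemma cont_x: "continuous_on X (\<lambda>x. \<psi> x t)" "continuous_on X (\<lambda>x. dx \<psi> x t)" "continuous_on X (\<lambda>x. dt \<psi> x t)"
  using cont[THEN continuous_on_compose2, OF continuous_on_Pair[OF continuous_on_id continuous_on_const[of X t]]] by auto

lemma cont_t: "continuous_on X (\<psi> x)" "continuous_on X (dx \<psi> x)" "continuous_on X (dt \<psi> x)"
  using cont[THEN continuous_on_compose2, OF continuous_on_Pair[OF continuous_on_const[of X x] continuous_on_id]] by auto

lemma meas: "(\<lambda>z. \<psi> (fst z) (snd z)) \<in> borel_measurable borel" "(\<lambda>z. dx \<psi> (fst z) (snd z)) \<in> borel_measurable borel"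
  "(\<lambda>z. dt \<psi> (fst z) (snd z)) \<in> borel_measurable borel"
  by (intro borel_measurable_continuous_onI cont)+

lemma exp_bound: "\<exists>C\<ge>0. \<forall>x t. 0 \<le> t \<longrightarrow> t \<le> T \<longrightarrow> \<bar>\<psi> x t\<bar> \<le> C * exp (- \<rho> * \<bar>x\<bar>)"
    "\<exists>C\<ge>0. \<forall>x t. 0 \<le> t \<longrightarrow> t \<le> T \<longrightarrow> \<bar>dx \<psi> x t\<bar> \<le> C * exp (- \<rho> * \<bar>x\<bar>)"
    "\<exists>C\<ge>0. \<forall>x t. 0 \<le> t \<longrightarrow> t \<le> T \<longrightarrow> \<bar>dt \<psi> x t\<bar> \<le> C * exp (- \<rho> * \<bar>x\<bar>)"
proof -
  obtain R where R: "\<forall>x t. R < \<bar>x\<bar> \<longrightarrow> \<psi> x t = 0 \<and> dx \<psi> x t = 0 \<and> dt \<psi> x t = 0" using support by blast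
  show "\<exists>C\<ge>0. \<forall>x t. 0 \<le> t \<longrightarrow> t \<le> T \<longrightarrow> \<bar>\<psi> x t\<bar> \<le> C * exp (- \<rho> * \<bar>x\<bar>)"
    by (rule continuous_compact_support_exp_bound[OF cont(1)]) (use R in auto)
  show "\<exists>C\<ge>0. \<forall>x t. 0 \<le> t \<longrightarrow> t \<le> T \<longrightarrow> \<bar>dx \<psi> x t\<bar> \<le> C * exp (- \<rho> * \<bar>x\<bar>)"
    by (rule continuous_compact_support_exp_bound[OF cont(2)]) (use R in auto)
  show "\<exists>C\<ge>0. \<forall>x t. 0 \<le> t \<longrightarrow> t \<le> T \<longrightarrow> \<bar>dt \<psi> x t\<bar> \<le> C * exp (- \<rho> * \<bar>x\<bar>)"
    by (rule continuous_compact_support_exp_bound[OF cont(3)]) (use R in auto)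
qed

lemma integrable_times_bounded:
  fixes F :: "real \<Rightarrow> real \<Rightarrow> real"
  assumes m: "(\<lambda>z. F (fst z) (snd z)) \<in> borel_measurable borel" and b: "\<And>x t. \<bar>F x t\<bar> \<le> B"
  shows "integrableD T (\<lambda>x t. F x t * \<psi> x t)" "integrableD T (\<lambda>x t. F x t * dx \<psi> x t)"
    "integrableD T (\<lambda>x t. F x t * dt \<psi> x t)"
proof -
  have "integrableD T (\<lambda>x t. F x t * \<kappa> x t)"
    if \<kappa>m: "(\<lambda>z. \<kappa> (fst z) (snd z)) \<in> borel_measurable borel"
      and ex: "\<exists>C\<ge>0. \<forall>x t. 0 \<le> t \<longrightarrow> t \<le> T \<longrightarrow> \<bar>\<kappa> x t\<bar> \<le> C * exp (- 1 * \<bar>x\<bar>)" for \<kappa>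
  proof -
    obtain C where C: "\<And>x t. 0 \<le> t \<Longrightarrow> t \<le> T \<Longrightarrow> \<bar>\<kappa> x t\<bar> \<le> C * exp (- 1 * \<bar>x\<bar>)" using ex by blast
    have B: "0 \<le> B" using b[of 0 0] by linarith
    show ?thesis
    proof (rule integrableD_exp_bound[where a = 1 and C = "B * C"])
      show "(\<lambda>z. F (fst z) (snd z) * \<kappa> (fst z) (snd z)) \<in> borel_measurable borel" using m \<kappa>m by measurable
      show "\<bar>F x t * \<kappa> x t\<bar> \<le> B * C * exp (- 1 * \<bar>x\<bar>)" if "0 \<le> t" "t \<le> T" for x t
        using mult_mono[OF b[of x t] C[OF that, of x]] B by (simp add: abs_mult mult.assoc)
    qed simp
  qed
  from this[OF meas(1) exp_bound(1)] this[OF meas(2) exp_bound(2)] this[OF meas(3) exp_bound(3)]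
  show "integrableD T (\<lambda>x t. F x t * \<psi> x t)" "integrableD T (\<lambda>x t. F x t * dx \<psi> x t)"
    "integrableD T (\<lambda>x t. F x t * dt \<psi> x t)" by auto
qed

lemma L2: "L2_D T \<psi>" "L2_D T (dx \<psi>)" "L2_D T (dt \<psi>)"
proof -
  have "L2_D T \<kappa>"
    if \<kappa>m: "(\<lambda>z. \<kappa> (fst z) (snd z)) \<in> borel_measurable borel"
      and "\<exists>C\<ge>0. \<forall>x t. 0 \<le> t \<longrightarrow> t \<le> T \<longrightarrow> \<bar>\<kappa> x t\<bar> \<le> C * exp (- 1 * \<bar>x\<bar>)" for \<kappa>
    using that L2_D_exp_bound[OF \<kappa>m zero_less_one] by blast
  from this[OF meas(1) exp_bound(1)] this[OF meas(2) exp_bound(2)] this[OF meas(3) exp_bound(3)]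
  show "L2_D T \<psi>" "L2_D T (dx \<psi>)" "L2_D T (dt \<psi>)" by auto
qed

end

lemma periodic_ibp:
  fixes \<eta> \<eta>' :: "real \<Rightarrow> real"
  assumes T: "0 \<le> T" and per: "cos (k * T) = 1" "sin (k * T) = 0"
    and d: "\<And>t. (\<eta> has_real_derivative \<eta>' t) (at t)" and c: "continuous_on {0..T} \<eta>'" and \<eta>: "\<eta> T = \<eta> 0"
  shows "(\<integral>t. sin (k * t) * \<eta>' t \<partial>IT T) = - k * (\<integral>t. cos (k * t) * \<eta> t \<partial>IT T)"
    "(\<integral>t. cos (k * t) * \<eta>' t \<partial>IT T) = k * (\<integral>t. sin (k * t) * \<eta> t \<partial>IT T)"
proof -
  have \<eta>c: "continuous_on {0..T} \<eta>" by (meson d DERIV_continuous_on has_field_derivative_at_within)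
  have cc: "continuous_on {0..T} (\<lambda>t. sin (k * t) * \<eta>' t)" "continuous_on {0..T} (\<lambda>t. cos (k * t) * \<eta> t)"
    "continuous_on {0..T} (\<lambda>t. cos (k * t) * \<eta>' t)" "continuous_on {0..T} (\<lambda>t. sin (k * t) * \<eta> t)"
    by (intro continuous_intros c \<eta>c)+
  note ii = cc[THEN IT_integrable_cont]
  have "(\<integral>t. sin (k * t) * \<eta>' t + k * (cos (k * t) * \<eta> t) \<partial>IT T) = sin (k * T) * \<eta> T - sin (k * 0) * \<eta> 0"
    by (rule IT_FTC[OF T]) (auto intro!: derivative_eq_intros d continuous_intros cc)
  then show "(\<integral>t. sin (k * t) * \<eta>' t \<partial>IT T) = - k * (\<integral>t. cos (k * t) * \<eta> t \<partial>IT T)"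
    using ii per by simp
  have "(\<integral>t. cos (k * t) * \<eta>' t - k * (sin (k * t) * \<eta> t) \<partial>IT T) = cos (k * T) * \<eta> T - cos (k * 0) * \<eta> 0"
    by (rule IT_FTC[OF T]) (auto intro!: derivative_eq_intros d continuous_intros cc)
  then show "(\<integral>t. cos (k * t) * \<eta>' t \<partial>IT T) = k * (\<integral>t. sin (k * t) * \<eta> t \<partial>IT T)"
    using ii per \<eta> by simp
qed

section \<open>Integration by parts across x = 0\<close>

context exp_tail
begin

lemma A_meas[measurable]: "A \<in> borel_measurable borel"
  by (intro borel_measurable_continuous_onI continuous_at_imp_continuous_on) (simp add: A_isCont)

lemma S_meas[measurable]: "S \<in> borel_measurable borel"
  by (intro borel_measurable_continuous_onI S_continuous)

text \<open>Each half line contributes one formula, the left one through the reflected test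
  function. For the even function S |x| the boundary terms at 0 cancel; for the odd function sgn x A
  |x| they add up to -2 A 0 \<eta> 0, the jump of the derivative that meets the Dirac term.\<close>

lemma even_ibp:
  fixes \<eta> \<eta>' :: "real \<Rightarrow> real"
  assumes d: "\<And>x. (\<eta> has_real_derivative \<eta>' x) (at x)" and c: "continuous_on UNIV \<eta>'"
    and supp: "\<And>x. R < \<bar>x\<bar> \<Longrightarrow> \<eta> x = 0" "\<And>x. R < \<bar>x\<bar> \<Longrightarrow> \<eta>' x = 0"
  shows "(\<integral>x. S \<bar>x\<bar> * \<eta>' x \<partial>lborel) = - (\<integral>x. sgn x * A \<bar>x\<bar> * \<eta> x \<partial>lborel)"
    "(\<integral>x. sgn x * A \<bar>x\<bar> * \<eta>' x \<partial>lborel) = - 2 * A 0 * \<eta> 0 - (\<integral>x. q \<bar>x\<bar> * \<eta> x \<partial>lborel)"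
proof -
  have \<eta>c: "continuous_on UNIV \<eta>" by (meson d DERIV_continuous_on has_field_derivative_at_within)
  note [measurable] = borel_measurable_continuous_onI[OF \<eta>c] borel_measurable_continuous_onI[OF c]
  have d2: "((\<lambda>x. \<eta> (- x)) has_real_derivative - \<eta>' (- x)) (at x)" for x
    using DERIV_chain'[OF DERIV_minus[OF DERIV_ident] d, of x] by simp
  have c2: "continuous_on UNIV (\<lambda>x. - \<eta>' (- x))"
    by (intro continuous_intros continuous_on_compose2[OF c]) auto
  have supp': "\<eta> x = 0" "\<eta>' x = 0" "\<eta> (- x) = 0" "- \<eta>' (- x) = 0" if "R < x" for x
    using supp[of x] supp[of "- x"] that by auto
  note S1 = S_ibp[where R = R, OF d c supp'(1,2)] and S2 = S_ibp[where R = R, OF d2 c2 supp'(3,4)]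
  have S2': "integrable lborel (\<lambda>x. indicator {0..} x * (S x * \<eta>' (- x)))"
    using S2(1) by simp
  have S2'': "integrable lborel (\<lambda>x. indicator {0..} x * (- (A x * \<eta> (- x))))"
    using S2(2) by simp
  have e1: "(\<integral>x. S \<bar>x\<bar> * \<eta>' x \<partial>lborel) = (\<integral>x. indicator {0..} x * (S x * \<eta>' x) \<partial>lborel)
      + (\<integral>x. indicator {0..} x * (S x * \<eta>' (- x)) \<partial>lborel)"
    by (rule integral_split_at_0(2)[OF _ S1(1) S2']) auto
  have e2: "(\<integral>x. sgn x * A \<bar>x\<bar> * \<eta> x \<partial>lborel) = (\<integral>x. indicator {0..} x * (A x * \<eta> x) \<partial>lborel)
      + (\<integral>x. indicator {0..} x * (- (A x * \<eta> (- x))) \<partial>lborel)"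
    by (rule integral_split_at_0(2)[OF _ S1(2) S2'']) auto
  show "(\<integral>x. S \<bar>x\<bar> * \<eta>' x \<partial>lborel) = - (\<integral>x. sgn x * A \<bar>x\<bar> * \<eta> x \<partial>lborel)"
    unfolding e1 e2 using S1(3) S2(3) by simp
  have "compact (\<eta> ` {-R..R})" by (intro compact_continuous_image continuous_on_subset[OF \<eta>c]) auto
  from compact_imp_bounded[OF this] obtain C where C: "\<And>x. x \<in> {-R..R} \<Longrightarrow> \<bar>\<eta> x\<bar> \<le> C"
    unfolding bounded_iff by force
  have Cb: "\<bar>\<eta> x\<bar> \<le> max 0 C" for x
  proof (cases "x \<in> {-R..R}")
    case False
    then have "R < \<bar>x\<bar>" by auto
    then show ?thesis using supp(1) by simp
  qed (use C in \<open>auto simp: le_max_iff_disj\<close>)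
  have i\<eta>': "integrable lborel \<eta>'"
  proof -
    have "\<eta>' = (\<lambda>x. indicator {-R..R} x *\<^sub>R \<eta>' x)"
    proof
      fix x show "\<eta>' x = indicator {-R..R} x *\<^sub>R \<eta>' x"
        using supp(2)[of x] by (cases "R < \<bar>x\<bar>") (auto simp: indicator_def)
    qed
    moreover have "set_integrable lborel {-R..R} \<eta>'"
      by (rule borel_integrable_atLeastAtMost'[OF continuous_on_subset[OF c]]) simp
    ultimately show ?thesis unfolding set_integrable_def by simp
  qed
  have i2\<eta>': "integrable lborel (\<lambda>x. - \<eta>' (- x))"
    using lborel_integrable_real_affine[OF i\<eta>', of "-1" 0] by simp
  note A1 = A_ibp[OF d c i\<eta>' Cb] and A2 = A_ibp[OF d2 c2 i2\<eta>' Cb]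
  have e3: "(\<integral>x. sgn x * A \<bar>x\<bar> * \<eta>' x \<partial>lborel) = (\<integral>x. indicator {0..} x * (A x * \<eta>' x) \<partial>lborel)
      + (\<integral>x. indicator {0..} x * (A x * - \<eta>' (- x)) \<partial>lborel)"
    by (rule integral_split_at_0(2)[OF _ A1(1) A2(1)]) auto
  have qi: "q x * f x = indicator {0..} x * (q x * f x)" for f :: "real \<Rightarrow> real" and x
    using q_zero[of x] by (auto simp: indicator_def)
  have q\<eta>: "integrable lborel (\<lambda>x. indicator {0..} x * (q x * f x))"
    if [measurable]: "f \<in> borel_measurable borel" and "\<And>x. \<bar>f x\<bar> \<le> max 0 C" for f
    unfolding qi[symmetric]
  proof (rule Bochner_Integration.integrable_bound)
    show "integrable lborel (\<lambda>x. max 0 C * \<bar>q x\<bar>)" using q_integrable by simp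
    have "\<bar>q x * f x\<bar> \<le> max 0 C * \<bar>q x\<bar>" for x
      unfolding abs_mult mult.commute[of "\<bar>q x\<bar>"] by (intro mult_right_mono that) auto
    then show "AE x in lborel. norm (q x * f x) \<le> norm (max 0 C * \<bar>q x\<bar>)"
      by (intro AE_I2) (metis abs_ge_self order_trans real_norm_def)
  qed simp
  have e4: "(\<integral>x. q \<bar>x\<bar> * \<eta> x \<partial>lborel) = (\<integral>x. indicator {0..} x * (q x * \<eta> x) \<partial>lborel)
      + (\<integral>x. indicator {0..} x * (q x * \<eta> (- x)) \<partial>lborel)"
    by (rule integral_split_at_0(2)[OF _ q\<eta> q\<eta>]) (auto intro: Cb)
  show "(\<integral>x. sgn x * A \<bar>x\<bar> * \<eta>' x \<partial>lborel) = - 2 * A 0 * \<eta> 0 - (\<integral>x. q \<bar>x\<bar> * \<eta> x \<partial>lborel)"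
    unfolding e3 e4 A1(2) A2(2) qi[of _ \<eta>, symmetric] qi[of _ "\<lambda>x. \<eta> (- x)", symmetric] by simp
qed

end

lemma integrableD_integrable_time:
  assumes "integrableD T F"
  shows "integrable (IT T) (\<lambda>t. \<integral>x. F x t \<partial>lborel)"
proof -
  have eq: "(\<lambda>z. indicator (UNIV \<times> {0..T}) z *\<^sub>R F (fst z) (snd z)) = (\<lambda>(x, t). indicator {0..T} t * F x t)"
    by (auto simp: indicator_def)
  have "integrable (lborel \<Otimes>\<^sub>M lborel) (\<lambda>(x, t). indicator {0..T} t * F x t)"
    using assms unfolding integrableD_def set_integrable_def eq lborel_prod .
  from lborel_pair.integrable_snd[OF this] show ?thesis
    unfolding IT_integrable set_integrable_def by simp
qed

text \<open>The separated mode S |x| sin (k t) against one test function. The bound \<open>B\<close>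
  may depend on the mode, since it serves integrability and not the summation over modes.\<close>

locale mode = exp_tail q Q \<rho> + test_function T \<psi> for q Q \<rho> T \<psi> +
  fixes k B :: real
  assumes k_pos: "0 < k" and T_nonneg: "0 \<le> T"
    and per: "cos (k * T) = 1" "sin (k * T) = 0"
    and S_bnd: "\<And>x. 0 \<le> x \<Longrightarrow> \<bar>S x\<bar> \<le> B" and A_bnd: "\<And>x. 0 \<le> x \<Longrightarrow> \<bar>A x\<bar> \<le> B"
begin

lemma mode_integrable:
  fixes a e :: "real \<Rightarrow> real"
  assumes [measurable]: "a \<in> borel_measurable borel" "e \<in> borel_measurable borel"
    and a: "\<And>x. \<bar>a x\<bar> \<le> D" and e: "\<And>t. \<bar>e t\<bar> \<le> 1"
  shows "integrableD T (\<lambda>x t. a x * e t * \<psi> x t)" "integrableD T (\<lambda>x t. a x * e t * dx \<psi> x t)"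
    "integrableD T (\<lambda>x t. a x * e t * dt \<psi> x t)"
proof -
  have m: "(\<lambda>z. a (fst z) * e (snd z)) \<in> borel_measurable borel" unfolding borel_prod[symmetric] by measurable
  have D: "0 \<le> D" using a[of 0] by linarith
  have b: "\<bar>a x * e t\<bar> \<le> D" for x t
    using mult_mono[OF a[of x] e[of t]] D by (simp add: abs_mult)
  from integrable_times_bounded[of "\<lambda>x t. a x * e t", OF m b]
  show "integrableD T (\<lambda>x t. a x * e t * \<psi> x t)" "integrableD T (\<lambda>x t. a x * e t * dx \<psi> x t)"
    "integrableD T (\<lambda>x t. a x * e t * dt \<psi> x t)" by auto
qed

lemma psi_period: "\<psi> x T = \<psi> x 0"
  using periodic[of x 0] by simp

lemma time_ibp:
  assumes a[measurable]: "a \<in> borel_measurable borel" and ab: "\<And>x. \<bar>a x\<bar> \<le> D"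
  shows "intD T (\<lambda>x t. a x * sin (k * t) * dt \<psi> x t) = - k * intD T (\<lambda>x t. a x * cos (k * t) * \<psi> x t)"
    "intD T (\<lambda>x t. a x * cos (k * t) * dt \<psi> x t) = k * intD T (\<lambda>x t. a x * sin (k * t) * \<psi> x t)"
proof -
  note ms = mode_integrable[of a "\<lambda>t. sin (k * t)" D] and mc = mode_integrable[of a "\<lambda>t. cos (k * t)" D]
  note ibp = periodic_ibp[OF T_nonneg per deriv(2) cont_t(3) psi_period]
  have "intD T (\<lambda>x t. a x * sin (k * t) * dt \<psi> x t) = (\<integral>x. a x * (- k * (\<integral>t. cos (k * t) * \<psi> x t \<partial>IT T)) \<partial>lborel)"
    using intD_Fubini(1)[OF ms(3)] ab by (simp add: mult.assoc ibp)
  also have "\<dots> = - k * intD T (\<lambda>x t. a x * cos (k * t) * \<psi> x t)"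
    using intD_Fubini(1)[OF mc(1)] ab by (simp add: mult.assoc mult.left_commute[of _ k])
  finally show "intD T (\<lambda>x t. a x * sin (k * t) * dt \<psi> x t) = - k * intD T (\<lambda>x t. a x * cos (k * t) * \<psi> x t)" .
  have "intD T (\<lambda>x t. a x * cos (k * t) * dt \<psi> x t) = (\<integral>x. a x * (k * (\<integral>t. sin (k * t) * \<psi> x t \<partial>IT T)) \<partial>lborel)"
    using intD_Fubini(1)[OF mc(3)] ab by (simp add: mult.assoc ibp)
  also have "\<dots> = k * intD T (\<lambda>x t. a x * sin (k * t) * \<psi> x t)"
    using intD_Fubini(1)[OF ms(1)] ab by (simp add: mult.assoc mult.left_commute[of _ k])
  finally show "intD T (\<lambda>x t. a x * cos (k * t) * dt \<psi> x t) = k * intD T (\<lambda>x t. a x * sin (k * t) * \<psi> x t)" .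
qed

lemma space_ibp:
  "(\<integral>x. S \<bar>x\<bar> * dx \<psi> x t \<partial>lborel) = - (\<integral>x. sgn x * A \<bar>x\<bar> * \<psi> x t \<partial>lborel)"
  "(\<integral>x. sgn x * A \<bar>x\<bar> * dx \<psi> x t \<partial>lborel) = - 2 * A 0 * \<psi> 0 t - (\<integral>x. q \<bar>x\<bar> * \<psi> x t \<partial>lborel)"
proof -
  obtain R where R: "\<forall>x t. R < \<bar>x\<bar> \<longrightarrow> \<psi> x t = 0 \<and> dx \<psi> x t = 0 \<and> dt \<psi> x t = 0" using support by blast
  then have s: "\<And>x. R < \<bar>x\<bar> \<Longrightarrow> \<psi> x t = 0" "\<And>x. R < \<bar>x\<bar> \<Longrightarrow> dx \<psi> x t = 0" by auto
  show "(\<integral>x. S \<bar>x\<bar> * dx \<psi> x t \<partial>lborel) = - (\<integral>x. sgn x * A \<bar>x\<bar> * \<psi> x t \<partial>lborel)"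
    "(\<integral>x. sgn x * A \<bar>x\<bar> * dx \<psi> x t \<partial>lborel) = - 2 * A 0 * \<psi> 0 t - (\<integral>x. q \<bar>x\<bar> * \<psi> x t \<partial>lborel)"
    using even_ibp[OF deriv(1) cont_x(2) s] by auto
qed

lemma sgn_A_bnd: "\<bar>sgn x * A \<bar>x\<bar>\<bar> \<le> B"
proof -
  have "\<bar>sgn x\<bar> * \<bar>A \<bar>x\<bar>\<bar> \<le> 1 * B" by (intro mult_mono A_bnd) (auto simp: sgn_if)
  then show ?thesis by (simp add: abs_mult)
qed

lemma mode_dx:
  "intD T (\<lambda>x t. S \<bar>x\<bar> * sin (k * t) * dx \<psi> x t) = - intD T (\<lambda>x t. sgn x * A \<bar>x\<bar> * sin (k * t) * \<psi> x t)"
proof -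
  have "intD T (\<lambda>x t. S \<bar>x\<bar> * sin (k * t) * dx \<psi> x t) = (\<integral>t. (\<integral>x. sin (k * t) * (S \<bar>x\<bar> * dx \<psi> x t) \<partial>lborel) \<partial>IT T)"
    using intD_Fubini(2)[OF mode_integrable(2)[of "\<lambda>x. S \<bar>x\<bar>" "\<lambda>t. sin (k * t)" B]] S_bnd
    by (simp add: mult_ac del: integral_mult_right_zero integral_mult_left_zero)
  also have "\<dots> = - (\<integral>t. (\<integral>x. sin (k * t) * (sgn x * A \<bar>x\<bar> * \<psi> x t) \<partial>lborel) \<partial>IT T)"
    by (simp add: space_ibp)
  also have "(\<integral>t. (\<integral>x. sin (k * t) * (sgn x * A \<bar>x\<bar> * \<psi> x t) \<partial>lborel) \<partial>IT T) = intD T (\<lambda>x t. sgn x * A \<bar>x\<bar> * sin (k * t) * \<psi> x t)"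
    using intD_Fubini(2)[OF mode_integrable(1)[of "\<lambda>x. sgn x * A \<bar>x\<bar>" "\<lambda>t. sin (k * t)" B]] sgn_A_bnd
    by (simp add: mult_ac del: integral_mult_right_zero integral_mult_left_zero)
  finally show ?thesis .
qed

text \<open>The jump at 0 yields the trace term. Both terms on the right are rewritten with
  \<open>dt \<psi>\<close> by an integration by parts in time, because the weak formulation pairs
  \<open>wt\<close> and the cubic term with \<open>dt \<psi>\<close>; this is the origin of the
  factors 1/k.\<close>

lemma mode_equation:
  "intD T (\<lambda>x t. sgn x * A \<bar>x\<bar> * sin (k * t) * dx \<psi> x t)
    = - 2 * A 0 / k * (\<integral>t. cos (k * t) * dt \<psi> 0 t \<partial>IT T) - 1 / k * intD T (\<lambda>x t. q \<bar>x\<bar> * cos (k * t) * dt \<psi> x t)"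
proof -
  have "intD T (\<lambda>x t. sgn x * A \<bar>x\<bar> * sin (k * t) * dx \<psi> x t) = (\<integral>t. (\<integral>x. sin (k * t) * (sgn x * A \<bar>x\<bar> * dx \<psi> x t) \<partial>lborel) \<partial>IT T)"
    using intD_Fubini(2)[OF mode_integrable(2)[of "\<lambda>x. sgn x * A \<bar>x\<bar>" "\<lambda>t. sin (k * t)" B]] sgn_A_bnd
    by (simp add: mult_ac del: integral_mult_right_zero integral_mult_left_zero)
  also have "\<dots> = (\<integral>t. - 2 * A 0 * (sin (k * t) * \<psi> 0 t) - (\<integral>x. sin (k * t) * (q \<bar>x\<bar> * \<psi> x t) \<partial>lborel) \<partial>IT T)"
    by (simp only: integral_mult_right_zero space_ibp) (simp add: right_diff_distrib mult_ac)
  also have "\<dots> = - 2 * A 0 * (\<integral>t. sin (k * t) * \<psi> 0 t \<partial>IT T) - (\<integral>t. (\<integral>x. sin (k * t) * (q \<bar>x\<bar> * \<psi> x t) \<partial>lborel) \<partial>IT T)"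
  proof -
    have i1: "integrable (IT T) (\<lambda>t. sin (k * t) * \<psi> 0 t)"
      by (intro IT_integrable_cont continuous_intros cont_t)
    have "integrable (IT T) (\<lambda>t. \<integral>x. sin (k * t) * (q \<bar>x\<bar> * \<psi> x t) \<partial>lborel)"
    proof -
      have "integrableD T (\<lambda>x t. q \<bar>x\<bar> * sin (k * t) * \<psi> x t)"
        using q_le by (intro mode_integrable(1)) auto
      from integrableD_integrable_time[OF this] show ?thesis
        by (simp add: mult_ac del: integral_mult_right_zero integral_mult_left_zero)
    qed
    with i1 show ?thesis by simp
  qed
  also have "(\<integral>t. (\<integral>x. sin (k * t) * (q \<bar>x\<bar> * \<psi> x t) \<partial>lborel) \<partial>IT T) = intD T (\<lambda>x t. q \<bar>x\<bar> * sin (k * t) * \<psi> x t)"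
    using intD_Fubini(2)[OF mode_integrable(1)[of "\<lambda>x. q \<bar>x\<bar>" "\<lambda>t. sin (k * t)" Q]] q_le
    by (simp add: mult_ac del: integral_mult_right_zero integral_mult_left_zero)
  also have "\<dots> = 1 / k * intD T (\<lambda>x t. q \<bar>x\<bar> * cos (k * t) * dt \<psi> x t)"
    using time_ibp(2)[of "\<lambda>x. q \<bar>x\<bar>" Q] q_le k_pos by simp
  also have "(\<integral>t. sin (k * t) * \<psi> 0 t \<partial>IT T) = 1 / k * (\<integral>t. cos (k * t) * dt \<psi> 0 t \<partial>IT T)"
    using periodic_ibp(2)[OF T_nonneg per deriv(2) cont_t(3) psi_period] k_pos by simp
  finally show ?thesis by simp
qed

end

section \<open>Assembling the solution\<close>

lemma sin_orth_system:
  assumes \<omega>: "0 < \<omega>" and T: "T = 2 * pi / \<omega>"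
  shows "orth_system (IT T) (\<lambda>j t. sin (real (2 * j + 1) * \<omega> * t)) (T / 2)"
proof (intro orth_system.intro orth_system_axioms.intro IT_finite)
  show "(\<lambda>t. sin (real (2 * j + 1) * \<omega> * t)) \<in> borel_measurable (IT T)" for j
    by (intro IT_measurable_cont continuous_intros)
  show "(\<integral>t. sin (real (2 * i + 1) * \<omega> * t) * sin (real (2 * j + 1) * \<omega> * t) \<partial>IT T) = (if i = j then T / 2 else 0)" for i j
    using IT_cos_cos(2)[OF \<omega> T, of "2 * i + 1" "2 * j + 1"] by simp
qed (use \<omega> T in auto)

lemma AE_lborel_fst:
  assumes "AE x in lborel. P x"
  shows "AE z in (lborel :: (real \<times> real) measure). P (fst z)"
proof -
  obtain N where N: "N \<in> null_sets lborel" "{x. \<not> P x} \<subseteq> N"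
    using assms unfolding eventually_ae_filter by auto
  have [measurable]: "N \<in> sets lborel" using N(1) by auto
  have "AE x in lborel. x \<notin> N" using N(1) by (rule AE_not_in)
  then have ae: "AE x in lborel. AE y in lborel. fst (x, y :: real) \<notin> N" by eventually_elim simp
  have "AE z in lborel \<Otimes>\<^sub>M lborel. fst (z :: real \<times> real) \<notin> N"
  proof (rule lborel_pair.AE_pair_measure)
    show "{z \<in> space (lborel \<Otimes>\<^sub>M lborel). fst (z :: real \<times> real) \<notin> N} \<in> sets (lborel \<Otimes>\<^sub>M lborel)" by measurable
  qed (rule ae)
  then show ?thesis unfolding lborel_prod using N(2) by auto
qed

lemma intD_cong_AE:
  assumes "AE x in lborel. \<forall>t. F x t = F' x t" and "integrableD T F" "integrableD T F'"
  shows "intD T F = intD T F'"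
  unfolding intD_def set_lebesgue_integral_def
  using assms(2,3) AE_lborel_fst[OF assms(1)] unfolding integrableD_def set_integrable_def
  by (intro integral_cong_AE) auto

lemma DERIV_unique_at_right:
  fixes f :: "real \<Rightarrow> real"
  assumes "(f has_real_derivative d) (at 0 within {0..})" "(f has_real_derivative d') (at 0 within {0..})"
  shows "d = d'"
proof -
  have "at 0 within {0..} \<noteq> (bot :: real filter)" by (simp add: at_within_Ici_at_right)
  then show ?thesis using assms unfolding has_field_derivative_iff by (rule tendsto_unique)
qed

lemma summable_inverse_odd_squares: "summable (\<lambda>j. 1 / (real (2 * j + 1))\<^sup>2)"
proof (rule summable_comparison_test)
  have "summable (\<lambda>n. inverse (real n ^ 2))" by (rule inverse_power_summable) simp
  then show "summable (\<lambda>n. inverse (real (Suc n) ^ 2))" by (subst summable_Suc_iff)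
  have "1 / (real (2 * n + 1))\<^sup>2 \<le> inverse (real (Suc n) ^ 2)" for n
    unfolding inverse_eq_divide by (intro divide_left_mono power_mono) auto
  then show "\<exists>N. \<forall>n\<ge>N. norm (1 / (real (2 * n + 1))\<^sup>2) \<le> inverse (real (Suc n) ^ 2)" by auto
qed

text \<open>\<open>G\<close> is a representative of the coefficient that is bounded and even at
  every point, so that the estimates for the modes can be pointwise.\<close>

locale wave_modes =
  fixes G :: "real \<Rightarrow> real" and \<omega> \<rho> M B :: real and \<Phi> :: "nat \<Rightarrow> real \<Rightarrow> real"
  assumes omega_pos: "0 < \<omega>" and rho_pos: "0 < \<rho>"
    and G_meas[measurable]: "G \<in> borel_measurable borel"
    and G_bnd: "\<And>x. \<bar>G x\<bar> \<le> B" and G_even: "\<And>x. G (- x) = G x"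
    and Phi: "\<And>k. odd k \<Longrightarrow> is_Phi G \<omega> k (\<Phi> k)"
    and Phi_bnd: "\<And>k x. odd k \<Longrightarrow> 0 \<le> x \<Longrightarrow> \<bar>\<Phi> k x\<bar> \<le> M * exp (- \<rho> * x)"
begin

definition T :: real where "T = 2 * pi / \<omega>"

definition \<kappa> :: "nat \<Rightarrow> real" where "\<kappa> j = real (2 * j + 1) * \<omega>"

text \<open>The second derivative dictated by the equation, set to 0 on the left. The inner
  \<open>max 0 x\<close> lets measurability follow from the continuity of \<Phi> on the half
  line.\<close>

definition q :: "nat \<Rightarrow> real \<Rightarrow> real" where
  "q j x = (if 0 < x then - (\<kappa> j)\<^sup>2 * G x * \<Phi> (2 * j + 1) (max 0 x) else 0)"

lemma T_pos: "0 < T" using omega_pos by (simp add: T_def)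

lemma kappa_pos: "0 < \<kappa> j" using omega_pos by (simp add: \<kappa>_def)

lemma kappa_period: "cos (\<kappa> j * T) = 1" "sin (\<kappa> j * T) = 0"
  using cos_at_period[OF omega_pos T_def, of "2 * j + 1"] by (simp_all add: \<kappa>_def)

lemma B_nonneg: "0 \<le> B" using G_bnd[of 0] by linarith

lemma M_nonneg: "0 \<le> M" using Phi_bnd[of 1 0] by simp

lemma Phi_cont: "continuous_on {0..} (\<Phi> (2 * j + 1))"
  using Phi[of "2 * j + 1"] by (simp add: is_Phi_def)

lemma exp_tail_q: "exp_tail (q j) ((\<kappa> j)\<^sup>2 * B * M) \<rho>"
proof
  have "continuous_on UNIV (\<lambda>x. \<Phi> (2 * j + 1) (max 0 x))"
    by (rule continuous_on_compose2[OF Phi_cont]) (auto intro!: continuous_intros)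
  from borel_measurable_continuous_onI[OF this] have [measurable]: "(\<lambda>x. \<Phi> (2 * j + 1) (max 0 x)) \<in> borel_measurable borel" .
  show "q j \<in> borel_measurable borel" unfolding q_def by measurable
  show "0 < \<rho>" by (rule rho_pos)
  show "q j x = 0" if "x \<le> 0" for x using that by (simp add: q_def)
  show "\<bar>q j x\<bar> \<le> (\<kappa> j)\<^sup>2 * B * M * exp (- \<rho> * x)" if "0 < x" for x
  proof -
    have "\<bar>q j x\<bar> = (\<kappa> j)\<^sup>2 * (\<bar>G x\<bar> * \<bar>\<Phi> (2 * j + 1) x\<bar>)"
      using that by (simp add: q_def abs_mult max_def)
    also have "\<dots> \<le> (\<kappa> j)\<^sup>2 * (B * (M * exp (- \<rho> * x)))"
      using that B_nonneg by (intro mult_left_mono mult_mono G_bnd Phi_bnd) auto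
    finally show ?thesis by (simp add: mult.assoc)
  qed
qed

sublocale E: exp_tail "q j" "(\<kappa> j)\<^sup>2 * B * M" \<rho> for j by (rule exp_tail_q)

lemma Phi_eq_S: "0 \<le> x \<Longrightarrow> \<Phi> (2 * j + 1) x = E.S j x"
proof -
  assume x: "0 \<le> x"
  obtain p1 p2 where p: "weak_deriv_on {0<..} (\<Phi> (2 * j + 1)) p1" "weak_deriv_on {0<..} p1 p2"
    "AE x in lborel. 0 < x \<longrightarrow> - p2 x - (real (2 * j + 1))\<^sup>2 * \<omega>\<^sup>2 * G x * \<Phi> (2 * j + 1) x = 0"
    using Phi[of "2 * j + 1"] unfolding is_Phi_def by auto
  have "AE x in lborel. 0 < x \<longrightarrow> p2 x = q j x"
    using p(3)
  proof eventually_elim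
    case (elim x)
    show ?case
    proof
      assume "0 < x"
      with elim have "p2 x = - ((real (2 * j + 1))\<^sup>2 * \<omega>\<^sup>2 * G x * \<Phi> (2 * j + 1) x)" by linarith
      then show "p2 x = q j x" using \<open>0 < x\<close> by (simp add: q_def \<kappa>_def max_def power_mult_distrib)
    qed
  qed
  from E.weak_solution_eq_S[OF p(1,2) this Phi_cont Phi_bnd x] show ?thesis by simp
qed

lemma S_bnd: "0 \<le> x \<Longrightarrow> \<bar>E.S j x\<bar> \<le> M * exp (- \<rho> * x)"
  using Phi_bnd[of "2 * j + 1" x] Phi_eq_S[of x j] by simp

lemma S_abs_bnd: "\<bar>E.S j \<bar>x\<bar>\<bar> \<le> M * exp (- \<rho> * \<bar>x\<bar>)"
  by (rule S_bnd) simp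

lemma S_zero: "E.S j 0 = 1"
  using Phi_eq_S[of 0 j] Phi[of "2 * j + 1"] by (simp add: is_Phi_def)

text \<open>Landau's inequality with step 1/(2j+1) balances 2M/h against the quadratic growth of
  \<open>q\<close>: both terms become linear in 2j+1, with this constant.\<close>

definition L :: real where "L = 2 * M + \<omega>\<^sup>2 * B * M"

lemma L_nonneg: "0 \<le> L" using M_nonneg B_nonneg by (simp add: L_def)

lemma A_bnd: "0 \<le> x \<Longrightarrow> \<bar>E.A j x\<bar> \<le> L / \<omega> * \<kappa> j * exp (- \<rho> * x)"
proof -
  assume x: "0 \<le> x"
  have n: "0 < 1 / real (2 * j + 1)" by simp
  have "2 * M / (1 / real (2 * j + 1)) + (\<kappa> j)\<^sup>2 * B * M * (1 / real (2 * j + 1)) = L / \<omega> * \<kappa> j"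
    using omega_pos by (simp add: L_def \<kappa>_def power2_eq_square field_simps del: of_nat_add of_nat_mult of_nat_Suc)
  with E.A_bound[OF S_bnd n x, of j] show ?thesis by simp
qed

text \<open>\<Phi> is meaningful only on the half line, so the sign condition concerns a one-sided
  derivative; uniqueness identifies it with the tail integral.\<close>

lemma deriv_at_0:
  assumes "(\<Phi> (2 * j + 1) has_real_derivative d) (at 0 within {0..})"
  shows "d = E.A j 0"
proof (rule DERIV_unique_at_right[OF assms])
  have "(E.S j has_real_derivative E.A j 0) (at 0 within {0..})"
    by (rule has_field_derivative_at_within[OF E.S_deriv])
  then show "(\<Phi> (2 * j + 1) has_real_derivative E.A j 0) (at 0 within {0..})"
    by (rule has_field_derivative_transform_within[where d = 1]) (auto simp: Phi_eq_S simp del: add_Suc_right One_nat_def Suc_eq_plus1_left)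
qed

lemma q_abs: "x \<noteq> 0 \<Longrightarrow> q j \<bar>x\<bar> = - (\<kappa> j)\<^sup>2 * (E.S j \<bar>x\<bar> * G x)"
  using Phi_eq_S[of "\<bar>x\<bar>" j] G_even[of x] by (auto simp: q_def max_def abs_if)

lemma mode_test:
  assumes "test_fun_D T \<psi>"
  shows "\<exists>C. mode (q j) ((\<kappa> j)\<^sup>2 * B * M) \<rho> T \<psi> (\<kappa> j) C"
proof -
  have le: "D * exp (- \<rho> * x) \<le> D" if "0 \<le> x" "0 \<le> D" for D x :: real
    using that rho_pos by (intro mult_left_le) auto
  have S: "\<bar>E.S j x\<bar> \<le> max M (L / \<omega> * \<kappa> j)" if "0 \<le> x" for x
    using S_bnd[OF that, of j] le[OF that M_nonneg] by linarith
  have A: "\<bar>E.A j x\<bar> \<le> max M (L / \<omega> * \<kappa> j)" if "0 \<le> x" for x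
    using A_bnd[OF that, of j] le[OF that, of "L / \<omega> * \<kappa> j"] L_nonneg omega_pos kappa_pos[of j]
    by (smt (verit) divide_nonneg_pos mult_nonneg_nonneg)
  show ?thesis
    by (intro exI[of _ "max M (L / \<omega> * \<kappa> j)"] mode.intro exp_tail_q test_function.intro assms mode_axioms.intro kappa_pos kappa_period S A)
      (use T_pos in auto)
qed

end

text \<open>The interface between the variational part and the verification of the equation. The
  Euler-Lagrange identity here already carries \<gamma> and not its absolute value.\<close>

locale wave_solution = wave_modes +
  fixes \<gamma> :: real and c :: "nat \<Rightarrow> real" and v :: "real \<Rightarrow> real"
  assumes v_meas[measurable]: "v \<in> borel_measurable (IT T)" and v4: "integrable (IT T) (\<lambda>t. v t ^ 4)"
    and c2: "summable (\<lambda>j. (c j)\<^sup>2)" and c_nonzero: "\<exists>j. c j \<noteq> 0"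
    and v_series: "(\<lambda>N. \<integral>t. (v t - (\<Sum>j<N. c j * cos (\<kappa> j * t)))\<^sup>2 \<partial>IT T) \<longlonglongrightarrow> 0"
    and Euler_Lagrange: "\<And>\<phi>. continuous_on {0..T} \<phi> \<Longrightarrow>
      (\<lambda>j. - 2 * E.A j 0 / (\<kappa> j)\<^sup>2 * c j * (\<integral>t. cos (\<kappa> j * t) * \<phi> t \<partial>IT T)) sums (\<gamma> * (\<integral>t. v t ^ 3 * \<phi> t \<partial>IT T))"
begin

definition w :: "real \<Rightarrow> real \<Rightarrow> real" where
  "w x t = (\<Sum>j. c j / \<kappa> j * (E.S j \<bar>x\<bar> * sin (\<kappa> j * t)))"

text \<open>Both c and 1/\<kappa> are square summable, so their product is summable. Hence w is a
  uniform limit and inherits the exponential envelope of the modes.\<close>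

lemma coeff_summable: "summable (\<lambda>j. \<bar>c j / \<kappa> j\<bar>)"
proof (rule summable_comparison_test)
  show "summable (\<lambda>j. (c j)\<^sup>2 + 1 / \<omega>\<^sup>2 * (1 / (real (2 * j + 1))\<^sup>2))"
    by (intro summable_add c2 summable_mult summable_inverse_odd_squares)
  have "\<bar>c j * (1 / \<kappa> j)\<bar> \<le> 1 * (c j)\<^sup>2 + (1 / \<kappa> j)\<^sup>2 / 1" for j
    by (rule abs_mult_le_weighted_squares) simp
  then show "\<exists>N. \<forall>j\<ge>N. norm \<bar>c j / \<kappa> j\<bar> \<le> (c j)\<^sup>2 + 1 / \<omega>\<^sup>2 * (1 / (real (2 * j + 1))\<^sup>2)"
    by (intro exI[of _ 0]) (simp add: \<kappa>_def power_divide power_mult_distrib mult.commute)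
qed

lemma term_bnd: "\<bar>c j / \<kappa> j * (E.S j \<bar>x\<bar> * sin (\<kappa> j * t))\<bar> \<le> \<bar>c j / \<kappa> j\<bar> * (M * exp (- \<rho> * \<bar>x\<bar>))"
proof -
  have "\<bar>E.S j \<bar>x\<bar>\<bar> * \<bar>sin (\<kappa> j * t)\<bar> \<le> (M * exp (- \<rho> * \<bar>x\<bar>)) * 1"
    using S_abs_bnd[of j x] M_nonneg by (intro mult_mono) auto
  then show ?thesis unfolding abs_mult[of "c j / \<kappa> j"] by (intro mult_left_mono) (auto simp: abs_mult)
qed

definition C :: real where "C = (\<Sum>j. \<bar>c j / \<kappa> j\<bar>) * M"

lemma partial_sum_bnd: "\<bar>\<Sum>j<N. c j / \<kappa> j * (E.S j \<bar>x\<bar> * sin (\<kappa> j * t))\<bar> \<le> C * exp (- \<rho> * \<bar>x\<bar>)"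
proof -
  have "\<bar>\<Sum>j<N. c j / \<kappa> j * (E.S j \<bar>x\<bar> * sin (\<kappa> j * t))\<bar> \<le> (\<Sum>j<N. \<bar>c j / \<kappa> j\<bar> * (M * exp (- \<rho> * \<bar>x\<bar>)))"
    by (rule order_trans[OF sum_abs sum_mono]) (rule term_bnd)
  also have "\<dots> = (\<Sum>j<N. \<bar>c j / \<kappa> j\<bar>) * (M * exp (- \<rho> * \<bar>x\<bar>))" by (simp add: sum_distrib_right)
  also have "\<dots> \<le> (\<Sum>j. \<bar>c j / \<kappa> j\<bar>) * (M * exp (- \<rho> * \<bar>x\<bar>))"
    using M_nonneg by (intro mult_right_mono sum_le_suminf coeff_summable) auto
  finally show ?thesis by (simp add: C_def mult.assoc)
qed

lemma terms_summable: "summable (\<lambda>j. c j / \<kappa> j * (E.S j \<bar>x\<bar> * sin (\<kappa> j * t)))"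
  by (rule summable_comparison_test[OF _ summable_mult2[OF coeff_summable, of "M * exp (- \<rho> * \<bar>x\<bar>)"]])
    (use term_bnd in auto)

lemma w_lim: "(\<lambda>N. \<Sum>j<N. c j / \<kappa> j * (E.S j \<bar>x\<bar> * sin (\<kappa> j * t))) \<longlonglongrightarrow> w x t"
  unfolding w_def by (rule summable_LIMSEQ[OF terms_summable])

lemma w_bnd: "\<bar>w x t\<bar> \<le> C * exp (- \<rho> * \<bar>x\<bar>)"
  using tendsto_rabs[OF w_lim] by (rule LIMSEQ_le_const2) (use partial_sum_bnd in auto)

lemma C_nonneg: "0 \<le> C"
  unfolding C_def using M_nonneg by (intro mult_nonneg_nonneg suminf_nonneg coeff_summable) auto

lemma w_cont: "continuous_on UNIV (\<lambda>z. w (fst z) (snd z))"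
proof (rule uniform_limit_theorem)
  let ?f = "\<lambda>j z. c j / \<kappa> j * (E.S j \<bar>fst z\<bar> * sin (\<kappa> j * snd z))"
  show "uniform_limit UNIV (\<lambda>N z. \<Sum>j<N. ?f j z) (\<lambda>z. w (fst z) (snd z)) sequentially"
    unfolding w_def
  proof (rule Weierstrass_m_test)
    show "summable (\<lambda>j. \<bar>c j / \<kappa> j\<bar> * M)" by (rule summable_mult2[OF coeff_summable])
    fix j and z :: "real \<times> real"
    have "\<bar>c j / \<kappa> j\<bar> * (M * exp (- \<rho> * \<bar>fst z\<bar>)) \<le> \<bar>c j / \<kappa> j\<bar> * M"
      using rho_pos M_nonneg by (intro mult_left_mono mult_left_le) auto
    then show "norm (?f j z) \<le> \<bar>c j / \<kappa> j\<bar> * M" using term_bnd[of j "fst z" "snd z"] by simp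
  qed
  show "\<forall>\<^sub>F N in sequentially. continuous_on UNIV (\<lambda>z. \<Sum>j<N. ?f j z)"
    by (intro always_eventually allI continuous_intros continuous_on_compose2[OF E.S_continuous[of UNIV]]) auto
qed simp

lemma w_periodic: "w x (t + T) = w x t"
proof -
  have "sin (\<kappa> j * (t + T)) = sin (\<kappa> j * t)" for j
    using kappa_period[of j] by (simp add: distrib_left sin_add)
  then show ?thesis by (simp add: w_def)
qed

lemma w_meas: "(\<lambda>z. w (fst z) (snd z)) \<in> borel_measurable borel"
  by (rule borel_measurable_continuous_onI[OF w_cont])

lemma w_L2: "L2_D T w"
  by (rule L2_D_exp_bound[OF w_meas rho_pos w_bnd])

lemma w_series_integral:
  assumes \<eta>: "L2_D T \<eta>"
  shows "(\<lambda>N. \<Sum>j<N. c j / \<kappa> j * intD T (\<lambda>x t. E.S j \<bar>x\<bar> * sin (\<kappa> j * t) * \<eta> x t)) \<longlonglongrightarrow> intD T (\<lambda>x t. w x t * \<eta> x t)"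
proof -
  let ?s = "\<lambda>N z. \<Sum>j<N. c j / \<kappa> j * (E.S j \<bar>fst z\<bar> * sin (\<kappa> j * snd z))"
  have sm: "(\<lambda>z. E.S j \<bar>fst z\<bar> * sin (\<kappa> j * snd z)) \<in> borel_measurable borel" for j
    unfolding borel_prod[symmetric] by measurable
  have mode_L2: "L2_D T (\<lambda>x t. E.S j \<bar>x\<bar> * sin (\<kappa> j * t))" for j
  proof (rule L2_D_exp_bound[OF sm rho_pos])
    show "\<bar>E.S j \<bar>x\<bar> * sin (\<kappa> j * t)\<bar> \<le> M * exp (- \<rho> * \<bar>x\<bar>)" for x t
      using mult_mono[OF S_abs_bnd[of j x] abs_sin_le_one[of "\<kappa> j * t"]] M_nonneg by (simp add: abs_mult)
  qed
  have ssm: "?s N \<in> borel_measurable borel" for N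
    by (intro borel_measurable_sum borel_measurable_times borel_measurable_const sm)
  have restr: "f \<in> borel_measurable (DT T)" if "f \<in> borel_measurable borel" for f :: "real \<times> real \<Rightarrow> real"
    using that by (intro measurable_restrict_space1) simp
  have \<eta>m: "(\<lambda>z. \<eta> (fst z) (snd z)) \<in> borel_measurable (DT T)" using \<eta> by (simp add: L2_D_iff)
  have "(\<lambda>N. \<integral>z. ?s N z * \<eta> (fst z) (snd z) \<partial>DT T) \<longlonglongrightarrow> (\<integral>z. w (fst z) (snd z) * \<eta> (fst z) (snd z) \<partial>DT T)"
  proof (rule integral_dominated_convergence[where w = "\<lambda>z. \<bar>(C * exp (- \<rho> * \<bar>fst z\<bar>)) * \<eta> (fst z) (snd z)\<bar>"])
    have em: "(\<lambda>z :: real \<times> real. C * exp (- \<rho> * \<bar>fst z\<bar>)) \<in> borel_measurable borel"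
      unfolding borel_prod[symmetric] by measurable
    have "L2_D T (\<lambda>x t. C * exp (- \<rho> * \<bar>x\<bar>))"
      by (rule L2_D_exp_bound[OF em rho_pos, where C = C]) (use C_nonneg in auto)
    from integrableD_mult[OF this \<eta>] show "integrable (DT T) (\<lambda>z. \<bar>(C * exp (- \<rho> * \<bar>fst z\<bar>)) * \<eta> (fst z) (snd z)\<bar>)"
      using DT_integrable[where F = "\<lambda>x t. C * exp (- \<rho> * \<bar>x\<bar>) * \<eta> x t"] by (intro integrable_abs) simp
    show "(\<lambda>z. w (fst z) (snd z) * \<eta> (fst z) (snd z)) \<in> borel_measurable (DT T)"
      by (intro borel_measurable_times restr w_meas \<eta>m)
    show "(\<lambda>z. ?s N z * \<eta> (fst z) (snd z)) \<in> borel_measurable (DT T)" for N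
      by (intro borel_measurable_times restr ssm \<eta>m)
    show "AE z in DT T. (\<lambda>N. ?s N z * \<eta> (fst z) (snd z)) \<longlonglongrightarrow> w (fst z) (snd z) * \<eta> (fst z) (snd z)"
      by (intro AE_I2 tendsto_mult tendsto_const w_lim)
    have "\<bar>?s N z * \<eta> (fst z) (snd z)\<bar> \<le> \<bar>(C * exp (- \<rho> * \<bar>fst z\<bar>)) * \<eta> (fst z) (snd z)\<bar>" for N z
      unfolding abs_mult[of "?s N z"] abs_mult[of "C * exp (- \<rho> * \<bar>fst z\<bar>)"]
      using order_trans[OF partial_sum_bnd abs_ge_self] by (intro mult_right_mono) auto
    then show "AE z in DT T. norm (?s N z * \<eta> (fst z) (snd z)) \<le> \<bar>(C * exp (- \<rho> * \<bar>fst z\<bar>)) * \<eta> (fst z) (snd z)\<bar>" for N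
      by (intro AE_I2) simp
  qed
  moreover have "(\<integral>z. ?s N z * \<eta> (fst z) (snd z) \<partial>DT T) = (\<Sum>j<N. c j / \<kappa> j * intD T (\<lambda>x t. E.S j \<bar>x\<bar> * sin (\<kappa> j * t) * \<eta> x t))" for N
  proof -
    have "(\<integral>z. ?s N z * \<eta> (fst z) (snd z) \<partial>DT T)
        = (\<integral>z. (\<Sum>j<N. c j / \<kappa> j * (E.S j \<bar>fst z\<bar> * sin (\<kappa> j * snd z) * \<eta> (fst z) (snd z))) \<partial>DT T)"
      by (simp add: sum_distrib_right mult.assoc)
    also have "\<dots> = (\<Sum>j<N. \<integral>z. c j / \<kappa> j * (E.S j \<bar>fst z\<bar> * sin (\<kappa> j * snd z) * \<eta> (fst z) (snd z)) \<partial>DT T)"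
    proof (intro Bochner_Integration.integral_sum integrable_mult_right)
      show "integrable (DT T) (\<lambda>z. E.S j \<bar>fst z\<bar> * sin (\<kappa> j * snd z) * \<eta> (fst z) (snd z))" for j
        using integrableD_mult[OF mode_L2[of j] \<eta>] DT_integrable[where F = "\<lambda>x t. E.S j \<bar>x\<bar> * sin (\<kappa> j * t) * \<eta> x t"] by simp
    qed
    also have "\<dots> = (\<Sum>j<N. c j / \<kappa> j * intD T (\<lambda>x t. E.S j \<bar>x\<bar> * sin (\<kappa> j * t) * \<eta> x t))"
      unfolding DT_integral[symmetric] by simp
    finally show ?thesis .
  qed
  moreover have "(\<integral>z. w (fst z) (snd z) * \<eta> (fst z) (snd z) \<partial>DT T) = intD T (\<lambda>x t. w x t * \<eta> x t)"
    by (rule DT_integral)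
  ultimately show ?thesis by simp
qed

lemma w0_cont: "continuous_on X (w 0)"
  using continuous_on_compose2[OF w_cont, OF continuous_on_Pair[OF continuous_on_const[of X 0] continuous_on_id]] by auto

lemma w0_series_integral:
  assumes \<eta>: "continuous_on {0..T} \<eta>"
  shows "(\<lambda>N. \<Sum>j<N. c j / \<kappa> j * (\<integral>t. sin (\<kappa> j * t) * \<eta> t \<partial>IT T)) \<longlonglongrightarrow> (\<integral>t. w 0 t * \<eta> t \<partial>IT T)"
proof -
  let ?s = "\<lambda>N t. \<Sum>j<N. c j / \<kappa> j * sin (\<kappa> j * t)"
  have sb: "\<bar>?s N t\<bar> \<le> C" for N t using partial_sum_bnd[where N = N and x = 0 and t = t] by (simp add: S_zero)
  have \<eta>i: "integrable (IT T) \<eta>" by (rule IT_integrable_cont[OF \<eta>])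
  have "(\<lambda>N. \<integral>t. ?s N t * \<eta> t \<partial>IT T) \<longlonglongrightarrow> (\<integral>t. w 0 t * \<eta> t \<partial>IT T)"
  proof (rule integral_dominated_convergence[where w = "\<lambda>t. C * \<bar>\<eta> t\<bar>"])
    show "integrable (IT T) (\<lambda>t. C * \<bar>\<eta> t\<bar>)" using \<eta>i by simp
    show "(\<lambda>t. w 0 t * \<eta> t) \<in> borel_measurable (IT T)" by (intro IT_measurable_cont continuous_intros w0_cont \<eta>)
    show "(\<lambda>t. ?s N t * \<eta> t) \<in> borel_measurable (IT T)" for N by (intro IT_measurable_cont continuous_intros \<eta>)
    show "AE t in IT T. (\<lambda>N. ?s N t * \<eta> t) \<longlonglongrightarrow> w 0 t * \<eta> t"
      using w_lim[of 0] by (intro AE_I2 tendsto_mult tendsto_const) (simp add: S_zero)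
    show "AE t in IT T. norm (?s N t * \<eta> t) \<le> C * \<bar>\<eta> t\<bar>" for N
      unfolding real_norm_def abs_mult by (intro AE_I2 mult_right_mono sb) simp
  qed
  moreover have "(\<integral>t. ?s N t * \<eta> t \<partial>IT T) = (\<Sum>j<N. c j / \<kappa> j * (\<integral>t. sin (\<kappa> j * t) * \<eta> t \<partial>IT T))" for N
  proof -
    have "integrable (IT T) (\<lambda>t. sin (\<kappa> j * t) * \<eta> t)" for j by (intro IT_integrable_cont continuous_intros \<eta>)
    then show ?thesis by (simp add: sum_distrib_right mult.assoc)
  qed
  ultimately show ?thesis by simp
qed

text \<open>Every S is 1 at x = 0, so the trace of w has integral c_i/\<kappa>_i times T/2 against
  the i-th sine, and some c_i is not 0.\<close>

lemma w_nontrivial: "\<not> (\<forall>x t. w x t = 0)"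
proof
  assume w: "\<forall>x t. w x t = 0"
  have "c i = 0" for i
  proof -
    have orth: "(\<integral>t. sin (\<kappa> j * t) * sin (\<kappa> i * t) \<partial>IT T) = (if j = i then T / 2 else 0)" for j
      using IT_cos_cos(2)[OF omega_pos T_def, of "2 * j + 1" "2 * i + 1"] by (simp add: \<kappa>_def)
    have "(\<lambda>N. \<Sum>j<N. c j / \<kappa> j * (\<integral>t. sin (\<kappa> j * t) * sin (\<kappa> i * t) \<partial>IT T)) \<longlonglongrightarrow> (\<integral>t. w 0 t * sin (\<kappa> i * t) \<partial>IT T)"
      by (intro w0_series_integral continuous_intros)
    then have "(\<lambda>N. \<Sum>j<N. c j / \<kappa> j * (if j = i then T / 2 else 0)) \<longlonglongrightarrow> 0"
      unfolding orth using w by simp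
    moreover have "(\<lambda>N. \<Sum>j<N. c j / \<kappa> j * (if j = i then T / 2 else 0)) \<longlonglongrightarrow> c i / \<kappa> i * (T / 2)"
      by (intro tendsto_eventually eventually_sequentiallyI[of "Suc i"]) (simp add: if_distrib[of "(*) _"] sum.delta cong: if_cong)
    ultimately have "c i / \<kappa> i * (T / 2) = 0" by (rule LIMSEQ_unique[symmetric])
    then show ?thesis using T_pos kappa_pos[of i] by simp
  qed
  then show False using c_nonzero by blast
qed

lemma v_square: "integrable (IT T) (\<lambda>t. (v t)\<^sup>2)" and v_cube: "integrable (IT T) (\<lambda>t. \<bar>v t\<bar> ^ 3)"
proof -
  interpret finite_measure "IT T" by (rule IT_finite)
  have "integrable (IT T) (\<lambda>t. \<bar>v t\<bar> ^ n)" if "n \<le> 4" for n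
  proof (rule Bochner_Integration.integrable_bound)
    show "integrable (IT T) (\<lambda>t. 1 + v t ^ 4)" using v4 by simp
    show "AE t in IT T. norm (\<bar>v t\<bar> ^ n) \<le> norm (1 + v t ^ 4)"
      using power_le_one_plus_power4[OF that] by (intro AE_I2) simp
  qed auto
  from this[of 2] this[of 3] show "integrable (IT T) (\<lambda>t. (v t)\<^sup>2)" "integrable (IT T) (\<lambda>t. \<bar>v t\<bar> ^ 3)" by auto
qed

lemma v_series_integral:
  assumes \<eta>: "continuous_on {0..T} \<eta>"
  shows "(\<lambda>N. \<Sum>j<N. c j * (\<integral>t. cos (\<kappa> j * t) * \<eta> t \<partial>IT T)) \<longlonglongrightarrow> (\<integral>t. v t * \<eta> t \<partial>IT T)"
    "integrable (IT T) (\<lambda>t. v t * \<eta> t)"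
proof -
  let ?s = "\<lambda>N t. \<Sum>j<N. c j * cos (\<kappa> j * t)"
  have sc: "continuous_on {0..T} (?s N)" for N by (intro continuous_intros)
  have s2: "integrable (IT T) (\<lambda>t. (?s N t)\<^sup>2)" for N by (intro IT_integrable_cont continuous_intros)
  have \<eta>2: "integrable (IT T) (\<lambda>t. (\<eta> t)\<^sup>2)" by (intro IT_integrable_cont continuous_intros \<eta>)
  note m = IT_measurable_cont[OF sc] IT_measurable_cont[OF \<eta>]
  show vi: "integrable (IT T) (\<lambda>t. v t * \<eta> t)" by (rule integrable_mult_squares[OF v_meas m(2) v_square \<eta>2])
  have "(\<lambda>N. \<integral>t. (v t - ?s N t) * \<eta> t \<partial>IT T) \<longlonglongrightarrow> 0"
    using m v_square s2 \<eta>2 v_series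
    by (intro integral_mult_tendsto_zero integrable_diff_square) auto
  moreover have "(\<integral>t. (v t - ?s N t) * \<eta> t \<partial>IT T) = (\<integral>t. v t * \<eta> t \<partial>IT T) - (\<Sum>j<N. c j * (\<integral>t. cos (\<kappa> j * t) * \<eta> t \<partial>IT T))" for N
  proof -
    have i: "integrable (IT T) (\<lambda>t. cos (\<kappa> j * t) * \<eta> t)" for j by (intro IT_integrable_cont continuous_intros \<eta>)
    have "(\<integral>t. (v t - ?s N t) * \<eta> t \<partial>IT T) = (\<integral>t. v t * \<eta> t - (\<Sum>j<N. c j * (cos (\<kappa> j * t) * \<eta> t)) \<partial>IT T)"
      by (simp add: left_diff_distrib sum_distrib_right mult.assoc)
    also have "\<dots> = (\<integral>t. v t * \<eta> t \<partial>IT T) - (\<integral>t. (\<Sum>j<N. c j * (cos (\<kappa> j * t) * \<eta> t)) \<partial>IT T)"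
      using vi i by (intro Bochner_Integration.integral_diff integrable_sum integrable_mult_right) auto
    finally show ?thesis using i by simp
  qed
  ultimately have "(\<lambda>N. (\<integral>t. v t * \<eta> t \<partial>IT T) - (\<Sum>j<N. c j * (\<integral>t. cos (\<kappa> j * t) * \<eta> t \<partial>IT T))) \<longlonglongrightarrow> 0" by simp
  from tendsto_diff[OF tendsto_const[of "\<integral>t. v t * \<eta> t \<partial>IT T"] this]
  show "(\<lambda>N. \<Sum>j<N. c j * (\<integral>t. cos (\<kappa> j * t) * \<eta> t \<partial>IT T)) \<longlonglongrightarrow> (\<integral>t. v t * \<eta> t \<partial>IT T)" by simp
qed

text \<open>The sine series of the trace and the cosine series of \<open>v\<close> are paired with
  the test function term by term; the factor \<kappa> from differentiation cancels the one in
  w.\<close>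

lemma trace_derivative: "weak_deriv_T T (\<lambda>t. w 0 t) v"
  unfolding weak_deriv_T_def IT_integrable[symmetric] IT_integral[symmetric]
proof (intro allI impI)
  fix \<eta> assume "smooth1 \<eta> \<and> (\<forall>t. \<eta> (t + T) = \<eta> t)"
  then have \<eta>: "smooth1 \<eta>" and per: "\<eta> T = \<eta> 0" by (auto dest: spec[of _ 0])
  note c = smooth1_continuous[OF \<eta>, of "{0..T}"] smooth1_continuous[OF smooth1_deriv[OF \<eta>], of "{0..T}"]
  have "(\<integral>t. sin (\<kappa> j * t) * deriv \<eta> t \<partial>IT T) = - \<kappa> j * (\<integral>t. cos (\<kappa> j * t) * \<eta> t \<partial>IT T)" for j
    using T_pos by (intro periodic_ibp kappa_period smooth1_has_deriv \<eta> c per) auto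
  then have eq: "c j / \<kappa> j * (\<integral>t. sin (\<kappa> j * t) * deriv \<eta> t \<partial>IT T) = - (c j * (\<integral>t. cos (\<kappa> j * t) * \<eta> t \<partial>IT T))" for j
    using kappa_pos[of j] by simp
  have "(\<integral>t. w 0 t * deriv \<eta> t \<partial>IT T) = - (\<integral>t. v t * \<eta> t \<partial>IT T)"
    using LIMSEQ_unique[OF w0_series_integral[OF c(2), unfolded eq sum_negf] tendsto_minus[OF v_series_integral(1)[OF c(1)]]] .
  moreover have "integrable (IT T) (\<lambda>t. w 0 t * deriv \<eta> t)" by (intro IT_integrable_cont continuous_intros w0_cont c)
  ultimately show "integrable (IT T) (\<lambda>t. w 0 t * deriv \<eta> t) \<and> integrable (IT T) (\<lambda>t. v t * \<eta> t) \<and>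
      (\<integral>t. w 0 t * deriv \<eta> t \<partial>IT T) = - (\<integral>t. v t * \<eta> t \<partial>IT T)"
    using v_series_integral(2)[OF c(1)] by blast
qed

lemma solution: "weak_solution G \<gamma> \<omega> w"
proof -
  \<comment> \<open>Division by \<kappa> absorbs the linear growth of the derivatives, so the space
    amplitudes have one envelope for all modes, as \<open>L2_D_series\<close> requires.\<close>
  have A_abs: "\<bar>sgn x * E.A j \<bar>x\<bar> / \<kappa> j\<bar> \<le> L / \<omega> * exp (- \<rho> * \<bar>x\<bar>)" for j x
  proof -
    have "\<bar>sgn x\<bar> * \<bar>E.A j \<bar>x\<bar>\<bar> \<le> 1 * (L / \<omega> * \<kappa> j * exp (- \<rho> * \<bar>x\<bar>))"
      by (intro mult_mono A_bnd) (auto simp: sgn_if)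
    then show ?thesis using kappa_pos[of j] by (simp add: abs_mult divide_le_eq mult_ac)
  qed
  have co: "orth_system (IT T) (\<lambda>j t. cos (\<kappa> j * t)) (T / 2)" and so: "orth_system (IT T) (\<lambda>j t. sin (\<kappa> j * t)) (T / 2)"
    unfolding \<kappa>_def by (rule cos_orth_system[OF omega_pos T_def], rule sin_orth_system[OF omega_pos T_def])
  obtain wt where wt: "L2_D T wt" "\<And>\<eta>. L2_D T \<eta> \<Longrightarrow>
      (\<lambda>N. \<Sum>j<N. c j * intD T (\<lambda>x t. E.S j \<bar>x\<bar> * cos (\<kappa> j * t) * \<eta> x t)) \<longlonglongrightarrow> intD T (\<lambda>x t. wt x t * \<eta> x t)"
    by (rule L2_D_series[where a = "\<lambda>j x. E.S j \<bar>x\<bar>", OF co _ _ rho_pos S_abs_bnd c2]) auto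
  obtain wx where wx: "L2_D T wx" "\<And>\<eta>. L2_D T \<eta> \<Longrightarrow>
      (\<lambda>N. \<Sum>j<N. c j * intD T (\<lambda>x t. sgn x * E.A j \<bar>x\<bar> / \<kappa> j * sin (\<kappa> j * t) * \<eta> x t)) \<longlonglongrightarrow> intD T (\<lambda>x t. wx x t * \<eta> x t)"
    by (rule L2_D_series[where a = "\<lambda>j x. sgn x * E.A j \<bar>x\<bar> / \<kappa> j", OF so _ _ rho_pos A_abs c2]) auto
  have wx_mode: "c j * intD T (\<lambda>x t. sgn x * E.A j \<bar>x\<bar> / \<kappa> j * sin (\<kappa> j * t) * \<eta> x t)
      = c j / \<kappa> j * intD T (\<lambda>x t. sgn x * E.A j \<bar>x\<bar> * sin (\<kappa> j * t) * \<eta> x t)" for j \<eta>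
  proof -
    have "intD T (\<lambda>x t. sgn x * E.A j \<bar>x\<bar> / \<kappa> j * sin (\<kappa> j * t) * \<eta> x t)
        = intD T (\<lambda>x t. 1 / \<kappa> j * (sgn x * E.A j \<bar>x\<bar> * sin (\<kappa> j * t) * \<eta> x t))" by simp
    also have "\<dots> = 1 / \<kappa> j * intD T (\<lambda>x t. sgn x * E.A j \<bar>x\<bar> * sin (\<kappa> j * t) * \<eta> x t)"
      unfolding DT_integral[symmetric] by (rule integral_mult_right_zero)
    finally show ?thesis by simp
  qed
  have dt: "weak_dt_D T w wt"
    unfolding weak_dt_D_def
  proof (intro allI impI)
    fix \<psi> assume \<psi>: "test_fun_D T \<psi>"
    interpret t: test_function T \<psi> by unfold_locales (rule \<psi>)
    have "c j / \<kappa> j * intD T (\<lambda>x t. E.S j \<bar>x\<bar> * sin (\<kappa> j * t) * dt \<psi> x t) = - (c j * intD T (\<lambda>x t. E.S j \<bar>x\<bar> * cos (\<kappa> j * t) * \<psi> x t))" for j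
    proof -
      obtain C where "mode (q j) ((\<kappa> j)\<^sup>2 * B * M) \<rho> T \<psi> (\<kappa> j) C" using mode_test[OF \<psi>] by blast
      then interpret m: mode "q j" "(\<kappa> j)\<^sup>2 * B * M" \<rho> T \<psi> "\<kappa> j" C .
      show ?thesis using m.time_ibp(1)[of "\<lambda>x. E.S j \<bar>x\<bar>" C] m.S_bnd kappa_pos[of j] by simp
    qed
    then have "intD T (\<lambda>x t. w x t * dt \<psi> x t) = - intD T (\<lambda>x t. wt x t * \<psi> x t)"
      using LIMSEQ_unique[OF w_series_integral[OF t.L2(3)] ] tendsto_minus[OF wt(2)[OF t.L2(1)]] by (simp add: sum_negf)
    then show "integrableD T (\<lambda>x t. w x t * dt \<psi> x t) \<and> integrableD T (\<lambda>x t. wt x t * \<psi> x t) \<and>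
        intD T (\<lambda>x t. w x t * dt \<psi> x t) = - intD T (\<lambda>x t. wt x t * \<psi> x t)"
      using integrableD_mult[OF w_L2 t.L2(3)] integrableD_mult[OF wt(1) t.L2(1)] by simp
  qed
  have dx: "weak_dx_D T w wx"
    unfolding weak_dx_D_def
  proof (intro allI impI)
    fix \<psi> assume \<psi>: "test_fun_D T \<psi>"
    interpret t: test_function T \<psi> by unfold_locales (rule \<psi>)
    have "c j / \<kappa> j * intD T (\<lambda>x t. E.S j \<bar>x\<bar> * sin (\<kappa> j * t) * dx \<psi> x t) = - (c j * intD T (\<lambda>x t. sgn x * E.A j \<bar>x\<bar> / \<kappa> j * sin (\<kappa> j * t) * \<psi> x t))" for j
    proof -
      obtain C where "mode (q j) ((\<kappa> j)\<^sup>2 * B * M) \<rho> T \<psi> (\<kappa> j) C" using mode_test[OF \<psi>] by blast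
      then interpret m: mode "q j" "(\<kappa> j)\<^sup>2 * B * M" \<rho> T \<psi> "\<kappa> j" C .
      show ?thesis unfolding wx_mode m.mode_dx by simp
    qed
    then have "intD T (\<lambda>x t. w x t * dx \<psi> x t) = - intD T (\<lambda>x t. wx x t * \<psi> x t)"
      using LIMSEQ_unique[OF w_series_integral[OF t.L2(2)] ] tendsto_minus[OF wx(2)[OF t.L2(1)]] by (simp add: sum_negf)
    then show "integrableD T (\<lambda>x t. w x t * dx \<psi> x t) \<and> integrableD T (\<lambda>x t. wx x t * \<psi> x t) \<and>
        intD T (\<lambda>x t. w x t * dx \<psi> x t) = - intD T (\<lambda>x t. wx x t * \<psi> x t)"
      using integrableD_mult[OF w_L2 t.L2(2)] integrableD_mult[OF wx(1) t.L2(1)] by simp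
  qed
  have eqn: "intD T (\<lambda>x t. - G x * wt x t * dt \<psi> x t + wx x t * dx \<psi> x t) - \<gamma> * (LINT t:{0..T}|lborel. (v t) ^ 3 * dt \<psi> 0 t) = 0"
    if \<psi>: "test_fun_D T \<psi>" for \<psi>
  proof -
    interpret t: test_function T \<psi> by unfold_locales (rule \<psi>)
    obtain D where D: "0 \<le> D" "\<And>x t. 0 \<le> t \<Longrightarrow> t \<le> T \<Longrightarrow> \<bar>dt \<psi> x t\<bar> \<le> D * exp (- \<rho> * \<bar>x\<bar>)"
      using t.exp_bound(3) by blast
    have Gm: "(\<lambda>z :: real \<times> real. G (fst z)) \<in> borel_measurable borel"
      unfolding borel_prod[symmetric] by measurable
    \<comment> \<open>The coefficient is moved to the test function, because \<open>wt\<close> is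
      accessible through its pairings.\<close>
    have G\<psi>: "L2_D T (\<lambda>x t. G x * dt \<psi> x t)"
    proof (rule L2_D_exp_bound[OF _ rho_pos, where C = "B * D"])
      show "(\<lambda>z. G (fst z) * dt \<psi> (fst z) (snd z)) \<in> borel_measurable borel"
        by (intro borel_measurable_times Gm t.meas)
      show "\<bar>G x * dt \<psi> x t\<bar> \<le> B * D * exp (- \<rho> * \<bar>x\<bar>)" if "0 \<le> t" "t \<le> T" for x t
        using mult_mono[OF G_bnd[of x] D(2)[OF that, of x]] B_nonneg by (simp add: abs_mult mult.assoc)
    qed
    let ?I = "\<lambda>j. intD T (\<lambda>x t. E.S j \<bar>x\<bar> * cos (\<kappa> j * t) * (G x * dt \<psi> x t))"
    let ?J = "\<lambda>j. \<integral>t. cos (\<kappa> j * t) * dt \<psi> 0 t \<partial>IT T"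
    \<comment> \<open>Since q is -\<kappa>^2 S G, the volume term of the mode becomes a term of the
      pairing of \<open>wt\<close> with \<open>G \<psi>_t\<close>; the rest is a term of the
      Euler-Lagrange series.\<close>
    have mode_eq: "c j * intD T (\<lambda>x t. sgn x * E.A j \<bar>x\<bar> / \<kappa> j * sin (\<kappa> j * t) * dx \<psi> x t)
        = - 2 * E.A j 0 / (\<kappa> j)\<^sup>2 * c j * ?J j + c j * ?I j" for j
    proof -
      obtain C where "mode (q j) ((\<kappa> j)\<^sup>2 * B * M) \<rho> T \<psi> (\<kappa> j) C" using mode_test[OF \<psi>] by blast
      then interpret m: mode "q j" "(\<kappa> j)\<^sup>2 * B * M" \<rho> T \<psi> "\<kappa> j" C .
      \<comment> \<open>At x = 0 the left-hand q is 0 by definition, whereas S G need not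
        be.\<close>
      have "AE x in lborel. x \<noteq> (0::real)" by (rule AE_lborel_singleton)
      then have ae: "AE x in lborel. \<forall>t. q j \<bar>x\<bar> * cos (\<kappa> j * t) * dt \<psi> x t = - (\<kappa> j)\<^sup>2 * (E.S j \<bar>x\<bar> * G x) * cos (\<kappa> j * t) * dt \<psi> x t"
        by eventually_elim (simp add: q_abs)
      have b: "\<bar>- (\<kappa> j)\<^sup>2 * (E.S j \<bar>x\<bar> * G x)\<bar> \<le> (\<kappa> j)\<^sup>2 * (C * B)" for x
      proof -
        have "0 \<le> C" using m.S_bnd[of 0] by simp
        then have "\<bar>E.S j \<bar>x\<bar>\<bar> * \<bar>G x\<bar> \<le> C * B" using m.S_bnd[of "\<bar>x\<bar>"] by (intro mult_mono G_bnd) auto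
        then show ?thesis by (simp add: abs_mult mult_left_mono)
      qed
      have "intD T (\<lambda>x t. q j \<bar>x\<bar> * cos (\<kappa> j * t) * dt \<psi> x t)
          = intD T (\<lambda>x t. - (\<kappa> j)\<^sup>2 * (E.S j \<bar>x\<bar> * G x) * cos (\<kappa> j * t) * dt \<psi> x t)"
        by (rule intD_cong_AE[OF ae m.mode_integrable(3)[OF _ _ E.q_le] m.mode_integrable(3)[OF _ _ b]]) auto
      also have "\<dots> = intD T (\<lambda>x t. - (\<kappa> j)\<^sup>2 * (E.S j \<bar>x\<bar> * cos (\<kappa> j * t) * (G x * dt \<psi> x t)))"
        by (simp add: mult_ac)
      also have "\<dots> = - (\<kappa> j)\<^sup>2 * ?I j"
        unfolding DT_integral[symmetric] by (rule integral_mult_right_zero)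
      finally have qI: "intD T (\<lambda>x t. q j \<bar>x\<bar> * cos (\<kappa> j * t) * dt \<psi> x t) = - (\<kappa> j)\<^sup>2 * ?I j" .
      show ?thesis unfolding wx_mode m.mode_equation qI using kappa_pos[of j] by (simp add: field_simps power2_eq_square)
    qed
    \<comment> \<open>The two volume series converge separately as L^2 pairings; their difference is
      the trace series, whose sum is known from the Euler-Lagrange identity.\<close>
    have "(\<lambda>N. (\<Sum>j<N. c j * intD T (\<lambda>x t. sgn x * E.A j \<bar>x\<bar> / \<kappa> j * sin (\<kappa> j * t) * dx \<psi> x t)) - (\<Sum>j<N. c j * ?I j))
        \<longlonglongrightarrow> intD T (\<lambda>x t. wx x t * dx \<psi> x t) - intD T (\<lambda>x t. wt x t * (G x * dt \<psi> x t))"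
      by (intro tendsto_diff wx(2) wt(2) t.L2 G\<psi>)
    then have "(\<lambda>N. \<Sum>j<N. - 2 * E.A j 0 / (\<kappa> j)\<^sup>2 * c j * ?J j)
        \<longlonglongrightarrow> intD T (\<lambda>x t. wx x t * dx \<psi> x t) - intD T (\<lambda>x t. wt x t * (G x * dt \<psi> x t))"
      unfolding mode_eq sum.distrib by simp
    moreover have "(\<lambda>N. \<Sum>j<N. - 2 * E.A j 0 / (\<kappa> j)\<^sup>2 * c j * ?J j) \<longlonglongrightarrow> \<gamma> * (\<integral>t. v t ^ 3 * dt \<psi> 0 t \<partial>IT T)"
      using Euler_Lagrange[OF t.cont_t(3)] unfolding sums_def .
    ultimately have "intD T (\<lambda>x t. wx x t * dx \<psi> x t) - intD T (\<lambda>x t. wt x t * (G x * dt \<psi> x t)) = \<gamma> * (\<integral>t. v t ^ 3 * dt \<psi> 0 t \<partial>IT T)"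
      by (rule LIMSEQ_unique)
    moreover have "intD T (\<lambda>x t. - G x * wt x t * dt \<psi> x t + wx x t * dx \<psi> x t)
        = intD T (\<lambda>x t. wx x t * dx \<psi> x t) - intD T (\<lambda>x t. wt x t * (G x * dt \<psi> x t))"
    proof -
      have i: "integrable (DT T) (\<lambda>z. wx (fst z) (snd z) * dx \<psi> (fst z) (snd z))"
        "integrable (DT T) (\<lambda>z. wt (fst z) (snd z) * (G (fst z) * dt \<psi> (fst z) (snd z)))"
        using integrableD_mult[OF wx(1) t.L2(2)] integrableD_mult[OF wt(1) G\<psi>]
          DT_integrable[where F = "\<lambda>x t. wx x t * dx \<psi> x t"] DT_integrable[where F = "\<lambda>x t. wt x t * (G x * dt \<psi> x t)"] by auto
      have "intD T (\<lambda>x t. - G x * wt x t * dt \<psi> x t + wx x t * dx \<psi> x t)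
         = intD T (\<lambda>x t. wx x t * dx \<psi> x t - wt x t * (G x * dt \<psi> x t))" by (simp add: algebra_simps)
      also have "\<dots> = intD T (\<lambda>x t. wx x t * dx \<psi> x t) - intD T (\<lambda>x t. wt x t * (G x * dt \<psi> x t))"
        unfolding DT_integral[symmetric] by (rule Bochner_Integration.integral_diff[OF i])
      finally show ?thesis .
    qed
    ultimately show ?thesis unfolding IT_integral by simp
  qed
  have vm: "(\<lambda>t. indicator {0..T} t * v t) \<in> borel_measurable lborel"
    using v_meas by (simp add: borel_measurable_restrict_space_iff)
  have v3: "set_integrable lborel {0..T} (\<lambda>t. \<bar>v t\<bar> ^ 3)"
    using v_cube unfolding IT_integrable .
  show ?thesis
    unfolding weak_solution_def Let_def T_def[symmetric]
    using w_cont w_periodic w_L2 wx(1) wt(1) dx dt trace_derivative vm v3 eqn by blast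
qed

end

text \<open>The coefficient enters only under an integral over the strip, and a null set of x gives
  a null set of pairs.\<close>

lemma weak_solution_cong_AE:
  assumes sol: "weak_solution G \<gamma> \<omega> w" and ae: "AE x in lborel. G x = g x"
    and G: "G \<in> borel_measurable borel" and g: "g \<in> borel_measurable borel"
  shows "weak_solution g \<gamma> \<omega> w"
proof -
  define T where "T = 2 * pi / \<omega>"
  have int: "intD T (\<lambda>x t. - G x * wt x t * dt \<psi> x t + wx x t * dx \<psi> x t) = intD T (\<lambda>x t. - g x * wt x t * dt \<psi> x t + wx x t * dx \<psi> x t)"
    if "L2_D T wx" "L2_D T wt" "test_fun_D T \<psi>" for wx wt \<psi>
  proof -
    interpret t: test_function T \<psi> by unfold_locales (rule that)
    have restr: "f \<in> borel_measurable (DT T)" if "f \<in> borel_measurable borel" for f :: "real \<times> real \<Rightarrow> real"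
      using that by (intro measurable_restrict_space1) simp
    have fm: "(\<lambda>z :: real \<times> real. f (fst z)) \<in> borel_measurable borel" if "f \<in> borel_measurable borel" for f :: "real \<Rightarrow> real"
      using that unfolding borel_prod[symmetric] by measurable
    note [measurable] = restr[OF fm[OF G]] restr[OF fm[OF g]] t.meas[THEN restr]
    have [measurable]: "(\<lambda>z. wt (fst z) (snd z)) \<in> borel_measurable (DT T)" "(\<lambda>z. wx (fst z) (snd z)) \<in> borel_measurable (DT T)"
      using that by (auto simp: L2_D_iff)
    have "AE z in lborel. G (fst z) = g (fst (z :: real \<times> real))" by (rule AE_lborel_fst[OF ae])
    then have "AE z in DT T. G (fst z) = g (fst z)"
      using strip_borel by (subst AE_restrict_space_iff) auto
    then show ?thesis
      unfolding DT_integral[symmetric] by (intro integral_cong_AE) (measurable, auto)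
  qed
  obtain wx wt v where reg: "continuous_on UNIV (\<lambda>z. w (fst z) (snd z))" "\<forall>x t. w x (t + T) = w x t" "L2_D T w"
    "L2_D T wx" "L2_D T wt" "weak_dx_D T w wx" "weak_dt_D T w wt" "weak_deriv_T T (\<lambda>t. w 0 t) v"
    "(\<lambda>t. indicator {0..T} t * v t) \<in> borel_measurable lborel" "set_integrable lborel {0..T} (\<lambda>t. \<bar>v t\<bar> ^ 3)"
    and eqn: "\<forall>\<psi>. test_fun_D T \<psi> \<longrightarrow> intD T (\<lambda>x t. - G x * wt x t * dt \<psi> x t + wx x t * dx \<psi> x t)
        - \<gamma> * (LINT t:{0..T}|lborel. (v t) ^ 3 * dt \<psi> 0 t) = 0"
    using sol unfolding weak_solution_def Let_def T_def[symmetric] by blast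
  have "\<forall>\<psi>. test_fun_D T \<psi> \<longrightarrow> intD T (\<lambda>x t. - g x * wt x t * dt \<psi> x t + wx x t * dx \<psi> x t)
        - \<gamma> * (LINT t:{0..T}|lborel. (v t) ^ 3 * dt \<psi> 0 t) = 0"
    using eqn int[OF reg(4,5)] by simp
  with reg show ?thesis unfolding weak_solution_def Let_def T_def[symmetric] by blast
qed

context wave_modes
begin

lemma ex_solution:
  assumes \<gamma>: "\<gamma> \<noteq> 0" and j0: "0 < - sgn \<gamma> * E.A j0 0"
  shows "\<exists>w. weak_solution G \<gamma> \<omega> w \<and> \<not> (\<forall>x t. w x t = 0) \<and> (\<exists>C>0. \<forall>x t. \<bar>w x t\<bar> \<le> C * exp (- \<rho> * \<bar>x\<bar>))"
proof -
  \<comment> \<open>Chosen so that sgn \<gamma> times 2/T times b j is the jump coefficient -2 A 0 /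
    \<kappa>^2. The minimisation runs with |\<gamma>|, and multiplication by sgn \<gamma> restores
    the sign afterwards.\<close>
  define b where "b j = - sgn \<gamma> * T * E.A j 0 / (\<kappa> j)\<^sup>2" for j
  \<comment> \<open>Linear growth of A 0 against \<kappa>^2 leaves order 1/(2j+1), which is square
    summable.\<close>
  have "(b j)\<^sup>2 \<le> (T * L / \<omega>\<^sup>2)\<^sup>2 * (1 / (real (2 * j + 1))\<^sup>2)" for j
  proof -
    have "\<bar>b j\<bar> = T * \<bar>E.A j 0\<bar> / (\<kappa> j)\<^sup>2"
      using \<gamma> T_pos by (simp add: b_def abs_mult abs_sgn_eq)
    also have "\<dots> \<le> T * (L / \<omega> * \<kappa> j) / (\<kappa> j)\<^sup>2"
      using A_bnd[of 0 j] T_pos by (intro divide_right_mono mult_left_mono) auto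
    also have "\<dots> = T * L / \<omega>\<^sup>2 * (1 / real (2 * j + 1))"
      using omega_pos by (simp add: \<kappa>_def power2_eq_square field_simps del: of_nat_add of_nat_mult of_nat_Suc)
    finally have "\<bar>b j\<bar>\<^sup>2 \<le> (T * L / \<omega>\<^sup>2 * (1 / real (2 * j + 1)))\<^sup>2" by (intro power_mono) auto
    also have "\<dots> = (T * L / \<omega>\<^sup>2)\<^sup>2 * (1 / (real (2 * j + 1))\<^sup>2)" unfolding power_mult_distrib power_one_over ..
    finally show ?thesis by simp
  qed
  then have b2: "summable (\<lambda>j. (b j)\<^sup>2)"
    by (intro summable_comparison_test[OF _ summable_mult[OF summable_inverse_odd_squares]]) auto
  have "b j0 = (- sgn \<gamma> * E.A j0 0) * (T / (\<kappa> j0)\<^sup>2)" by (simp add: b_def)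
  also have "\<dots> > 0" using j0 T_pos kappa_pos[of j0] by (intro mult_pos_pos[OF j0]) auto
  finally have bpos: "0 < b j0" .
  have a: "0 < \<bar>\<gamma>\<bar>" using \<gamma> by simp
  obtain c v where cv: "v \<in> borel_measurable (IT T)" "integrable (IT T) (\<lambda>t. v t ^ 4)"
    "summable (\<lambda>j. (c j)\<^sup>2)" "\<exists>j. c j \<noteq> 0"
    "(\<lambda>N. \<integral>t. (v t - (\<Sum>j<N. c j * cos (\<kappa> j * t)))\<^sup>2 \<partial>IT T) \<longlonglongrightarrow> 0"
    and EL: "\<And>\<phi>. continuous_on {0..T} \<phi> \<Longrightarrow>
      (\<lambda>j. 2 / T * b j * c j * (\<integral>t. cos (\<kappa> j * t) * \<phi> t \<partial>IT T)) sums (\<bar>\<gamma>\<bar> * (\<integral>t. v t ^ 3 * \<phi> t \<partial>IT T))"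
    by (rule periodic_minimizer[OF omega_pos T_def a b2 bpos, folded \<kappa>_def]) (rule that)
  interpret s: wave_solution G \<omega> \<rho> M B \<Phi> \<gamma> c v
  proof (unfold_locales, fact cv, fact cv, fact cv, fact cv, fact cv)
    fix \<phi> :: "real \<Rightarrow> real" assume "continuous_on {0..T} \<phi>"
    from sums_mult[OF EL[OF this], of "sgn \<gamma>"]
    have "(\<lambda>j. sgn \<gamma> * (2 / T * b j * c j * (\<integral>t. cos (\<kappa> j * t) * \<phi> t \<partial>IT T))) sums (sgn \<gamma> * (\<bar>\<gamma>\<bar> * (\<integral>t. v t ^ 3 * \<phi> t \<partial>IT T)))" .
    moreover have "sgn \<gamma> * (2 / T * b j * c j * X) = - 2 * E.A j 0 / (\<kappa> j)\<^sup>2 * c j * X" for j X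
    proof -
      have "sgn \<gamma> * sgn \<gamma> = 1" using \<gamma> by (simp add: sgn_if)
      then have e: "sgn \<gamma> * (2 / T * b j) = - 2 * E.A j 0 / (\<kappa> j)\<^sup>2"
        using T_pos by (simp add: b_def field_simps)
      have "sgn \<gamma> * (2 / T * b j * c j * X) = sgn \<gamma> * (2 / T * b j) * c j * X" by (simp only: mult.assoc)
      then show ?thesis unfolding e .
    qed
    moreover have "sgn \<gamma> * (\<bar>\<gamma>\<bar> * Y) = \<gamma> * Y" for Y by (simp add: mult.assoc[symmetric] sgn_mult_abs)
    ultimately show "(\<lambda>j. - 2 * E.A j 0 / (\<kappa> j)\<^sup>2 * c j * (\<integral>t. cos (\<kappa> j * t) * \<phi> t \<partial>IT T)) sums (\<gamma> * (\<integral>t. v t ^ 3 * \<phi> t \<partial>IT T))"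
      by simp
  qed
  \<comment> \<open>The added 1 makes the constant strictly positive.\<close>
  have "\<bar>s.w x t\<bar> \<le> (s.C + 1) * exp (- \<rho> * \<bar>x\<bar>)" for x t
    using s.w_bnd[of x t] by (simp add: distrib_right add_increasing2)
  then have "\<exists>C>0. \<forall>x t. \<bar>s.w x t\<bar> \<le> C * exp (- \<rho> * \<bar>x\<bar>)"
    using s.C_nonneg by (intro exI[of _ "s.C + 1"]) auto
  then show ?thesis using s.solution s.w_nontrivial by blast
qed

end

theorem theorem1p5:
  fixes g :: "real \<Rightarrow> real" and \<omega> \<gamma> \<rho> M :: real and \<Phi> :: "nat \<Rightarrow> real \<Rightarrow> real"
  assumes omega_pos: "0 < \<omega>"
    and C0_meas: "g \<in> borel_measurable lborel"
    and C0_bdd: "\<exists>B. AE x in lborel. \<bar>g x\<bar> \<le> B"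
    and C0_even: "AE x in lborel. g (- x) = g x"
    and C0_nonzero: "\<not> (AE x in lborel. g x = 0)"
    and C0_gamma: "\<gamma> \<noteq> 0"
    and C1: "\<And>k. odd k \<Longrightarrow>
        0 \<notin> ess_spectrum (Lk_graph g \<omega> k) \<union> spectrum_op (LkD_graph g \<omega> k)"
    and Phi: "\<And>k. odd k \<Longrightarrow> is_Phi g \<omega> k (\<Phi> k)"
    and C2_pos: "0 < \<rho>" "0 < M"
    and C2: "\<And>k x. odd k \<Longrightarrow> 0 \<le> x \<Longrightarrow> \<bar>\<Phi> k x\<bar> \<le> M * exp (- \<rho> * x)"
    and sign: "(\<gamma> < 0 \<and> (\<exists>k d. odd k \<and> (\<Phi> k has_real_derivative d) (at 0 within {0..}) \<and> 0 < d))
             \<or> (\<gamma> > 0 \<and> (\<exists>k d. odd k \<and> (\<Phi> k has_real_derivative d) (at 0 within {0..}) \<and> d < 0))"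
  shows "\<exists>w. weak_solution g \<gamma> \<omega> w \<and> \<not> (\<forall>x t. w x t = 0) \<and>
           (\<exists>C>0. \<forall>x t. \<bar>w x t\<bar> \<le> C * exp (- \<rho> * \<bar>x\<bar>))"
proof -
  obtain B where B: "AE x in lborel. \<bar>g x\<bar> \<le> B" using C0_bdd by blast
  \<comment> \<open>Composition with |x| and clipping make evenness and the bound hold at every
    point; the absolute value of B keeps the clipping interval nonempty.\<close>
  define G where "G x = max (- \<bar>B\<bar>) (min \<bar>B\<bar> (g \<bar>x\<bar>))" for x
  have gm[measurable]: "g \<in> borel_measurable borel" using C0_meas by simp
  have Gm: "G \<in> borel_measurable borel" unfolding G_def by measurable
  have Gg: "AE x in lborel. G x = g x"
    using B C0_even
  proof eventually_elim
    case (elim x)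
    have "g \<bar>x\<bar> = g x" using elim(2) by (simp add: abs_if)
    then show ?case using elim(1) unfolding G_def by auto
  qed
  have PhiG: "is_Phi G \<omega> k (\<Phi> k)" if k: "odd k" for k
  proof -
    obtain p1 p2 where p: "L2_on {0<..} p1" "L2_on {0<..} p2" "weak_deriv_on {0<..} (\<Phi> k) p1" "weak_deriv_on {0<..} p1 p2"
      "AE x in lborel. 0 < x \<longrightarrow> - p2 x - (real k)\<^sup>2 * \<omega>\<^sup>2 * g x * \<Phi> k x = 0"
      using Phi[OF k] unfolding is_Phi_def by blast
    have "AE x in lborel. 0 < x \<longrightarrow> - p2 x - (real k)\<^sup>2 * \<omega>\<^sup>2 * G x * \<Phi> k x = 0"
      using p(5) Gg by eventually_elim simp
    then show ?thesis using Phi[OF k] p unfolding is_Phi_def by blast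
  qed
  interpret wave_modes G \<omega> \<rho> M "\<bar>B\<bar>" \<Phi>
  proof
    show "\<bar>G x\<bar> \<le> \<bar>B\<bar>" for x unfolding G_def by auto
  qed (use omega_pos C2_pos Gm PhiG C2 in \<open>auto simp: G_def\<close>)
  \<comment> \<open>Both sign cases say that -sgn \<gamma> times the one-sided slope is positive for
    some odd k.\<close>
  have "\<exists>j. 0 < - sgn \<gamma> * E.A j 0"
  proof -
    obtain k d where k: "odd k" "(\<Phi> k has_real_derivative d) (at 0 within {0..})" "0 < - sgn \<gamma> * d"
      using sign by (auto simp: sgn_if)
    then obtain j where "k = 2 * j + 1" by (elim oddE)
    with k deriv_at_0[of j d] show ?thesis by auto
  qed
  then obtain w where w: "weak_solution G \<gamma> \<omega> w" "\<not> (\<forall>x t. w x t = 0)"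
    "\<exists>C>0. \<forall>x t. \<bar>w x t\<bar> \<le> C * exp (- \<rho> * \<bar>x\<bar>)"
    using ex_solution[OF C0_gamma] by blast
  then show ?thesis using weak_solution_cong_AE[OF w(1) Gg Gm gm] by blast
qed

end
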